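(* Consider the CTMDP $\{S,A,q,c\}$ described in the context, assume $\bar c(x):=\sup_{a\in A}c(x,a)<\infty$ for every $x\in S$, and call a $[1,\infty]$-valued function $V$ on $S$ a solution to the optimality equation if $$0=\inf_{a\in A}\left\{c(x,a)V(x)+\int_S q(dy|x,a)V(y)\right\}$$ for each $x\in S$ with $V(x)<\infty$. (a) Suppose there is a continuous $[1,\infty)$-valued Borel function $w$ on $S$ with $w(x)\ge1+\bar c(x)+\bar q_x$ for all $x\in S$; for each bounded continuous $f$ on $S$, $(x,a)\mapsto\int_S f(y)\tilde q(dy|x,a)$ is continuous on $S\times A$; $c$ is lower semicontinuous on $S\times A$; and $A$ is compact. Then $V^\ast$ is the minimal $[1,\infty]$-valued lower semicontinuous solution to the optimality equation. (b) Suppose for each bounded measurable $f$ on $S$ and each $x\in S$, $a\mapsto\int_S f(y)\tilde q(dy|x,a)$ is continuous on $A$; for each $x\in S$, $a\mapsto c(x,a)$ is lower semicontinuous; and $A$ is compact. Then $V^\ast$ is the minimal $[1,\infty]$-valued measurable solution to the optimality equation.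
   Context: $S$, $A$ are nonempty Borel spaces. The transition rate $q(dy|x,a)$ is a signed kernel on $\mathcal B(S)$ given $(x,a)\in S\times A$ with $\tilde q(\Gamma|x,a):=q(\Gamma\setminus\{x\}|x,a)\ge0$ for all $\Gamma\in\mathcal B(S)$, $q(S|x,a)=0$, and $\bar q_x:=\sup_{a\in A}q_x(a)<\infty$, where $q_x(a):=-q(\{x\}|x,a)$. The cost rate $c:S\times A\to[0,\infty)$ is measurable. Adjoin an isolated point $x_\infty\notin S$ and put $c(x_\infty,\cdot)=0$, $q_{x_\infty}(\cdot)=0$, $\tilde q(\cdot|x_\infty,\cdot)=0$. For a probability measure $\mu$ on $A$ write $q_x(\mu)=\int_A q_x(a)\mu(da)$, $\tilde q(dy|x,\mu)=\int_A\tilde q(dy|x,a)\mu(da)$. A policy $\pi=(\pi_n)_{n\ge0}$ is a sequence of stochastic kernels $\pi_n(da|x_0,\theta_1,x_1,\dots,\theta_n,x_n,s)$ on $A$ given $(x_0,\theta_1,\dots,\theta_n,x_n)\in S\times((0,\infty)\times S)^n$ and $s\in(0,\infty)$. For $x\in S$, $P_x^\pi$ is the probability measure on sequences $\omega=(x_0,\theta_1,x_1,\dots)$ ($\theta_n\in(0,\infty]$, $x_n\in S\cup\{x_\infty\}$, entries $(\infty,x_\infty)$ after the first infinite $\theta$) with $x_0=x$ and, on $\{x_n\in S\}$, writing $\pi_n(\cdot|s)=\pi_n(\cdot|x_0,\dots,x_n,s)$: $P_x^\pi(\theta_{n+1}\in\Gamma_1,x_{n+1}\in\Gamma_2|x_0,\dots,x_n)=\int_{\Gamma_1}e^{-\int_0^t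 q_{x_n}(\pi_n(\cdot|s))ds}\tilde q(\Gamma_2|x_n,\pi_n(\cdot|t))dt$, $P_x^\pi(\theta_{n+1}=\infty,x_{n+1}=x_\infty|x_0,\dots,x_n)=e^{-\int_0^\infty q_{x_n}(\pi_n(\cdot|s))ds}$; on $\{x_n=x_\infty\}$, $(\theta_{n+1},x_{n+1})=(\infty,x_\infty)$ a.s. The criterion is $V(x,\pi)=E_x^\pi\big[\exp\big(\sum_{n\ge0}\int_0^{\theta_{n+1}}\int_A c(x_n,a)\pi_n(da|x_0,\dots,x_n,s)ds\big)\big]$ and $V^\ast(x)=\inf_\pi V(x,\pi)$. Conventions: $0/0=0$, $0\cdot\infty=0$, $1/0=+\infty$, $\infty-\infty=\infty$. *)

theory Defs
  imports "HOL-Probability.Probability"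
begin

text \<open>State space S and action space A are Borel subsets of Polish spaces (standard Borel
spaces), carrying the subspace topology and the trace Borel sigma-algebra.
The transition rate q is encoded through its off-diagonal part qt = q-tilde:
qt x a is a finite measure on S with no mass at x; the jump intensity is
q_x(a) = qt(S|x,a) (since q(S|x,a) = 0), and q(Gamma|x,a) = qt(Gamma|x,a) - q_x(a)
if x is in Gamma, qt(Gamma|x,a) otherwise.  The cemetery x_infinity is encoded as None.\<close>

definition qrate :: "'s set \<Rightarrow> ('s \<Rightarrow> 'b \<Rightarrow> 's measure) \<Rightarrow> 's \<Rightarrow> 'b \<Rightarrow> real" where
  "qrate S qt x a = measure (qt x a) S"

definition ctmdp ::
  "'s::polish_space set \<Rightarrow> 'b::polish_space set \<Rightarrow> ('s \<Rightarrow> 'b \<Rightarrow> 's measure) \<Rightarrow> ('s \<Rightarrow> 'b \<Rightarrow> real) \<Rightarrow> bool"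
where
  "ctmdp S A qt c \<longleftrightarrow>
     S \<in> sets borel \<and> S \<noteq> {} \<and> A \<in> sets borel \<and> A \<noteq> {} \<and>
     (\<forall>x\<in>S. \<forall>a\<in>A. sets (qt x a) = sets (restrict_space borel S) \<and> emeasure (qt x a) {x} = 0) \<and>
     (\<forall>x\<in>S. (SUP a\<in>A. emeasure (qt x a) S) < \<top>) \<and>
     (\<forall>\<Gamma>\<in>sets (restrict_space borel S).
        (\<lambda>(x, a). emeasure (qt x a) \<Gamma>) \<in> borel_measurable (restrict_space borel S \<Otimes>\<^sub>M restrict_space borel A)) \<and>
     (\<forall>x\<in>S. \<forall>a\<in>A. 0 \<le> c x a) \<and>
     (\<lambda>(x, a). c x a) \<in> borel_measurable (restrict_space borel S \<Otimes>\<^sub>M restrict_space borel A)"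

definition Sinf :: "'s::topological_space set \<Rightarrow> 's option measure" where
  "Sinf S = sigma (insert None (Some ` S))
              (insert {None} ((\<lambda>B. Some ` B) ` sets (restrict_space borel S)))"

text \<open>Coordinate space of the trajectory: coordinate n is (theta_n, x_n), theta_n in [0,infinity]
(theta_0 is a dummy 0).\<close>
definition Mst :: "'s::topological_space set \<Rightarrow> (ennreal \<times> 's option) measure" where
  "Mst S = (borel :: ennreal measure) \<Otimes>\<^sub>M Sinf S"

type_synonym ('s, 'b) policy = "nat \<Rightarrow> (nat \<Rightarrow> ennreal \<times> 's option) \<Rightarrow> real \<Rightarrow> 'b measure"

definition is_policy :: "'s::topological_space set \<Rightarrow> 'b::topological_space set \<Rightarrow> ('s, 'b) policy \<Rightarrow> bool" where
  "is_policy S A pol \<longleftrightarrow>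
     (\<forall>n. (\<lambda>(h, s). pol n h s) \<in>
        measurable (PiM {0..<Suc n} (\<lambda>_. Mst S) \<Otimes>\<^sub>M (borel :: real measure)) (prob_algebra (restrict_space borel A)))"

definition ennexp_neg :: "ennreal \<Rightarrow> ennreal" where
  "ennexp_neg L = (if L = \<top> then 0 else ennreal (exp (- enn2real L)))"

definition ennexp :: "ennreal \<Rightarrow> ennreal" where
  "ennexp L = (if L = \<top> then \<top> else ennreal (exp (enn2real L)))"

definition qmix :: "'s::topological_space set \<Rightarrow> ('s \<Rightarrow> 'b \<Rightarrow> 's measure) \<Rightarrow> 's \<Rightarrow> 'b measure \<Rightarrow> 's measure" where
  "qmix S qt z \<mu> = measure_of S (sets (restrict_space borel S)) (\<lambda>\<Gamma>. \<integral>\<^sup>+ a. emeasure (qt z a) \<Gamma> \<partial>\<mu>)"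

definition Lam :: "'s set \<Rightarrow> ('s \<Rightarrow> 'b \<Rightarrow> 's measure) \<Rightarrow> ('s, 'b) policy \<Rightarrow> nat
    \<Rightarrow> (nat \<Rightarrow> ennreal \<times> 's option) \<Rightarrow> 's \<Rightarrow> ennreal \<Rightarrow> ennreal" where
  "Lam S qt pol n h z t =
     (\<integral>\<^sup>+ s. indicator {s. 0 < s \<and> ennreal s < t} s * (\<integral>\<^sup>+ a. ennreal (qrate S qt z a) \<partial>pol n h s) \<partial>lborel)"

text \<open>Conditional law of (theta_{n+1}, x_{n+1}) given the history h on {0..n} with x_n = z in S.\<close>
definition jump :: "'s::topological_space set \<Rightarrow> ('s \<Rightarrow> 'b \<Rightarrow> 's measure) \<Rightarrow> ('s, 'b) policy \<Rightarrow> nat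
    \<Rightarrow> (nat \<Rightarrow> ennreal \<times> 's option) \<Rightarrow> 's \<Rightarrow> (ennreal \<times> 's option) measure" where
  "jump S qt pol n h z = measure_of (space (Mst S)) (sets (Mst S))
     (\<lambda>B. (\<integral>\<^sup>+ t. indicator {0<..} t * ennexp_neg (Lam S qt pol n h z (ennreal t))
              * emeasure (qmix S qt z (pol n h t)) {y\<in>S. (ennreal t, Some y) \<in> B} \<partial>lborel)
          + ennexp_neg (Lam S qt pol n h z \<top>) * indicator B (\<top>, None))"

definition trans :: "'s::topological_space set \<Rightarrow> ('s \<Rightarrow> 'b \<Rightarrow> 's measure) \<Rightarrow> ('s, 'b) policy \<Rightarrow> 's
    \<Rightarrow> nat \<Rightarrow> (nat \<Rightarrow> ennreal \<times> 's option) \<Rightarrow> (ennreal \<times> 's option) measure" where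
  "trans S qt pol x n h = (case n of
       0 \<Rightarrow> return (Mst S) (0, Some x)
     | Suc m \<Rightarrow> (case snd (h m) of
           Some z \<Rightarrow> jump S qt pol m (restrict h {0..<Suc m}) z
         | None \<Rightarrow> return (Mst S) (\<top>, None)))"

definition Pth :: "'s::topological_space set \<Rightarrow> ('s \<Rightarrow> 'b \<Rightarrow> 's measure) \<Rightarrow> ('s, 'b) policy \<Rightarrow> 's
    \<Rightarrow> (nat \<Rightarrow> ennreal \<times> 's option) measure" where
  "Pth S qt pol x = projective_family.lim UNIV
      (Ionescu_Tulcea.CI (trans S qt pol x) (\<lambda>_. Mst S)) (\<lambda>_. Mst S)"

definition pathcost :: "('s \<Rightarrow> 'b \<Rightarrow> real) \<Rightarrow> ('s, 'b) policy \<Rightarrow> (nat \<Rightarrow> ennreal \<times> 's option) \<Rightarrow> ennreal" where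
  "pathcost c pol \<omega> = (\<Sum>n. (case snd (\<omega> n) of
        None \<Rightarrow> 0
      | Some z \<Rightarrow> \<integral>\<^sup>+ s. indicator {s. 0 < s \<and> ennreal s < fst (\<omega> (Suc n))} s
                      * (\<integral>\<^sup>+ a. ennreal (c z a) \<partial>pol n (restrict \<omega> {0..<Suc n}) s) \<partial>lborel))"

definition Vcrit :: "'s::topological_space set \<Rightarrow> ('s \<Rightarrow> 'b \<Rightarrow> 's measure) \<Rightarrow> ('s \<Rightarrow> 'b \<Rightarrow> real)
    \<Rightarrow> ('s, 'b) policy \<Rightarrow> 's \<Rightarrow> ennreal" where
  "Vcrit S qt c pol x = (\<integral>\<^sup>+ \<omega>. ennexp (pathcost c pol \<omega>) \<partial>Pth S qt pol x)"

definition Vstar :: "'s::topological_space set \<Rightarrow> 'b::topological_space set \<Rightarrow> ('s \<Rightarrow> 'b \<Rightarrow> 's measure)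
    \<Rightarrow> ('s \<Rightarrow> 'b \<Rightarrow> real) \<Rightarrow> 's \<Rightarrow> ennreal" where
  "Vstar S A qt c x = (INF pol \<in> {pol. is_policy S A pol}. Vcrit S qt c pol x)"

text \<open>Optimality equation 0 = inf_a { c(x,a)V(x) + int_S q(dy|x,a) V(y) } at every x with V(x) finite;
  int_S q(dy|x,a)V(y) = int V dqt(.|x,a) - q_x(a) V(x).\<close>
definition opt_eq :: "'s set \<Rightarrow> 'b set \<Rightarrow> ('s \<Rightarrow> 'b \<Rightarrow> 's measure) \<Rightarrow> ('s \<Rightarrow> 'b \<Rightarrow> real)
    \<Rightarrow> ('s \<Rightarrow> ennreal) \<Rightarrow> bool" where
  "opt_eq S A qt c V \<longleftrightarrow>
     (\<forall>x\<in>S. V x < \<top> \<longrightarrow>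
        (INF a\<in>A. ereal (c x a * enn2real (V x)) + enn2ereal (\<integral>\<^sup>+ y. V y \<partial>qt x a)
                   - ereal (qrate S qt x a * enn2real (V x))) = 0)"

definition lsc_on :: "'a::topological_space set \<Rightarrow> ('a \<Rightarrow> 'c::linorder) \<Rightarrow> bool" where
  "lsc_on S f \<longleftrightarrow> (\<forall>x\<in>S. \<forall>t. t < f x \<longrightarrow> eventually (\<lambda>y. t < f y) (at x within S))"

end

theory Submission
  imports Defs
begin

text \<open>
  Fix a state \<open>x\<close> and suppose that \<open>V \<ge> 1\<close> is collected at the first jump. Constant controls are
  optimal for this one-jump problem, and the constant control \<open>a\<close> has value at most \<open>v\<close> iff
  \<open>\<integral> V dq\<^sub>t(x,a) + v c(x,a) \<le> v q\<^sub>x(a)\<close>. Hence the optimal one-jump value \<open>opt_op V\<close> has the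
  sublevel sets \<open>{x. \<exists>a. \<integral> V dq\<^sub>t(x,a) + v c(x,a) \<le> v q\<^sub>x(a)}\<close>, which are projections along the
  compact set \<open>A\<close>; they are closed in case (a), and in case (b) they are Borel because a Borel set
  with compact sections has a Borel projection (Novikov). The iterates of \<open>opt_op\<close> starting at \<open>1\<close>
  increase to a function \<open>U\<close> of the same regularity; by compactness \<open>U\<close> solves the optimality
  equation, and every solution \<open>V\<close> satisfies \<open>opt_op V \<le> V\<close> and so dominates \<open>U\<close>. Finally \<open>V\<^sup>* = U\<close>:
  the cost of any policy up to the \<open>n\<close>-th jump is worth at least the \<open>n\<close>-th iterate, and the
  stationary policy given by a measurable selector of the actions attaining the optimality equation
  costs at most \<open>U\<close>.
\<close>

section \<open>Analytic sets\<close>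

instance prod :: (polish_space, polish_space) polish_space ..

text \<open>Allowing closed subsets of the Baire space as domains spares the empty set a special case.\<close>

definition analytic_set :: "'a::topological_space set \<Rightarrow> bool" where
  "analytic_set A \<longleftrightarrow> (\<exists>(C :: (nat \<Rightarrow> nat) set) f. closed C \<and> continuous_on C f \<and> f ` C = A)"

lemma analytic_setI: "closed C \<Longrightarrow> continuous_on C f \<Longrightarrow> f ` C = A \<Longrightarrow> analytic_set A"
  for C :: "(nat \<Rightarrow> nat) set"
  unfolding analytic_set_def by blast

lemma analytic_setE:
  assumes "analytic_set A"
  obtains C :: "(nat \<Rightarrow> nat) set" and f where "closed C" "continuous_on C f" "f ` C = A"
  using assms unfolding analytic_set_def by blast

lemma analytic_set_family:
  assumes "\<And>n. analytic_set (A n)"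
  shows "\<exists>(C :: nat \<Rightarrow> (nat \<Rightarrow> nat) set) f.
    \<forall>n. closed (C n) \<and> continuous_on (C n) (f n) \<and> f n ` C n = A n"
  using assms unfolding analytic_set_def by metis

lemma analytic_image:
  assumes "analytic_set A" "continuous_on A g"
  shows "analytic_set (g ` A)"
proof -
  obtain C :: "(nat \<Rightarrow> nat) set" and f where C: "closed C" "continuous_on C f" "f ` C = A"
    using assms(1) by (rule analytic_setE)
  show ?thesis
  proof (rule analytic_setI)
    show "continuous_on C (g \<circ> f)" using assms(2) C by (intro continuous_on_compose) auto
    show "(g \<circ> f) ` C = g ` A" unfolding image_comp[symmetric] C(3) ..
  qed (rule C(1))
qed

lemma analytic_Int_closed:
  assumes "analytic_set A" "closed F"
  shows "analytic_set (A \<inter> F)"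
proof -
  obtain C :: "(nat \<Rightarrow> nat) set" and f where C: "closed C" "continuous_on C f" "f ` C = A"
    using assms(1) by (rule analytic_setE)
  show ?thesis
  proof (rule analytic_setI)
    show "closed (C \<inter> f -` F)" using C assms(2) by (intro continuous_closed_preimage)
    show "continuous_on (C \<inter> f -` F) f" using C(2) by (rule continuous_on_subset) blast
  qed (use C(3) in blast)
qed

lemma dense_sequence_exists:
  obtains d :: "nat \<Rightarrow> 'a::{metric_space, second_countable_topology}"
  where "\<And>x e. 0 < e \<Longrightarrow> \<exists>n. dist (d n) x < e"
proof -
  obtain D :: "'a set" where D: "countable D" "\<And>X. open X \<Longrightarrow> X \<noteq> {} \<Longrightarrow> \<exists>d\<in>D. d \<in> X"
    using countable_dense_exists by (metis (no_types))
  show ?thesis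
  proof (rule that)
    fix x :: 'a and e :: real assume "0 < e"
    then obtain y where "y \<in> D" "y \<in> ball x e" using D(2)[of "ball x e"] by auto
    moreover obtain n where "from_nat_into D n = y"
      using from_nat_into_surj[OF D(1) \<open>y \<in> D\<close>] by blast
    ultimately show "\<exists>n. dist (from_nat_into D n) x < e" by (metis dist_commute mem_ball)
  qed
qed

lemma dist_le_geometric_tail:
  fixes x :: "nat \<Rightarrow> 'a::metric_space"
  assumes "\<And>n. dist (x n) (x (Suc n)) \<le> (1/2)^n" and "n \<le> m"
  shows "dist (x n) (x m) \<le> 2 * (1/2)^n"
proof -
  have "dist (x n) (x (n + k)) \<le> 2 * (1/2)^n - 2 * (1/2)^(n+k)" for k
  proof (induction k)
    case (Suc k)
    have "dist (x n) (x (n + Suc k)) \<le> dist (x n) (x (n + k)) + dist (x (n + k)) (x (Suc (n + k)))"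
      by (metis add_Suc_right dist_triangle)
    also have "\<dots> \<le> (2 * (1/2)^n - 2 * (1/2)^(n+k)) + (1/2)^(n+k)"
      using Suc assms(1) by (intro add_mono) auto
    finally show ?case by simp
  qed simp
  from this[of "m - n"] show ?thesis
    using assms(2) by (smt (verit) le_add_diff_inverse zero_le_power zero_le_divide_1_iff)
qed

lemma geometric_half_small:
  assumes "0 < (e::real)"
  obtains N where "\<And>n. N \<le> n \<Longrightarrow> 2 * (1/2)^n < e"
proof -
  have "(\<lambda>n. 2 * (1/2::real)^n) \<longlonglongrightarrow> 2 * 0"
    by (intro tendsto_mult tendsto_const LIMSEQ_power_zero) simp
  then have "\<forall>\<^sub>F n in sequentially. 2 * (1/2)^n < e"
    using assms by (intro order_tendstoD(2)) auto
  then show ?thesis using that unfolding eventually_sequentially by blast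
qed

lemma geometric_steps_LIMSEQ:
  fixes x :: "nat \<Rightarrow> 'a::complete_space"
  assumes steps: "\<And>n. dist (x n) (x (Suc n)) \<le> (1/2)^n"
  shows "x \<longlonglongrightarrow> lim x" and "dist (x n) (lim x) \<le> 2 * (1/2)^n"
proof -
  have "Cauchy x"
    unfolding Cauchy_altdef
  proof (intro allI impI)
    fix e :: real assume "0 < e"
    then obtain N where N: "\<And>n. N \<le> n \<Longrightarrow> 2 * (1/2)^n < e" by (rule geometric_half_small) blast
    have "dist (x m) (x n) < e" if "N \<le> m" "m < n" for m n
      using dist_le_geometric_tail[OF steps, of m n] N[OF that(1)] that(2) by linarith
    then show "\<exists>M. \<forall>m\<ge>M. \<forall>n>m. dist (x m) (x n) < e" by blast
  qed
  then show lim: "x \<longlonglongrightarrow> lim x" using Cauchy_convergent convergent_LIMSEQ_iff by blast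
  show "dist (x n) (lim x) \<le> 2 * (1/2)^n"
  proof (rule LIMSEQ_le_const2)
    show "(\<lambda>m. dist (x n) (x m)) \<longlonglongrightarrow> dist (x n) (lim x)" by (intro tendsto_intros lim)
    show "\<exists>N. \<forall>m\<ge>N. dist (x n) (x m) \<le> 2 * (1/2)^n" using dist_le_geometric_tail[OF steps] by blast
  qed
qed

lemma fast_subsequence_of_dense:
  fixes d :: "nat \<Rightarrow> 'a::metric_space"
  assumes d: "\<And>x e. 0 < e \<Longrightarrow> \<exists>n. dist (d n) x < e"
  obtains s where "\<And>n. dist (d (s n)) (d (s (Suc n))) \<le> (1/2)^n" "(\<lambda>n. d (s n)) \<longlonglongrightarrow> x"
proof -
  have "\<exists>m. dist (d m) x < (1/2)^n / 2" for n by (intro d) simp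
  then obtain s where s: "\<And>n. dist (d (s n)) x < (1/2)^n / 2" by metis
  show ?thesis
  proof (rule that)
    fix n
    have "dist (d (s n)) (d (s (Suc n))) \<le> dist (d (s n)) x + dist (d (s (Suc n))) x"
      by (rule dist_triangle2)
    also have "\<dots> \<le> (1/2)^n / 2 + (1/2)^(Suc n) / 2" using s[of n] s[of "Suc n"] by linarith
    also have "\<dots> \<le> (1/2)^n" by (simp add: field_simps)
    finally show "dist (d (s n)) (d (s (Suc n))) \<le> (1/2)^n" .
  next
    show "(\<lambda>n. d (s n)) \<longlonglongrightarrow> x"
    proof (rule metric_LIMSEQ_I)
      fix e :: real assume "0 < e"
      then obtain N where N: "\<And>n. N \<le> n \<Longrightarrow> 2 * (1/2)^n < e" by (rule geometric_half_small) blast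
      have "dist (d (s n)) x < e" if "N \<le> n" for n
        using s[of n] N[OF that] zero_le_power[of "1/2::real" n] by linarith
      then show "\<exists>N. \<forall>n\<ge>N. dist (d (s n)) x < e" by blast
    qed
  qed
qed

text \<open>A point is coded by the indices of a fast converging subsequence of a dense sequence.\<close>

lemma analytic_UNIV: "analytic_set (UNIV :: 'a::polish_space set)"
proof -
  obtain d :: "nat \<Rightarrow> 'a" where d: "\<And>x e. 0 < e \<Longrightarrow> \<exists>n. dist (d n) x < e"
    by (rule dense_sequence_exists) blast
  define C where "C = {s. \<forall>n. dist (d (s n)) (d (s (Suc n))) \<le> (1/2)^n}"
  define f where "f s = lim (\<lambda>n. d (s n))" for s
  have cont: "continuous_on X (\<lambda>s. d (s n))" for n X
    by (rule continuous_on_compose2[where g=d and t=UNIV])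
      (auto intro: continuous_on_subset[OF continuous_on_product_coordinates])
  have approx: "dist (d (s n)) (f s) \<le> 2 * (1/2)^n" if "s \<in> C" for s n
    using that unfolding C_def f_def by (intro geometric_steps_LIMSEQ(2)) simp
  show ?thesis
  proof (rule analytic_setI)
    show "closed C"
      unfolding C_def by (intro closed_Collect_all closed_Collect_le continuous_intros cont)
    show "continuous_on C f"
    proof (rule uniform_limit_theorem)
      show "\<forall>\<^sub>F n in sequentially. continuous_on C (\<lambda>s. d (s n))"
        by (intro always_eventually allI cont)
      show "uniform_limit C (\<lambda>n s. d (s n)) f sequentially"
      proof (rule uniform_limitI)
        fix e :: real assume "0 < e"
        then obtain N where "\<And>n. N \<le> n \<Longrightarrow> 2 * (1/2)^n < e" by (rule geometric_half_small) blast
        then show "\<forall>\<^sub>F n in sequentially. \<forall>s\<in>C. dist (d (s n)) (f s) < e"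
          using approx unfolding eventually_sequentially by (meson order_le_less_trans)
      qed
    qed simp
    have "x \<in> f ` C" for x
    proof -
      obtain s where "\<And>n. dist (d (s n)) (d (s (Suc n))) \<le> (1/2)^n" "(\<lambda>n. d (s n)) \<longlonglongrightarrow> x"
        by (rule fast_subsequence_of_dense[where x=x]) (rule d, assumption, rule that)
      then show ?thesis unfolding C_def f_def by (intro image_eqI[of _ _ s]) (auto simp: limI)
    qed
    then show "f ` C = UNIV" by blast
  qed
qed

lemma analytic_closed: "closed F \<Longrightarrow> analytic_set F" for F :: "'a::polish_space set"
  using analytic_Int_closed[OF analytic_UNIV, of F] by simp

definition column :: "nat \<Rightarrow> (nat \<Rightarrow> 'a) \<Rightarrow> nat \<Rightarrow> 'a" where
  "column i s = (\<lambda>j. s (prod_encode (i, j)))"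

lemma columns_surj: "\<exists>s. \<forall>i. column i s = t i"
  unfolding column_def by (intro exI[of _ "\<lambda>n. case prod_decode n of (i, j) \<Rightarrow> t i j"]) simp

lemma continuous_on_column: "continuous_on X (column i)" for X :: "(nat \<Rightarrow> 'a::topological_space) set"
  unfolding column_def
  by (intro continuous_on_coordinatewise_then_product
      continuous_on_subset[OF continuous_on_product_coordinates]) auto

lemma closed_vimage_column: "closed C \<Longrightarrow> closed (column i -` C)"
  for C :: "(nat \<Rightarrow> 'a::topological_space) set"
  using continuous_closed_preimage[OF continuous_on_column[of UNIV] closed_UNIV, of C i] by simp

lemma analytic_family_common_domain:
  fixes A :: "nat \<Rightarrow> 'a::topological_space set"
  assumes "\<And>n. analytic_set (A n)"
  obtains D :: "(nat \<Rightarrow> nat) set" and g where "closed D" "\<And>n. continuous_on D (g n)" "\<And>n. g n ` D \<subseteq> A n"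
    "\<And>x. \<forall>n. x n \<in> A n \<Longrightarrow> \<exists>s\<in>D. \<forall>n. g n s = x n"
proof -
  obtain C :: "nat \<Rightarrow> (nat \<Rightarrow> nat) set" and f where
    C: "\<And>n. closed (C n)" "\<And>n. continuous_on (C n) (f n)" "\<And>n. f n ` C n = A n"
    using analytic_set_family[of A, OF assms] by blast
  define D where "D = (\<Inter>i. column i -` C i)"
  have mem_D: "s \<in> D \<longleftrightarrow> (\<forall>n. column n s \<in> C n)" for s unfolding D_def by blast
  show ?thesis
  proof (rule that)
    show "closed D" unfolding D_def by (intro closed_INT ballI closed_vimage_column C)
    show "continuous_on D (\<lambda>s. f n (column n s))" for n
      by (rule continuous_on_compose2[OF C(2) continuous_on_column]) (auto simp: mem_D)
    show "(\<lambda>s. f n (column n s)) ` D \<subseteq> A n" for n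
      unfolding C(3)[symmetric] by (auto simp: mem_D)
    fix x assume "\<forall>n. x n \<in> A n"
    then have "\<forall>n. \<exists>t. t \<in> C n \<and> f n t = x n" unfolding C(3)[symmetric] by (force simp: image_iff)
    then obtain t where t: "\<forall>n. t n \<in> C n \<and> f n (t n) = x n" by (rule choice[THEN exE])
    obtain s where s: "\<forall>n. column n s = t n" using columns_surj by blast
    show "\<exists>s\<in>D. \<forall>n. f n (column n s) = x n"
      by (rule bexI[of _ s]) (use s t in \<open>simp_all add: mem_D\<close>)
  qed
qed

lemma analytic_INT:
  fixes A :: "nat \<Rightarrow> 'a::t2_space set"
  assumes "\<And>n. analytic_set (A n)"
  shows "analytic_set (\<Inter>n. A n)"
proof -
  obtain D :: "(nat \<Rightarrow> nat) set" and g where D: "closed D" "\<And>n. continuous_on D (g n)" "\<And>n. g n ` D \<subseteq> A n"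
    "\<And>x. \<forall>n. x n \<in> A n \<Longrightarrow> \<exists>s\<in>D. \<forall>n. g n s = x n"
    by (rule analytic_family_common_domain[of A, OF assms]) blast
  define E where "E = (\<Inter>n. D \<inter> (\<lambda>s. (g n s, g 0 s)) -` {y. \<exists>x. y = (x, x)})"
  have mem_E: "s \<in> E \<longleftrightarrow> s \<in> D \<and> (\<forall>n. g n s = g 0 s)" for s unfolding E_def by simp metis
  show ?thesis
  proof (rule analytic_setI)
    show "closed E"
      unfolding E_def
      by (intro closed_INT ballI continuous_closed_preimage continuous_on_Pair D closed_diagonal)
    show "continuous_on E (g 0)"
      by (rule continuous_on_subset[OF D(2)]) (simp add: subset_iff mem_E)
    show "g 0 ` E = (\<Inter>n. A n)"
    proof (intro equalityI subsetI INT_I)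
      fix x n assume "x \<in> g 0 ` E"
      then obtain s where s: "s \<in> E" "x = g 0 s" by (rule imageE)
      then have "s \<in> D" "g n s = x" unfolding mem_E by blast+
      then show "x \<in> A n" using D(3)[of n] by blast
    next
      fix x assume "x \<in> (\<Inter>n. A n)"
      then obtain s where s: "s \<in> D" "\<forall>n. g n s = x" using D(4)[of "\<lambda>_. x"] by blast
      then have "x = g 0 s" "s \<in> E" unfolding mem_E by simp_all
      then show "x \<in> g 0 ` E" by (rule image_eqI)
    qed
  qed
qed

lemma analytic_Int: "analytic_set A \<Longrightarrow> analytic_set B \<Longrightarrow> analytic_set (A \<inter> B)" for A :: "'a::t2_space set"
  unfolding Int_range_binary by (rule analytic_INT) (simp add: binary_def)

lemma analytic_Times:
  assumes "analytic_set A" "analytic_set B"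
  shows "analytic_set (A \<times> B)"
proof -
  obtain C :: "(nat \<Rightarrow> nat) set" and f where C: "closed C" "continuous_on C f" "f ` C = A"
    using assms(1) by (rule analytic_setE)
  obtain D :: "(nat \<Rightarrow> nat) set" and g where D: "closed D" "continuous_on D g" "g ` D = B"
    using assms(2) by (rule analytic_setE)
  define E where "E = column 0 -` C \<inter> column 1 -` D"
  show ?thesis
  proof (rule analytic_setI)
    show "closed E" unfolding E_def by (intro closed_Int closed_vimage_column C D)
    show "continuous_on E (\<lambda>s. (f (column 0 s), g (column 1 s)))"
      by (intro continuous_on_Pair continuous_on_compose2[OF C(2) continuous_on_column]
          continuous_on_compose2[OF D(2) continuous_on_column]) (auto simp: E_def)
    show "(\<lambda>s. (f (column 0 s), g (column 1 s))) ` E = A \<times> B"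
    proof (intro equalityI subsetI)
      fix p assume "p \<in> A \<times> B"
      then obtain t u where tu: "t \<in> C" "u \<in> D" "p = (f t, g u)" using C(3) D(3) by auto
      obtain s where s: "\<And>i. column i s = (if i = 0 then t else u)"
        using columns_surj[of "\<lambda>i. if i = 0 then t else u"] by blast
      then have "column 0 s = t" "column 1 s = u" by simp_all
      then show "p \<in> (\<lambda>s. (f (column 0 s), g (column 1 s))) ` E"
        using tu by (intro image_eqI[of _ _ s]) (auto simp: E_def)
    qed (use C(3) D(3) in \<open>auto simp: E_def\<close>)
  qed
qed

lemma open_head: "open {s :: nat \<Rightarrow> nat. s 0 = n}"
  using open_vimage[OF Topological_Spaces.open_discrete[of "{n}"] continuous_on_product_coordinates[of 0]]
  by (simp add: vimage_def)

lemma continuous_on_cases_head: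
  fixes f :: "nat \<Rightarrow> (nat \<Rightarrow> nat) \<Rightarrow> 'a::topological_space"
  assumes "\<And>n. continuous_on {s\<in>D. s 0 = n} (f n)"
  shows "continuous_on D (\<lambda>s. f (s 0) s)"
  unfolding continuous_on_def
proof
  fix s assume s: "s \<in> D"
  have "continuous_on {t\<in>D. t 0 = s 0} (\<lambda>t. f (t 0) t)"
    using assms by (rule continuous_on_cong[THEN iffD1, rotated -1]) auto
  moreover have "at s within D = at s within {t\<in>D. t 0 = s 0}"
    by (rule at_within_nhd[OF _ open_head[of "s 0"]]) auto
  ultimately show "((\<lambda>s. f (s 0) s) \<longlongrightarrow> f (s 0) s) (at s within D)"
    using s by (simp add: continuous_on_def)
qed

text \<open>The first entry of a code selects the set, the remaining ones code the point.\<close>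

lemma analytic_UN:
  fixes A :: "nat \<Rightarrow> 'a::topological_space set"
  assumes "\<And>n. analytic_set (A n)"
  shows "analytic_set (\<Union>n. A n)"
proof -
  obtain C :: "nat \<Rightarrow> (nat \<Rightarrow> nat) set" and f where
    C: "\<And>n. closed (C n)" "\<And>n. continuous_on (C n) (f n)" "\<And>n. f n ` C n = A n"
    using analytic_set_family[of A, OF assms] by blast
  define shift where "shift s = (\<lambda>j. s (Suc j) :: nat)" for s
  define D where "D = {s. shift s \<in> C (s 0)}"
  have shift: "continuous_on X shift" for X
    unfolding shift_def
    by (intro continuous_on_coordinatewise_then_product
        continuous_on_subset[OF continuous_on_product_coordinates]) auto
  show ?thesis
  proof (rule analytic_setI)
    have "D = (\<Inter>n. - {s. s 0 = n} \<union> shift -` C n)" unfolding D_def by auto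
    moreover have "closed (shift -` C n)" for n
      using continuous_closed_preimage[OF shift closed_UNIV C(1)] by simp
    ultimately show "closed D" by (auto intro!: closed_INT closed_Un closed_Compl open_head)
    show "continuous_on D (\<lambda>s. f (s 0) (shift s))"
      by (intro continuous_on_cases_head[of D "\<lambda>n s. f n (shift s)"]
          continuous_on_compose2[OF C(2) shift])
        (auto simp: D_def)
    show "(\<lambda>s. f (s 0) (shift s)) ` D = (\<Union>n. A n)"
    proof (intro equalityI subsetI)
      fix x assume "x \<in> (\<Union>n. A n)"
      then obtain n t where t: "t \<in> C n" "x = f n t" using C(3) by blast
      have "shift (case_nat n t) = t" unfolding shift_def by auto
      then show "x \<in> (\<lambda>s. f (s 0) (shift s)) ` D"
        using t by (intro image_eqI[of _ _ "case_nat n t"]) (auto simp: D_def)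
    qed (use C(3) in \<open>auto simp: D_def\<close>)
  qed
qed

lemma analytic_Un: "analytic_set A \<Longrightarrow> analytic_set B \<Longrightarrow> analytic_set (A \<union> B)"
  unfolding Un_range_binary by (rule analytic_UN) (simp add: binary_def)

lemma analytic_open: "open U \<Longrightarrow> analytic_set U" for U :: "'a::polish_space set"
proof -
  assume "open U"
  then have "fsigma_in euclidean U" by (simp add: open_imp_fsigma_in metrizable_space_euclidean)
  then obtain F :: "nat \<Rightarrow> 'a set" where F: "\<And>n. closed (F n)" "(\<Union>n. F n) = U"
    unfolding fsigma_in_ascending by auto
  show "analytic_set U" unfolding F(2)[symmetric] by (intro analytic_UN analytic_closed F(1))
qed

lemma analytic_borel:
  fixes B :: "'a::polish_space set"
  assumes "B \<in> sets borel"
  shows "analytic_set B"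
proof -
  have "B \<in> sigma_sets UNIV {S. open S}" using assms by (simp add: sets_borel)
  then have "analytic_set B \<and> analytic_set (- B)"
  proof (induction rule: sigma_sets.induct)
    case (Basic U)
    then show ?case by (simp add: analytic_open analytic_closed closed_Compl)
  next
    case (Union A)
    have "- (\<Union>i. A i) = (\<Inter>i. - A i)" by auto
    then show ?case using Union analytic_UN[of A] analytic_INT[of "\<lambda>i. - A i"] by auto
  qed (auto simp: analytic_closed Compl_eq_Diff_UNIV[symmetric])
  then show ?thesis by blast
qed

definition borel_separated :: "(nat \<Rightarrow> 'a::topological_space set) \<Rightarrow> bool" where
  "borel_separated A \<longleftrightarrow> (\<exists>B. (\<forall>n. B n \<in> sets borel \<and> A n \<subseteq> B n) \<and> (\<Inter>n. B n) = {})"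

lemma borel_separatedI:
  "(\<And>n. B n \<in> sets borel) \<Longrightarrow> (\<And>n. A n \<subseteq> B n) \<Longrightarrow> (\<Inter>n. B n) = {} \<Longrightarrow> borel_separated A"
  unfolding borel_separated_def by blast

lemma borel_separated_empty: "A i = {} \<Longrightarrow> borel_separated A"
  by (rule borel_separatedI[of "\<lambda>n. if n = i then {} else UNIV"]) (auto split: if_splits)

lemma borel_separated_disjoint:
  assumes "B \<in> sets borel" "D \<in> sets borel" "A i \<subseteq> B" "A j \<subseteq> D" "B \<inter> D = {}" "i \<noteq> j"
  shows "borel_separated A"
proof (rule borel_separatedI)
  let ?F = "\<lambda>n. if n = i then B else if n = j then D else UNIV"
  show "?F n \<in> sets borel" "A n \<subseteq> ?F n" for n using assms by auto
  have "(\<Inter>n. ?F n) \<subseteq> ?F i \<inter> ?F j" by blast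
  then show "(\<Inter>n. ?F n) = {}" using assms(5,6) by auto
qed

lemma borel_separated_UN:
  assumes "\<And>m::nat. borel_separated (A(i := P m))"
  shows "borel_separated (A(i := \<Union>m. P m))"
proof -
  obtain B where B: "\<And>m n. B m n \<in> sets borel" "\<And>m n. (A(i := P m)) n \<subseteq> B m n" "\<And>m. (\<Inter>n. B m n) = {}"
    using assms unfolding borel_separated_def by metis
  define D where "D n = (if n = i then \<Union>m. B m n else \<Inter>m. B m n)" for n
  show ?thesis
  proof (rule borel_separatedI)
    show "D n \<in> sets borel" for n unfolding D_def using B(1) by auto
    show "(A(i := \<Union>m. P m)) n \<subseteq> D n" for n
      using B(2)[of _ n] unfolding D_def by (cases "n = i") fastforce+
    have False if y: "\<And>n. y \<in> D n" for y
    proof -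
      obtain m where "y \<in> B m i" using y[of i] unfolding D_def by auto
      then have "y \<in> B m n" for n using y[of n] unfolding D_def by (cases "n = i") auto
      then show False using B(3)[of m] by blast
    qed
    then show "(\<Inter>n. D n) = {}" by blast
  qed
qed

text \<open>The sequences which agree with the part of column \<open>i\<close> of \<open>u\<close> seen in the first \<open>k\<close> entries
  of \<open>u\<close>.\<close>

definition column_cylinder :: "(nat \<Rightarrow> 'a) \<Rightarrow> nat \<Rightarrow> nat \<Rightarrow> (nat \<Rightarrow> 'a) set" where
  "column_cylinder u k i = {t. \<forall>j. prod_encode (i, j) < k \<longrightarrow> t j = u (prod_encode (i, j))}"

lemma column_cylinder_0: "column_cylinder u 0 i = UNIV"
  unfolding column_cylinder_def by simp

lemma column_cylinder_cong: "(\<And>n. n < k \<Longrightarrow> u n = v n) \<Longrightarrow> column_cylinder u k i = column_cylinder v k i"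
  unfolding column_cylinder_def by simp

lemma column_cylinder_antimono: "k \<le> l \<Longrightarrow> column_cylinder u l i \<subseteq> column_cylinder u k i"
  unfolding column_cylinder_def by auto

lemma column_cylinder_Suc:
  assumes k: "prod_encode (i, j) = k"
  shows "column_cylinder (u(k := m)) (Suc k) i' =
    (if i' = i then {t\<in>column_cylinder u k i. t j = m} else column_cylinder u k i')"
proof -
  have "prod_encode (i', j') = k \<longleftrightarrow> i' = i \<and> j' = j" for j'
    unfolding k[symmetric] using inj_prod_encode[of UNIV] by (auto dest: injD)
  then show ?thesis unfolding column_cylinder_def by (auto simp: less_Suc_eq)
qed

lemma column_cylinder_subset_open:
  fixes W :: "(nat \<Rightarrow> nat) set"
  assumes "open W" "column i u \<in> W"
  shows "\<exists>k. column_cylinder u k i \<subseteq> W"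
proof -
  obtain X where X: "column i u \<in> PiE UNIV X" "finite {j. X j \<noteq> UNIV}" "PiE UNIV X \<subseteq> W"
    using product_topology_open_contains_basis[OF assms(1)[unfolded open_fun_def] assms(2)] by auto
  have "finite ((\<lambda>j. prod_encode (i, j)) ` {j. X j \<noteq> UNIV})" using X(2) by (rule finite_imageI)
  then obtain k where k: "\<And>j. X j \<noteq> UNIV \<Longrightarrow> prod_encode (i, j) < k"
    unfolding finite_nat_set_iff_bounded by blast
  have "t j \<in> X j" if "t \<in> column_cylinder u k i" for t j
    using that k[of j] X(1) by (cases "X j = UNIV") (auto simp: column_cylinder_def column_def)
  then have "column_cylinder u k i \<subseteq> W" using X(3) by (auto simp: PiE_iff extensional_def)
  then show ?thesis by blast
qed

lemma image_column_cylinder_subset_open: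
  fixes C :: "(nat \<Rightarrow> nat) set"
  assumes f: "continuous_on C f" and u: "column i u \<in> C" and U: "open U" "f (column i u) \<in> U"
  obtains m where "\<And>k. m \<le> k \<Longrightarrow> f ` (C \<inter> column_cylinder u k i) \<subseteq> U"
proof -
  obtain W where W: "open W" "W \<inter> C = f -` U \<inter> C"
    using f U(1) unfolding continuous_on_open_invariant by blast
  then have "column i u \<in> W" using u U(2) by blast
  then obtain m where m: "column_cylinder u m i \<subseteq> W" using column_cylinder_subset_open W(1) by blast
  show ?thesis
  proof (rule that)
    fix k assume "m \<le> k"
    then show "f ` (C \<inter> column_cylinder u k i) \<subseteq> U"
      using column_cylinder_antimono[of m k u i] m W(2) by blast
  qed
qed

lemma not_borel_separated_refine:
  fixes u :: "nat \<Rightarrow> nat"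
  assumes "\<not> borel_separated (\<lambda>i. f i ` (C i \<inter> column_cylinder u k i))"
  shows "\<exists>m. \<not> borel_separated (\<lambda>i. f i ` (C i \<inter> column_cylinder (u(k := m)) (Suc k) i))"
proof (rule ccontr)
  define A where "A u k = (\<lambda>i. f i ` (C i \<inter> column_cylinder u k i))" for u k
  assume "\<not> ?thesis"
  then have sep: "borel_separated (A (u(k := m)) (Suc k))" for m unfolding A_def by blast
  obtain i j where k: "prod_encode (i, j) = k" by (metis prod_decode_inverse surj_pair)
  define P where "P m = f i ` (C i \<inter> {t\<in>column_cylinder u k i. t j = m})" for m
  have "A (u(k := m)) (Suc k) = (A u k)(i := P m)" for m
    unfolding A_def P_def by (auto simp: fun_eq_iff column_cylinder_Suc[OF k])
  then have "borel_separated ((A u k)(i := \<Union>m. P m))"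
    using sep by (intro borel_separated_UN) simp
  moreover have "(\<Union>m. P m) = A u k i" unfolding P_def A_def by blast
  ultimately show False using assms unfolding A_def[symmetric] by simp
qed

lemma not_borel_separated_branch:
  assumes "\<not> borel_separated (\<lambda>i. f i ` C i)"
  obtains u :: "nat \<Rightarrow> nat" where "\<And>k. \<not> borel_separated (\<lambda>i. f i ` (C i \<inter> column_cylinder u k i))"
proof -
  define sep where "sep u k \<longleftrightarrow> borel_separated (\<lambda>i. f i ` (C i \<inter> column_cylinder u k i))" for u k
  have "\<exists>v. \<forall>k. \<not> sep (v k) k \<and> (\<exists>m. v (Suc k) = (v k)(k := m))"
  proof (rule dependent_nat_choice)
    show "\<exists>v. \<not> sep v 0" using assms unfolding sep_def by (simp add: column_cylinder_0)
    show "\<exists>w. \<not> sep w (Suc k) \<and> (\<exists>m. w = v(k := m))" if "\<not> sep v k" for v k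
      using not_borel_separated_refine[OF that[unfolded sep_def]] unfolding sep_def by blast
  qed
  then obtain v where v: "\<And>k. \<not> sep (v k) k" "\<And>k. \<exists>m. v (Suc k) = (v k)(k := m)" by metis
  define u where "u n = v (Suc n) n" for n
  have "v k n = u n" if "n < k" for k n
    using that
  proof (induction k)
    case (Suc k)
    obtain m where "v (Suc k) = (v k)(k := m)" using v(2) by blast
    then show ?case using Suc by (cases "n = k") (auto simp: u_def)
  qed simp
  then have "column_cylinder u k = column_cylinder (v k) k" for k
    by (intro ext column_cylinder_cong) simp
  then have "\<not> sep u k" for k using v(1)[of k] unfolding sep_def by simp
  then show ?thesis using that unfolding sep_def by blast
qed

text \<open>Otherwise inseparability passes down to smaller and smaller cylinders around the columns of
  some \<open>u\<close>. Two of the image points are distinct, since the sets have no point in common, and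
  disjoint neighbourhoods of these two points separate all small cylinders.\<close>

theorem Novikov_separation:
  fixes A :: "nat \<Rightarrow> 'a::t2_space set"
  assumes "\<And>n. analytic_set (A n)" and disjoint: "(\<Inter>n. A n) = {}"
  shows "borel_separated A"
proof (rule ccontr)
  assume neg: "\<not> borel_separated A"
  obtain C :: "nat \<Rightarrow> (nat \<Rightarrow> nat) set" and f where
    C: "\<And>n. closed (C n)" "\<And>n. continuous_on (C n) (f n)" "\<And>n. f n ` C n = A n"
    using analytic_set_family[of A, OF assms(1)] by blast
  obtain u where u: "\<And>k. \<not> borel_separated (\<lambda>i. f i ` (C i \<inter> column_cylinder u k i))"
    using not_borel_separated_branch[of f C] neg unfolding C(3) by blast
  have nonempty: "C i \<inter> column_cylinder u k i \<noteq> {}" for i k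
    using u[of k] borel_separated_empty[of "\<lambda>i. f i ` (C i \<inter> column_cylinder u k i)" i] by auto
  have column: "column i u \<in> C i" for i
  proof (rule ccontr)
    assume "column i u \<notin> C i"
    then obtain k where "column_cylinder u k i \<subseteq> - C i"
      using column_cylinder_subset_open[of "- C i" i u] C(1)[of i] by auto
    then show False using nonempty[of i k] by blast
  qed
  obtain i where i: "f i (column i u) \<noteq> f 0 (column 0 u)"
  proof (rule ccontr)
    assume "\<not> thesis"
    then have "f 0 (column 0 u) \<in> A n" for n using that column C(3) by (metis imageI)
    then show False using disjoint by blast
  qed
  then obtain U W where UW: "open U" "open W" "f i (column i u) \<in> U" "f 0 (column 0 u) \<in> W" "U \<inter> W = {}"
    using hausdorff[OF i] by auto
  obtain k where k: "\<And>n. k \<le> n \<Longrightarrow> f i ` (C i \<inter> column_cylinder u n i) \<subseteq> U"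
    by (rule image_column_cylinder_subset_open[OF C(2) column UW(1,3)]) blast
  obtain l where l: "\<And>n. l \<le> n \<Longrightarrow> f 0 ` (C 0 \<inter> column_cylinder u n 0) \<subseteq> W"
    by (rule image_column_cylinder_subset_open[OF C(2) column UW(2,4)]) blast
  have "borel_separated (\<lambda>j. f j ` (C j \<inter> column_cylinder u (max k l) j))"
  proof (rule borel_separated_disjoint)
    show "U \<in> sets borel" "W \<in> sets borel" using UW(1,2) by simp_all
    show "i \<noteq> 0" using i by metis
  qed (use UW(5) k l in auto)
  then show False using u by blast
qed

theorem Lusin_separation:
  fixes A B :: "'a::t2_space set"
  assumes "analytic_set A" "analytic_set B" "A \<inter> B = {}"
  obtains D where "D \<in> sets borel" "A \<subseteq> D" "D \<inter> B = {}"
proof -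
  have "borel_separated (binary A B)"
  proof (rule Novikov_separation)
    show "analytic_set (binary A B n)" for n using assms(1,2) by (simp add: binary_def)
    show "(\<Inter>n. binary A B n) = {}" using assms(3) unfolding Int_range_binary .
  qed
  then obtain F where F: "\<forall>n. F n \<in> sets borel \<and> binary A B n \<subseteq> F n" "(\<Inter>n. F n) = {}"
    unfolding borel_separated_def by (elim exE conjE) (rule that)
  show ?thesis
  proof (rule that)
    show "F 0 \<in> sets borel" using F(1) by blast
    show "A \<subseteq> F 0" using F(1)[rule_format, of 0] by (simp add: binary_def)
    have "F 0 \<inter> B \<subseteq> F n" for n
      using F(1)[rule_format, of n] by (cases "n = 0") (auto simp: binary_def)
    then show "F 0 \<inter> B = {}" using F(2) by blast
  qed
qed

section \<open>Borel sets with compact sections\<close>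

lemma open_basis_sequence:
  obtains V :: "nat \<Rightarrow> 'a::second_countable_topology set"
  where "\<And>n. open (V n)" "\<And>U x. open U \<Longrightarrow> x \<in> U \<Longrightarrow> \<exists>n. x \<in> V n \<and> V n \<subseteq> U"
proof -
  obtain \<B> :: "'a set set" where \<B>: "countable \<B>" "topological_basis \<B>"
    using ex_countable_basis by blast
  have "\<B> \<noteq> {}" using topological_basisE[OF \<B>(2) open_UNIV UNIV_I] by blast
  show ?thesis
  proof (rule that)
    show "open (from_nat_into \<B> n)" for n
      by (rule topological_basis_open[OF \<B>(2) from_nat_into[OF \<open>\<B> \<noteq> {}\<close>]])
    show "\<exists>n. x \<in> from_nat_into \<B> n \<and> from_nat_into \<B> n \<subseteq> U" if U: "open U" "x \<in> U" for U x
    proof -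
      obtain B where B: "B \<in> \<B>" "x \<in> B" "B \<subseteq> U" by (rule topological_basisE[OF \<B>(2) U])
      then obtain n where "from_nat_into \<B> n = B" using from_nat_into_surj[OF \<B>(1)] by blast
      then show ?thesis using B by blast
    qed
  qed
qed

lemma closed_sections_borel_cover:
  fixes B :: "('s::polish_space \<times> 'b::polish_space) set"
  assumes B: "B \<in> sets borel" and closed: "\<And>x. closed {a. (x, a) \<in> B}"
    and V: "\<And>n::nat. open (V n)" "\<And>U a. open U \<Longrightarrow> a \<in> U \<Longrightarrow> \<exists>n. a \<in> V n \<and> V n \<subseteq> U"
  obtains F where "\<And>n. F n \<in> sets borel" "(\<Inter>n. F n) = {}"
    "\<And>n. - B - F n \<subseteq> (- fst ` (B \<inter> UNIV \<times> V n)) \<times> V n"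
proof -
  define E where "E n = - B \<inter> (fst ` (B \<inter> UNIV \<times> V n) \<times> UNIV \<union> UNIV \<times> - V n)" for n
  have "borel_separated E"
  proof (rule Novikov_separation)
    show "analytic_set (E n)" for n
      unfolding E_def
      by (intro analytic_image analytic_Int analytic_Un analytic_Times analytic_borel[OF borel_comp[OF B]]
          analytic_borel[OF B] analytic_UNIV analytic_closed closed_Compl analytic_open V continuous_intros)
    have "\<exists>n. (x, a) \<notin> E n" for x a
    proof (cases "(x, a) \<in> B")
      case False
      then obtain n where "a \<in> V n" "V n \<subseteq> - {a. (x, a) \<in> B}"
        using V(2)[of "- {a. (x, a) \<in> B}" a] closed[of x] by auto
      then have "(x, a) \<notin> E n" unfolding E_def by auto
      then show ?thesis ..
    qed (simp add: E_def)
    then show "(\<Inter>n. E n) = {}" by auto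
  qed
  then obtain F where F: "\<forall>n. F n \<in> sets borel \<and> E n \<subseteq> F n" "(\<Inter>n. F n) = {}"
    unfolding borel_separated_def by (elim exE conjE) (rule that)
  show ?thesis
  proof (rule that)
    show "F n \<in> sets borel" for n using F(1) by blast
    show "- B - F n \<subseteq> (- fst ` (B \<inter> UNIV \<times> V n)) \<times> V n" for n
      using F(1)[rule_format, of n] unfolding E_def by auto
  qed (rule F(2))
qed

theorem Kunugui_Novikov:
  fixes B :: "('s::polish_space \<times> 'b::polish_space) set"
  assumes B: "B \<in> sets borel" and closed: "\<And>x. closed {a. (x, a) \<in> B}"
  obtains V :: "nat \<Rightarrow> 'b set" and D
  where "\<And>n. open (V n)" "\<And>n. D n \<in> sets borel" "- B = (\<Union>n. D n \<times> V n)"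
proof -
  obtain V :: "nat \<Rightarrow> 'b set" where
    V: "\<And>n. open (V n)" "\<And>U a. open U \<Longrightarrow> a \<in> U \<Longrightarrow> \<exists>n. a \<in> V n \<and> V n \<subseteq> U"
    by (rule open_basis_sequence) blast
  define P where "P n = fst ` (B \<inter> UNIV \<times> V n)" for n
  obtain F where F: "\<And>n. F n \<in> sets borel" "(\<Inter>n. F n) = {}" "\<And>n. - B - F n \<subseteq> (- P n) \<times> V n"
    by (rule closed_sections_borel_cover[where V=V and B=B, OF B closed V, folded P_def])
      (assumption+, rule that)
  have "\<exists>D\<in>sets borel. fst ` (- B - F n) \<subseteq> D \<and> D \<inter> P n = {}" for n
  proof (rule Lusin_separation)
    show "analytic_set (fst ` (- B - F n))"
      using B F(1)
      by (intro analytic_image analytic_borel sets.Diff borel_comp continuous_intros) auto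
    show "analytic_set (P n)"
      unfolding P_def
      by (intro analytic_image analytic_Int analytic_Times analytic_borel[OF B] analytic_UNIV
          analytic_open V continuous_intros)
    show "fst ` (- B - F n) \<inter> P n = {}" using F(3)[of n] by auto
  qed blast
  then obtain D where D: "\<And>n. D n \<in> sets borel" "\<And>n. fst ` (- B - F n) \<subseteq> D n" "\<And>n. D n \<inter> P n = {}"
    by metis
  have "- B = (\<Union>n. D n \<times> V n)"
  proof (intro equalityI subsetI)
    fix p assume p: "p \<in> - B"
    then obtain n where n: "p \<in> - B - F n" using F(2) by blast
    then have "fst p \<in> D n" "snd p \<in> V n" using D(2)[of n] F(3)[of n] by (auto simp: mem_Times_iff)
    then show "p \<in> (\<Union>n. D n \<times> V n)" by (auto simp: mem_Times_iff)
  next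
    fix p assume "p \<in> (\<Union>n. D n \<times> V n)"
    then obtain n where "fst p \<in> D n" "snd p \<in> V n" by auto
    then show "p \<in> - B" using D(3)[of n] unfolding P_def by (cases p) force
  qed
  with V(1) D(1) show ?thesis by (rule that)
qed

definition borel_closed_sections ::
  "'b::topological_space set \<Rightarrow> ('s::topological_space \<times> 'b) set \<Rightarrow> bool" where
  "borel_closed_sections K B \<longleftrightarrow> B \<in> sets borel \<and> (\<forall>x. closed {a. (x, a) \<in> B}) \<and> B \<subseteq> UNIV \<times> K"

lemma borel_closed_sections_Int:
  assumes "borel_closed_sections K B" "closed F"
  shows "borel_closed_sections K (B \<inter> UNIV \<times> F)"
proof -
  have "{a. (x, a) \<in> B \<inter> UNIV \<times> F} = {a. (x, a) \<in> B} \<inter> F" for x by auto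
  moreover have "UNIV \<times> F \<in> sets borel"
    using assms(2) by (intro borel_closed closed_Times closed_UNIV)
  ultimately show ?thesis
    using assms unfolding borel_closed_sections_def by (auto intro: closed_Int)
qed

lemma borel_closed_sections_INT:
  fixes E :: "nat \<Rightarrow> ('s::topological_space \<times> 'b::topological_space) set"
  assumes "\<And>n. borel_closed_sections K (E n)"
  shows "borel_closed_sections K (\<Inter>n. E n)"
proof -
  have "{a. (x, a) \<in> (\<Inter>n. E n)} = (\<Inter>n. {a. (x, a) \<in> E n})" for x by auto
  moreover have "(\<Inter>n. E n) \<subseteq> UNIV \<times> K"
    using assms[of 0] unfolding borel_closed_sections_def by blast
  ultimately show ?thesis
    using assms unfolding borel_closed_sections_def by (auto intro!: closed_INT)
qed

lemma borel_closed_sections_compact: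
  assumes "borel_closed_sections K B" "compact K"
  shows "compact {a. (x, a) \<in> B}"
proof -
  have "{a. (x, a) \<in> B} = K \<inter> {a. (x, a) \<in> B}"
    using assms(1) unfolding borel_closed_sections_def by auto
  then show ?thesis using assms unfolding borel_closed_sections_def by (metis compact_Int_closed)
qed

text \<open>By compactness, emptiness of a section is a finite covering condition.\<close>

theorem borel_projection_compact_sections:
  fixes B :: "('s::polish_space \<times> 'b::polish_space) set"
  assumes B: "borel_closed_sections K B" and K: "compact K"
  shows "fst ` B \<in> sets borel"
proof -
  obtain V :: "nat \<Rightarrow> 'b set" and D where
    V: "\<And>n. open (V n)" "\<And>n. D n \<in> sets borel" "- B = (\<Union>n. D n \<times> V n)"
    using B Kunugui_Novikov[of B thesis] unfolding borel_closed_sections_def by blast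
  define \<F> where "\<F> = {F :: nat set. finite F \<and> K \<subseteq> (\<Union>n\<in>F. V n)}"
  have notin_B: "(x, a) \<notin> B \<longleftrightarrow> (\<exists>n. x \<in> D n \<and> a \<in> V n)" for x a
    using V(3) by auto
  have "x \<notin> fst ` B \<longleftrightarrow> (\<exists>F\<in>\<F>. x \<in> (\<Inter>n\<in>F. D n))" for x
  proof
    assume "x \<notin> fst ` B"
    then have "(x, a) \<notin> B" for a by force
    then have "K \<subseteq> \<Union> (V ` {n. x \<in> D n})" unfolding notin_B by blast
    then obtain F where "F \<subseteq> {n. x \<in> D n}" "finite F" "K \<subseteq> \<Union> (V ` F)"
      using compactE_image[OF K, of "{n. x \<in> D n}" V] V(1) by blast
    then show "\<exists>F\<in>\<F>. x \<in> (\<Inter>n\<in>F. D n)" unfolding \<F>_def by blast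
  next
    assume "\<exists>F\<in>\<F>. x \<in> (\<Inter>n\<in>F. D n)"
    then have "(x, a) \<notin> B" if "a \<in> K" for a using that unfolding notin_B \<F>_def by blast
    then show "x \<notin> fst ` B" using B unfolding borel_closed_sections_def by auto
  qed
  then have complement: "- fst ` B = (\<Union>F\<in>\<F>. \<Inter>n\<in>F. D n)" by auto
  have "- fst ` B \<in> sets borel"
    unfolding complement
  proof (rule sets.countable_UN'')
    have "\<F> \<subseteq> Collect finite" unfolding \<F>_def by blast
    then show "countable \<F>" using countable_Collect_finite countable_subset by blast
    show "(\<Inter>n\<in>F. D n) \<in> sets borel" if "F \<in> \<F>" for F
    proof (cases "F = {}")
      case False
      then show ?thesis using that V(2) unfolding \<F>_def by (intro sets.finite_INT) auto
    qed simp
  qed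
  then show ?thesis using borel_comp[of "- fst ` B"] by simp
qed

lemma borel_measurable_closed_graph_sections:
  fixes f :: "'s::polish_space \<Rightarrow> 'b::polish_space"
  assumes G: "borel_closed_sections K {(x, f x) |x. x \<in> D}" and K: "compact K"
  shows "f \<in> borel_measurable (restrict_space borel D)"
proof (rule borel_measurableI)
  let ?G = "{(x, f x) |x. x \<in> D}"
  fix U :: "'b set" assume "open U"
  then have "borel_closed_sections K (?G \<inter> UNIV \<times> - U)"
    by (intro borel_closed_sections_Int[OF G]) auto
  then have "fst ` (?G \<inter> UNIV \<times> - U) \<in> sets borel"
    by (rule borel_projection_compact_sections[OF _ K])
  moreover have "fst ` ?G = D" by force
  then have "D \<in> sets borel" using borel_projection_compact_sections[OF G K] by simp
  moreover have "f -` U \<inter> D = D - fst ` (?G \<inter> UNIV \<times> - U)" by force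
  ultimately show "f -` U \<inter> space (restrict_space borel D) \<in> sets (restrict_space borel D)"
    by (simp add: space_restrict_space sets_restrict_space_iff sets.Diff)
qed

definition argmin_sections :: "('b \<Rightarrow> real) \<Rightarrow> ('s \<times> 'b) set \<Rightarrow> ('s \<times> 'b) set" where
  "argmin_sections \<phi> B = {(x, a) \<in> B. \<forall>b. (x, b) \<in> B \<longrightarrow> \<phi> a \<le> \<phi> b}"

lemma fst_argmin_sections:
  assumes B: "borel_closed_sections K B" and K: "compact K" and \<phi>: "continuous_on UNIV \<phi>"
  shows "fst ` argmin_sections \<phi> B = fst ` B"
proof (intro equalityI subsetI)
  fix x assume "x \<in> fst ` B"
  then have "{a. (x, a) \<in> B} \<noteq> {}" by auto
  then obtain a where "a \<in> {a. (x, a) \<in> B}" "\<forall>b\<in>{a. (x, a) \<in> B}. \<phi> a \<le> \<phi> b"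
    using continuous_attains_inf[OF borel_closed_sections_compact[OF B K]] \<phi> continuous_on_subset
    by blast
  then show "x \<in> fst ` argmin_sections \<phi> B" unfolding argmin_sections_def by force
qed (auto simp: argmin_sections_def)

lemma borel_closed_sections_argmin:
  fixes B :: "('s::polish_space \<times> 'b::polish_space) set"
  assumes B: "borel_closed_sections K B" and K: "compact K" and \<phi>: "continuous_on UNIV \<phi>"
  shows "borel_closed_sections K (argmin_sections \<phi> B)"
proof -
  have sublevel: "closed {b. \<phi> b \<le> r}" for r by (intro closed_Collect_le \<phi> continuous_intros)
  define P where "P r = fst ` (B \<inter> UNIV \<times> {b. \<phi> b \<le> r})" for r
  have P: "P r \<in> sets borel" for r
    unfolding P_def
    by (intro borel_projection_compact_sections[OF _ K] borel_closed_sections_Int B sublevel)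
  have "argmin_sections \<phi> B = B - (\<Union>r\<in>\<rat>. P r \<times> {b. r < \<phi> b})"
  proof (intro equalityI subsetI)
    fix p assume p: "p \<in> B - (\<Union>r\<in>\<rat>. P r \<times> {b. r < \<phi> b})"
    obtain x a where xa: "p = (x, a)" by fastforce
    have "\<phi> a \<le> \<phi> b" if "(x, b) \<in> B" for b
    proof (rule ccontr)
      assume "\<not> \<phi> a \<le> \<phi> b"
      then obtain r where r: "r \<in> \<rat>" "\<phi> b < r" "r < \<phi> a"
        using Rats_dense_in_real[of "\<phi> b" "\<phi> a"] by auto
      then have "x \<in> P r" unfolding P_def using that by force
      then show False using p r xa by auto
    qed
    then show "p \<in> argmin_sections \<phi> B" using p xa unfolding argmin_sections_def by auto
  qed (unfold argmin_sections_def P_def, fastforce)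
  moreover have "P r \<times> {b. r < \<phi> b} \<in> sets (borel :: ('s \<times> 'b) measure)" for r
  proof -
    have "{b. r < \<phi> b} \<in> sets borel" by (intro borel_open open_Collect_less \<phi> continuous_intros)
    then show ?thesis using P unfolding borel_prod[symmetric] by auto
  qed
  ultimately have "argmin_sections \<phi> B \<in> sets borel"
    using B unfolding borel_closed_sections_def by (auto intro!: sets.countable_UN'' countable_rat)
  moreover have "closed {a. (x, a) \<in> argmin_sections \<phi> B}" for x
  proof -
    have "{a. (x, a) \<in> argmin_sections \<phi> B} = {a. (x, a) \<in> B} \<inter> (\<Inter>b\<in>{b. (x, b) \<in> B}. {a. \<phi> a \<le> \<phi> b})"
      unfolding argmin_sections_def by auto
    then show ?thesis
      using B sublevel unfolding borel_closed_sections_def by (auto intro!: closed_Int closed_INT)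
  qed
  ultimately show ?thesis
    using B unfolding borel_closed_sections_def argmin_sections_def by auto
qed

lemma compact_decreasing_nonempty:
  fixes F :: "nat \<Rightarrow> 'a::t2_space set"
  assumes "\<And>n. compact (F n)" "\<And>n. F n \<noteq> {}" "\<And>m n. m \<le> n \<Longrightarrow> F n \<subseteq> F m"
  shows "(\<Inter>n. F n) \<noteq> {}"
proof -
  have "F 0 \<inter> (\<Inter>n. F n) \<noteq> {}"
  proof (rule compact_imp_fip_image)
    fix I :: "nat set" assume "finite I"
    then obtain m where "\<forall>n\<in>I. n \<le> m" using finite_nat_set_iff_bounded_le by blast
    then have "F m \<subseteq> F 0 \<inter> (\<Inter>n\<in>I. F n)" using assms(3) by blast
    then show "F 0 \<inter> (\<Inter>n\<in>I. F n) \<noteq> {}" using assms(2) by blast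
  qed (simp_all add: assms(1) compact_imp_closed)
  then show ?thesis by blast
qed

text \<open>Minimising the distances to the points of a dense sequence, one after the other, leaves
  exactly one point in each section.\<close>

lemma borel_uniformization_compact_sections:
  fixes B :: "('s::polish_space \<times> 'b::polish_space) set"
  assumes B: "borel_closed_sections K B" and K: "compact K"
  obtains G where "borel_closed_sections K G" "G \<subseteq> B" "\<And>x. x \<in> fst ` B \<Longrightarrow> \<exists>!a. (x, a) \<in> G"
proof -
  obtain d :: "nat \<Rightarrow> 'b" where d: "\<And>x e. 0 < e \<Longrightarrow> \<exists>n. dist (d n) x < e"
    by (rule dense_sequence_exists) blast
  define E where "E = rec_nat B (\<lambda>n. argmin_sections (\<lambda>a. dist (d n) a))"
  have E_0: "E 0 = B" and E_Suc: "E (Suc n) = argmin_sections (\<lambda>a. dist (d n) a) (E n)" for n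
    unfolding E_def by simp_all
  have cont: "continuous_on UNIV (\<lambda>a. dist (d n) a)" for n by (intro continuous_intros)
  have sections: "borel_closed_sections K (E n)" for n
    by (induction n) (simp_all add: E_0 E_Suc B borel_closed_sections_argmin[OF _ K cont])
  have fst_E: "fst ` E n = fst ` B" for n
    by (induction n) (simp_all add: E_0 E_Suc fst_argmin_sections[OF sections K cont])
  have dec: "E m \<subseteq> E n" if "n \<le> m" for m n
    using that by (induction m rule: dec_induct) (auto simp: E_Suc argmin_sections_def)
  have unique_point: "\<exists>!a. (x, a) \<in> (\<Inter>n. E n)" if x: "x \<in> fst ` B" for x
  proof -
    have "(\<Inter>n. {a. (x, a) \<in> E n}) \<noteq> {}"
    proof (rule compact_decreasing_nonempty)
      show "compact {a. (x, a) \<in> E n}" for n by (rule borel_closed_sections_compact[OF sections K])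
      show "{a. (x, a) \<in> E n} \<noteq> {}" for n using x unfolding fst_E[of n, symmetric] by auto
      show "{a. (x, a) \<in> E n} \<subseteq> {a. (x, a) \<in> E m}" if "m \<le> n" for m n using dec[OF that] by blast
    qed
    then obtain a where a: "(x, a) \<in> (\<Inter>n. E n)" by auto
    have unique: "a = b" if ab: "(x, a) \<in> (\<Inter>n. E n)" "(x, b) \<in> (\<Inter>n. E n)" for a b
    proof (rule ccontr)
      assume "a \<noteq> b"
      then obtain n where n: "dist (d n) a < dist a b / 2" using d[of "dist a b / 2" a] by auto
      have "dist (d n) b \<le> dist (d n) a"
        using ab[THEN INT_D, of "Suc n"] ab[THEN INT_D, of n]
        unfolding E_Suc argmin_sections_def by blast
      then show False using n dist_triangle3[of a b "d n"] by linarith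
    qed
    show ?thesis by (rule ex1I, rule a) (rule unique[OF _ a])
  qed
  have "(\<Inter>n. E n) \<subseteq> B" using E_0 by blast
  from that[OF borel_closed_sections_INT[OF sections] this unique_point] show ?thesis .
qed

theorem borel_selection_compact_sections:
  fixes B :: "('s::polish_space \<times> 'b::polish_space) set"
  assumes B: "borel_closed_sections K B" and K: "compact K"
  obtains f where "f \<in> borel_measurable (restrict_space borel (fst ` B))" "\<And>x. x \<in> fst ` B \<Longrightarrow> (x, f x) \<in> B"
proof -
  obtain G where G: "borel_closed_sections K G" "G \<subseteq> B" "\<And>x. x \<in> fst ` B \<Longrightarrow> \<exists>!a. (x, a) \<in> G"
    by (rule borel_uniformization_compact_sections[OF B K]) blast
  define f where "f x = (THE a. (x, a) \<in> G)" for x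
  have f: "(x, f x) \<in> G" if "x \<in> fst ` B" for x
    unfolding f_def using G(3)[OF that] by (rule theI')
  have "G = {(x, f x) |x. x \<in> fst ` B}"
  proof (intro equalityI subsetI)
    fix p assume p: "p \<in> G"
    then have x: "fst p \<in> fst ` B" using G(2) by blast
    then have "snd p = f (fst p)" using G(3)[OF x] f[OF x] p by (metis prod.collapse)
    then show "p \<in> {(x, f x) |x. x \<in> fst ` B}"
      using x by (metis (mono_tags, lifting) mem_Collect_eq prod.collapse)
  qed (use f in blast)
  then have "f \<in> borel_measurable (restrict_space borel (fst ` B))"
    using G(1) K by (intro borel_measurable_closed_graph_sections) simp_all
  then show ?thesis using f G(2) by (intro that) auto
qed

section \<open>Lower semicontinuous functions\<close>

lemma lsc_on_iff_openin: "lsc_on S f \<longleftrightarrow> (\<forall>u. openin (top_of_set S) {x\<in>S. u < f x})"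
proof
  assume lsc: "lsc_on S f"
  show "\<forall>u. openin (top_of_set S) {x\<in>S. u < f x}"
  proof
    fix u
    have "\<exists>T. openin (top_of_set S) T \<and> x \<in> T \<and> T \<subseteq> {x\<in>S. u < f x}" if x: "x \<in> S" "u < f x" for x
    proof -
      have "\<forall>\<^sub>F y in at x within S. u < f y" using lsc x unfolding lsc_on_def by blast
      then obtain T where "open T" "x \<in> T" "\<And>y. y \<in> T \<Longrightarrow> y \<noteq> x \<Longrightarrow> y \<in> S \<Longrightarrow> u < f y"
        unfolding eventually_at_topological by blast
      then show ?thesis using x by (intro exI[of _ "S \<inter> T"]) (auto simp: openin_open_Int)
    qed
    then show "openin (top_of_set S) {x\<in>S. u < f x}" by (subst openin_subopen) blast
  qed
next
  assume op: "\<forall>u. openin (top_of_set S) {x\<in>S. u < f x}"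
  show "lsc_on S f"
    unfolding lsc_on_def
  proof (intro ballI allI impI)
    fix x u assume x: "x \<in> S" "u < f x"
    obtain T where T: "open T" "{x\<in>S. u < f x} = S \<inter> T" using op by (meson openin_open)
    then have "x \<in> T" using x by blast
    moreover have "u < f y" if "y \<in> T" "y \<in> S" for y using T(2) that by blast
    ultimately show "\<forall>\<^sub>F y in at x within S. u < f y"
      using T(1) unfolding eventually_at_topological by blast
  qed
qed

lemma closedin_le_iff_openin_less:
  fixes f g :: "'a::topological_space \<Rightarrow> 'c::linorder"
  shows "closedin (top_of_set S) {x\<in>S. f x \<le> g x} \<longleftrightarrow> openin (top_of_set S) {x\<in>S. g x < f x}"
proof -
  have "S - {x\<in>S. f x \<le> g x} = {x\<in>S. g x < f x}" by auto
  then show ?thesis unfolding closedin_def by auto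
qed

lemma lsc_on_iff_closedin: "lsc_on S f \<longleftrightarrow> (\<forall>u. closedin (top_of_set S) {x\<in>S. f x \<le> u})"
  unfolding closedin_le_iff_openin_less lsc_on_iff_openin ..

lemma closedin_lsc_le_continuous:
  fixes f h :: "'a::topological_space \<Rightarrow> real"
  assumes f: "lsc_on D f" and h: "continuous_on D h"
  shows "closedin (top_of_set D) {p\<in>D. f p \<le> h p}"
proof -
  have "{p\<in>D. h p < f p} = (\<Union>t. {p\<in>D. t < f p} \<inter> (D \<inter> h -` {..<t}))"
    by (auto dest: dense)
  moreover have "openin (top_of_set D) ({p\<in>D. t < f p} \<inter> (D \<inter> h -` {..<t}))" for t
    using f continuous_openin_preimage_gen[OF h, of "{..<t}"] unfolding lsc_on_iff_openin
    by (intro openin_Int[of _ "{p\<in>D. t < f p}" "D \<inter> h -` {..<t}"]) auto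
  ultimately have "openin (top_of_set D) {p\<in>D. h p < f p}"
    by (simp only:) (rule openin_Union, blast)
  then show ?thesis unfolding closedin_le_iff_openin_less .
qed

definition truncate :: "nat \<Rightarrow> ennreal \<Rightarrow> real" where
  "truncate k u = enn2real (min u (of_nat k))"

lemma ennreal_truncate: "ennreal (truncate k u) = min u (of_nat k)"
  unfolding truncate_def by (simp add: min_less_iff_disj of_nat_less_top)

lemma truncate_nonneg: "0 \<le> truncate k u"
  unfolding truncate_def by simp

lemma truncate_le: "truncate k u \<le> real k"
  unfolding truncate_def by (rule enn2real_leI) (simp_all add: ennreal_of_nat_eq_real_of_nat)

lemma ennreal_truncate_le: "ennreal (truncate k u) \<le> u"
  unfolding ennreal_truncate by simp

lemma truncate_mono:
  assumes "k \<le> l"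
  shows "truncate k u \<le> truncate l u"
proof -
  have "min u (of_nat k) \<le> min u (of_nat l)" using assms by (intro min.mono) auto
  then show ?thesis
    unfolding ennreal_truncate[symmetric] by (simp add: truncate_nonneg ennreal_le_iff)
qed

lemma truncate_ge:
  assumes "ennreal r \<le> u" "r \<le> real k"
  shows "r \<le> truncate k u"
proof -
  have "ennreal r \<le> ennreal (truncate k u)"
    unfolding ennreal_truncate using assms by (simp add: ennreal_of_nat_eq_real_of_nat ennreal_leI)
  then show ?thesis by (simp add: truncate_nonneg ennreal_le_iff)
qed

lemma SUP_truncate: "(SUP k. ennreal (truncate k u)) = u"
  unfolding ennreal_truncate inf_min[symmetric] inf_SUP[symmetric] ennreal_SUP_of_nat_eq_top by simp

lemma measurable_truncate[measurable]: "truncate k \<in> borel_measurable borel"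
  unfolding truncate_def[abs_def] by measurable

definition bounded_approximation :: "'a set \<Rightarrow> ('a \<Rightarrow> ennreal) \<Rightarrow> (nat \<Rightarrow> 'a \<Rightarrow> real) \<Rightarrow> bool" where
  "bounded_approximation S V f \<longleftrightarrow>
     (\<forall>y\<in>S. (\<forall>k. 0 \<le> f k y \<and> f k y \<le> real k) \<and> incseq (\<lambda>k. f k y) \<and> (SUP k. ennreal (f k y)) = V y)"

lemma bounded_approximationD:
  assumes "bounded_approximation S V f" "y \<in> S"
  shows "0 \<le> f k y" "f k y \<le> real k" "incseq (\<lambda>k. f k y)" "(SUP k. ennreal (f k y)) = V y"
  using assms unfolding bounded_approximation_def by blast+

lemma bounded_approximation_bounded: "bounded_approximation S V f \<Longrightarrow> bounded (f k ` S)"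
  by (rule boundedI[of _ "real k"]) (auto simp: bounded_approximationD)

lemma bounded_approximation_truncate: "bounded_approximation S V (\<lambda>k y. truncate k (V y))"
  unfolding bounded_approximation_def
  by (auto simp: truncate_nonneg truncate_le truncate_mono SUP_truncate incseq_def)

definition lipschitz_minorant :: "'a::metric_space set \<Rightarrow> ('a \<Rightarrow> ennreal) \<Rightarrow> nat \<Rightarrow> 'a \<Rightarrow> real" where
  "lipschitz_minorant S V k y = (INF z\<in>S. truncate k (V z) + real k * dist y z)"

lemma lipschitz_minorant_le:
  "z \<in> S \<Longrightarrow> lipschitz_minorant S V k y \<le> truncate k (V z) + real k * dist y z"
  unfolding lipschitz_minorant_def
  by (rule cINF_lower) (auto intro!: bdd_belowI[of _ 0] simp: truncate_nonneg)

lemma lipschitz_minorant_ge: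
  "S \<noteq> {} \<Longrightarrow> (\<And>z. z \<in> S \<Longrightarrow> r \<le> truncate k (V z) + real k * dist y z) \<Longrightarrow> r \<le> lipschitz_minorant S V k y"
  unfolding lipschitz_minorant_def by (rule cINF_greatest)

lemma continuous_on_lipschitz_minorant: "continuous_on S (lipschitz_minorant S V k)"
proof (cases "S = {}")
  case False
  have le: "lipschitz_minorant S V k x \<le> lipschitz_minorant S V k y + real k * dist x y" for x y
  proof -
    have "lipschitz_minorant S V k x - real k * dist x y \<le> lipschitz_minorant S V k y"
    proof (rule lipschitz_minorant_ge[OF False])
      fix z assume "z \<in> S"
      have "real k * dist x z \<le> real k * (dist x y + dist y z)"
        by (intro mult_left_mono dist_triangle) simp
      then show "lipschitz_minorant S V k x - real k * dist x y \<le> truncate k (V z) + real k * dist y z"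
        using lipschitz_minorant_le[OF \<open>z \<in> S\<close>, of V k x] by (simp add: algebra_simps)
    qed
    then show ?thesis by simp
  qed
  have "(real k)-lipschitz_on S (lipschitz_minorant S V k)"
  proof (rule lipschitz_onI)
    show "dist (lipschitz_minorant S V k x) (lipschitz_minorant S V k y) \<le> real k * dist x y" for x y
      using le[of x y] le[of y x] by (simp add: dist_real_def dist_commute abs_le_iff)
  qed simp
  then show ?thesis by (rule lipschitz_on_continuous_on)
qed simp

lemma lipschitz_minorant_approaches:
  assumes V: "lsc_on S V" and y: "y \<in> S" and r: "0 \<le> r" "ennreal r < V y"
  shows "\<exists>k. r \<le> lipschitz_minorant S V k y"
proof -
  have "\<forall>\<^sub>F z in at y within S. ennreal r < V z" using V y r unfolding lsc_on_def by blast
  then obtain \<delta> where \<delta>: "0 < \<delta>" "\<And>z. z \<in> S \<Longrightarrow> z \<noteq> y \<Longrightarrow> dist z y < \<delta> \<Longrightarrow> ennreal r < V z"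
    unfolding eventually_at by blast
  obtain k :: nat where k: "max r (r / \<delta>) \<le> real k" using real_arch_simple by blast
  have "r \<le> lipschitz_minorant S V k y"
  proof (rule lipschitz_minorant_ge)
    fix z assume z: "z \<in> S"
    show "r \<le> truncate k (V z) + real k * dist y z"
    proof (cases "dist z y < \<delta>")
      case True
      then have "ennreal r \<le> V z" using \<delta>(2)[OF z] r by (cases "z = y") (auto intro: less_imp_le)
      then have "r \<le> truncate k (V z)" using k by (intro truncate_ge) auto
      then show ?thesis by (simp add: add_increasing2)
    next
      case False
      have "r \<le> real k * \<delta>" using k \<delta>(1) by (simp add: divide_le_eq)
      also have "\<dots> \<le> real k * dist y z"
        using False by (intro mult_left_mono) (auto simp: dist_commute)
      finally show ?thesis using truncate_nonneg[of k "V z"] by simp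
    qed
  qed (use y in auto)
  then show ?thesis ..
qed

lemma bounded_approximation_lipschitz_minorant:
  assumes V: "lsc_on S V"
  shows "bounded_approximation S V (lipschitz_minorant S V)"
  unfolding bounded_approximation_def
proof (intro ballI conjI allI)
  fix y k assume y: "y \<in> S"
  then have ne: "S \<noteq> {}" by blast
  have le_truncate: "lipschitz_minorant S V k y \<le> truncate k (V y)" for k
    using lipschitz_minorant_le[OF y, of V k y] by simp
  then show "lipschitz_minorant S V k y \<le> real k" using truncate_le order_trans by blast
  show "0 \<le> lipschitz_minorant S V k y"
    by (rule lipschitz_minorant_ge[OF ne]) (simp add: truncate_nonneg)
  show "incseq (\<lambda>k. lipschitz_minorant S V k y)"
    unfolding incseq_def
  proof (intro allI impI lipschitz_minorant_ge[OF ne])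
    fix k l :: nat and z assume "k \<le> l" "z \<in> S"
    have "lipschitz_minorant S V k y \<le> truncate k (V z) + real k * dist y z"
      by (rule lipschitz_minorant_le[OF \<open>z \<in> S\<close>])
    also have "\<dots> \<le> truncate l (V z) + real l * dist y z"
      using truncate_mono[OF \<open>k \<le> l\<close>] \<open>k \<le> l\<close> by (intro add_mono mult_right_mono) auto
    finally show "lipschitz_minorant S V k y \<le> truncate l (V z) + real l * dist y z" .
  qed
  show "(SUP k. ennreal (lipschitz_minorant S V k y)) = V y"
  proof (rule antisym)
    show "(SUP k. ennreal (lipschitz_minorant S V k y)) \<le> V y"
      using ennreal_leI[OF le_truncate] ennreal_truncate_le by (intro SUP_least) (meson order_trans)
    show "V y \<le> (SUP k. ennreal (lipschitz_minorant S V k y))"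
    proof (rule dense_le)
      fix t assume t: "t < V y"
      then obtain r where r: "t = ennreal r" "0 \<le> r" by (cases t) auto
      then obtain k where "r \<le> lipschitz_minorant S V k y"
        using lipschitz_minorant_approaches[OF V y] t by blast
      then have "t \<le> ennreal (lipschitz_minorant S V k y)" unfolding r by (rule ennreal_leI)
      also have "\<dots> \<le> (SUP k. ennreal (lipschitz_minorant S V k y))" by (rule SUP_upper) simp
      finally show "t \<le> (SUP k. ennreal (lipschitz_minorant S V k y))" .
    qed
  qed
qed

section \<open>Primitives of bounded measurable functions\<close>

definition primitive :: "(real \<Rightarrow> real) \<Rightarrow> real \<Rightarrow> real" where
  "primitive f t = (\<integral>s. indicator {0<..t} s * f s \<partial>lborel)"

lemma integrable_Ioc_bounded:
  fixes f :: "real \<Rightarrow> real"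
  assumes [measurable]: "f \<in> borel_measurable borel" and "\<And>s. a < s \<Longrightarrow> s \<le> b \<Longrightarrow> \<bar>f s\<bar> \<le> M"
  shows "integrable lborel (\<lambda>s. indicator {a<..b} s * f s)"
proof (rule integrableI_bounded_set[where A="{a<..b}" and B="max 0 M"])
  show "emeasure lborel {a<..b} < \<infinity>" by (cases "a \<le> b") auto
  show "AE x in lborel. x \<in> {a<..b} \<longrightarrow> norm (indicator {a<..b} x * f x) \<le> max 0 M"
    using assms(2) by (intro AE_I2) (force simp: indicator_def abs_mult)
qed (auto simp: indicator_def)

lemma primitive_nonneg: "(\<And>s. 0 < s \<Longrightarrow> 0 \<le> f s) \<Longrightarrow> 0 \<le> primitive f t"
  unfolding primitive_def by (intro integral_nonneg_AE AE_I2) (auto simp: indicator_def)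

lemma measurable_primitive[measurable]:
  assumes [measurable]: "f \<in> borel_measurable borel"
  shows "primitive f \<in> borel_measurable borel"
proof -
  have "primitive f = (\<lambda>t. \<integral>s. (if 0 < s \<and> s \<le> t then f s else 0) \<partial>lborel)"
    unfolding primitive_def
    by (intro ext Bochner_Integration.integral_cong refl) (auto simp: indicator_def)
  then show ?thesis by simp
qed

lemma primitive_diff:
  assumes "f \<in> borel_measurable borel" "\<And>s. 0 < s \<Longrightarrow> s \<le> t \<Longrightarrow> \<bar>f s\<bar> \<le> M"
    and "g \<in> borel_measurable borel" "\<And>s. 0 < s \<Longrightarrow> s \<le> t \<Longrightarrow> \<bar>g s\<bar> \<le> N"
  shows "primitive (\<lambda>s. f s - g s) t = primitive f t - primitive g t"
  unfolding primitive_def right_diff_distrib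
  by (intro Bochner_Integration.integral_diff integrable_Ioc_bounded assms) (use assms in auto)

lemma abs_primitive_le:
  assumes [measurable]: "f \<in> borel_measurable borel" and bound: "\<And>s. \<bar>f s\<bar> \<le> K" and "0 \<le> t"
  shows "\<bar>primitive f t\<bar> \<le> K * t"
proof -
  have "\<bar>primitive f t\<bar> \<le> (\<integral>s. \<bar>indicator {0<..t} s * f s\<bar> \<partial>lborel)"
    unfolding primitive_def by (rule integral_abs_bound)
  also have "\<dots> \<le> (\<integral>s. indicator {0<..t} s * K \<partial>lborel)"
  proof (rule integral_mono)
    show "integrable lborel (\<lambda>s. \<bar>indicator {0<..t} s * f s\<bar>)"
      by (intro integrable_abs integrable_Ioc_bounded[where M=K] bound) measurable
    show "integrable lborel (\<lambda>s. indicator {0<..t} s * K)"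
      by (rule integrable_Ioc_bounded[where M="\<bar>K\<bar>"]) auto
    show "\<bar>indicator {0<..t} s * f s\<bar> \<le> indicator {0<..t} s * K" for s
      using bound[of s] by (simp add: indicator_def)
  qed
  also have "\<dots> = K * t" using assms(3) by simp
  finally show ?thesis .
qed

lemma primitive_LIMSEQ:
  assumes [measurable]: "\<And>n. g n \<in> borel_measurable borel" "f \<in> borel_measurable borel"
    and lim: "AE s in lborel. (\<lambda>n. g n s) \<longlonglongrightarrow> f s"
    and bound: "\<And>n s. 0 < s \<Longrightarrow> s \<le> t \<Longrightarrow> \<bar>g n s\<bar> \<le> K"
  shows "(\<lambda>n. primitive (g n) t) \<longlonglongrightarrow> primitive f t"
  unfolding primitive_def
proof (rule integral_dominated_convergence[where w="\<lambda>s. indicator {0<..t} s * K"])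
  show "integrable lborel (\<lambda>s. indicator {0<..t} s * K)"
    by (rule integrable_Ioc_bounded[where M="\<bar>K\<bar>"]) auto
  show "AE s in lborel. (\<lambda>n. indicator {0<..t} s * g n s) \<longlonglongrightarrow> indicator {0<..t} s * f s"
    using lim by eventually_elim (intro tendsto_intros)
  show "AE s in lborel. norm (indicator {0<..t} s * g n s) \<le> indicator {0<..t} s * K" for n
    using bound by (intro AE_I2) (auto simp: indicator_def)
qed measurable

lemma primitive_eq_interval_integral: "0 \<le> t \<Longrightarrow> primitive f t = (LBINT s=0..t. f s)"
  unfolding primitive_def using interval_integral_Ioc[of 0 t f]
  by (simp add: set_lebesgue_integral_def zero_ereal_def)

lemma primitive_exp_continuous:
  assumes r: "continuous_on UNIV r" and T: "0 \<le> T"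
  shows "primitive (\<lambda>t. r t * exp (- primitive r t)) T = 1 - exp (- primitive r T)"
proof -
  have deriv: "(primitive r has_real_derivative r t) (at t within {0..T})" if "t \<in> {0..T}" for t
  proof -
    have "((\<lambda>u. LBINT s=0..u. r s) has_vector_derivative r t) (at t within {0..T})"
      using interval_integral_FTC2[of 0 0 T r t] that T continuous_on_subset[OF r]
      by (simp add: zero_ereal_def)
    then show ?thesis
      unfolding has_real_derivative_iff_has_vector_derivative
      by (rule has_vector_derivative_transform[rotated 2])
        (use that in \<open>auto simp: primitive_eq_interval_integral\<close>)
  qed
  then have "continuous_on {0..T} (primitive r)"
    by (meson DERIV_continuous continuous_on_eq_continuous_within)
  then have "continuous_on {0..T} (\<lambda>t. r t * exp (- primitive r t))"
    by (intro continuous_intros continuous_on_subset[OF r]) auto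
  moreover have "((\<lambda>t. - exp (- primitive r t)) has_real_derivative r t * exp (- primitive r t))
      (at t within {0..T})"
    if "t \<in> {0..T}" for t
    by (rule derivative_eq_intros deriv[OF that] refl)+ simp
  ultimately have "(LBINT t=0..T. r t * exp (- primitive r t))
      = - exp (- primitive r T) - - exp (- primitive r 0)"
    using interval_integral_FTC_finite[of 0 T "\<lambda>t. r t * exp (- primitive r t)"
        "\<lambda>t. - exp (- primitive r t)"] T
    by (simp add: has_real_derivative_iff_has_vector_derivative zero_ereal_def)
  then show ?thesis using T by (simp add: primitive_eq_interval_integral primitive_def[of r 0])
qed

lemma bounded_measurable_AE_limit_continuous:
  fixes r :: "real \<Rightarrow> real"
  assumes "r \<in> borel_measurable borel" and "\<And>s. \<bar>r s\<bar> \<le> K"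
  obtains g :: "nat \<Rightarrow> real \<Rightarrow> real" where "\<And>n. continuous_on UNIV (g n)" "\<And>n s. \<bar>g n s\<bar> \<le> K"
    "AE s in lborel. (\<lambda>n. g n s) \<longlonglongrightarrow> r s"
proof -
  have "r \<in> borel_measurable lebesgue" using assms(1) by (simp add: measurable_completion)
  then have "r measurable_on UNIV" by (simp add: lebesgue_measurable_imp_measurable_on)
  then obtain N h where h: "negligible N" "\<And>n. continuous_on UNIV (h n)" "\<And>s. s \<notin> N \<Longrightarrow> (\<lambda>n. h n s) \<longlonglongrightarrow> r s"
    unfolding measurable_on_def by auto
  show ?thesis
  proof (rule that)
    show "continuous_on UNIV (\<lambda>s. max (- K) (min K (h n s)))" for n
      by (intro continuous_intros h(2))
    show "\<bar>max (- K) (min K (h n s))\<bar> \<le> K" for n s using assms(2)[of s] by auto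
    have "AE s in lborel. s \<notin> N"
      using h(1) AE_not_in[of N lebesgue] by (simp add: negligible_iff_null_sets AE_completion_iff)
    then show "AE s in lborel. (\<lambda>n. max (- K) (min K (h n s))) \<longlonglongrightarrow> r s"
    proof eventually_elim
      case (elim s)
      have "(\<lambda>n. max (- K) (min K (h n s))) \<longlonglongrightarrow> max (- K) (min K (r s))"
        by (intro tendsto_intros h(3) elim)
      then show ?case using assms(2)[of s] by (simp add: abs_le_iff min_absorb2 max_absorb2)
    qed
  qed
qed

text \<open>For continuous \<open>r\<close> this is the fundamental theorem of calculus; dominated convergence does
  the rest.\<close>

lemma primitive_exp:
  fixes r :: "real \<Rightarrow> real"
  assumes [measurable]: "r \<in> borel_measurable borel" and bound: "\<And>s. \<bar>r s\<bar> \<le> K" and T: "0 \<le> T"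
  shows "primitive (\<lambda>t. r t * exp (- primitive r t)) T = 1 - exp (- primitive r T)"
proof -
  obtain g :: "nat \<Rightarrow> real \<Rightarrow> real" where g: "\<And>n. continuous_on UNIV (g n)" "\<And>n s. \<bar>g n s\<bar> \<le> K"
    "AE s in lborel. (\<lambda>n. g n s) \<longlonglongrightarrow> r s"
    by (rule bounded_measurable_AE_limit_continuous[OF assms(1,2)]) blast
  have [measurable]: "g n \<in> borel_measurable borel" for n
    by (rule borel_measurable_continuous_onI[OF g(1)])
  have lim: "(\<lambda>n. primitive (g n) t) \<longlonglongrightarrow> primitive r t" for t
    by (rule primitive_LIMSEQ) (use g in auto)
  have "(\<lambda>n. primitive (\<lambda>t. g n t * exp (- primitive (g n) t)) T)
      \<longlonglongrightarrow> primitive (\<lambda>t. r t * exp (- primitive r t)) T"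
  proof (rule primitive_LIMSEQ)
    show "AE t in lborel. (\<lambda>n. g n t * exp (- primitive (g n) t)) \<longlonglongrightarrow> r t * exp (- primitive r t)"
      using g(3) by eventually_elim (intro tendsto_intros lim)
    fix n and t :: real assume t: "0 < t" "t \<le> T"
    have "0 \<le> K" using bound[of 0] by linarith
    have "- primitive (g n) t \<le> K * t" using abs_primitive_le[of "g n" K t] g(2) t by simp
    also have "\<dots> \<le> K * T" using t \<open>0 \<le> K\<close> by (intro mult_left_mono)
    finally show "\<bar>g n t * exp (- primitive (g n) t)\<bar> \<le> K * exp (K * T)"
      using g(2)[of n t] \<open>0 \<le> K\<close> unfolding abs_mult by (intro mult_mono) auto
  qed measurable
  moreover have "(\<lambda>n. primitive (\<lambda>t. g n t * exp (- primitive (g n) t)) T) \<longlonglongrightarrow> 1 - exp (- primitive r T)"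
    unfolding primitive_exp_continuous[OF g(1) T] by (intro tendsto_intros lim)
  ultimately show ?thesis by (rule LIMSEQ_unique)
qed

section \<open>Exponentials and cumulated rates\<close>

lemma ennexp_neg_ennreal: "0 \<le> x \<Longrightarrow> ennexp_neg (ennreal x) = ennreal (exp (- x))"
  unfolding ennexp_neg_def by simp

lemma ennexp_ennreal: "0 \<le> x \<Longrightarrow> ennexp (ennreal x) = ennreal (exp x)"
  unfolding ennexp_def by simp

lemma ennexp_0[simp]: "ennexp 0 = 1"
  unfolding ennexp_def by simp

lemma measurable_ennexp[measurable]: "ennexp \<in> borel_measurable borel"
  "ennexp_neg \<in> borel_measurable borel"
  unfolding ennexp_def[abs_def] ennexp_neg_def[abs_def] by measurable

lemma ennexp_mono: "L \<le> L' \<Longrightarrow> ennexp L \<le> ennexp L'"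
  by (cases L; cases L') (auto simp: ennexp_ennreal ennexp_def[of top] top_unique)

lemma ennexp_ge_1: "1 \<le> ennexp L"
  using ennexp_mono[of 0 L] by simp

lemma ennexp_ge_self: "L \<le> ennexp L"
proof (cases L)
  case (real x)
  moreover have "x \<le> exp x" using exp_ge_add_one_self[of x] by linarith
  ultimately show ?thesis by (simp add: ennexp_ennreal ennreal_leI)
qed (simp add: ennexp_def)

lemma ennexp_neg_eq_inverse: "ennexp_neg L = inverse (ennexp L)"
  by (cases L) (auto simp: ennexp_neg_ennreal ennexp_ennreal ennexp_def[of top] ennexp_neg_def[of top]
      inverse_ennreal exp_minus)

lemma ennexp_neg_antimono: "L \<le> L' \<Longrightarrow> ennexp_neg L' \<le> ennexp_neg L"
  by (cases L; cases L') (auto simp: ennexp_neg_ennreal ennexp_neg_def[of top] top_unique)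

lemma ennexp_neg_le_1: "ennexp_neg L \<le> 1"
  using ennexp_neg_antimono[of 0 L] by (simp add: ennexp_neg_def[of 0])

lemma ennexp_add: "ennexp (L + L') = ennexp L * ennexp L'"
proof (cases "L = \<top> \<or> L' = \<top>")
  case True
  have "ennexp M \<noteq> 0" for M using ennexp_ge_1[of M] by auto
  then show ?thesis using True by (auto simp: ennexp_def[of top] ennreal_top_mult ennreal_mult_top)
next
  case False
  then obtain x y where "L = ennreal x" "L' = ennreal y" "0 \<le> x" "0 \<le> y" by (metis ennreal_cases)
  then show ?thesis by (simp add: ennexp_ennreal exp_add ennreal_mult flip: ennreal_plus)
qed

lemma ennexp_SUP:
  fixes L :: "nat \<Rightarrow> ennreal"
  assumes "incseq L"
  shows "ennexp (SUP n. L n) = (SUP n. ennexp (L n))"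
proof (cases "SUP n. L n")
  case (real x)
  have "L n \<noteq> \<top>" for n using SUP_upper[of n UNIV L] real by (auto simp: top_unique)
  then have L: "L n = ennreal (enn2real (L n))" for n by (simp add: ennreal_enn2real less_top)
  have "(\<lambda>n. ennreal (enn2real (L n))) \<longlonglongrightarrow> ennreal x"
    using LIMSEQ_SUP[OF assms] unfolding real L[symmetric] .
  then have "(\<lambda>n. exp (enn2real (L n))) \<longlonglongrightarrow> exp x"
    using real by (intro tendsto_exp) (simp add: tendsto_ennreal_iff)
  then have "(\<lambda>n. ennexp (L n)) \<longlonglongrightarrow> ennexp (SUP n. L n)"
    unfolding real using real by (subst L) (simp add: ennexp_ennreal tendsto_ennrealI)
  moreover have "incseq (\<lambda>n. ennexp (L n))" using assms ennexp_mono unfolding incseq_def by blast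
  ultimately show ?thesis using LIMSEQ_SUP LIMSEQ_unique by blast
next
  case top
  have "(SUP n. L n) \<le> (SUP n. ennexp (L n))" by (intro SUP_mono) (use ennexp_ge_self in blast)
  then have "(SUP n. ennexp (L n)) = \<top>" unfolding top by (simp add: top_unique)
  moreover have "ennexp \<top> = \<top>" by (simp add: ennexp_def)
  ultimately show ?thesis unfolding top by metis
qed

lemma ennexp_neg_LIMSEQ:
  assumes "incseq L"
  shows "(\<lambda>n. ennexp_neg (L n)) \<longlonglongrightarrow> ennexp_neg (SUP n. L n)"
proof -
  have "incseq (\<lambda>n. ennexp (L n))" using assms ennexp_mono unfolding incseq_def by blast
  then have "(\<lambda>n. ennexp (L n)) \<longlonglongrightarrow> ennexp (SUP n. L n)"
    unfolding ennexp_SUP[OF assms] by (rule LIMSEQ_SUP)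
  then have "(\<lambda>n. inverse (ennexp (L n))) \<longlonglongrightarrow> inverse (ennexp (SUP n. L n))"
    by (rule continuous_on_tendsto_compose[where s=UNIV,
          OF continuous_on_inverse_ennreal[OF continuous_on_id]]) auto
  then show ?thesis unfolding ennexp_neg_eq_inverse .
qed

definition cumul :: "(real \<Rightarrow> ennreal) \<Rightarrow> ennreal \<Rightarrow> ennreal" where
  "cumul f t = (\<integral>\<^sup>+ s. indicator {s. 0 < s \<and> ennreal s < t} s * f s \<partial>lborel)"

lemma cumul_mono: "(\<And>s. 0 < s \<Longrightarrow> f s \<le> g s) \<Longrightarrow> t \<le> t' \<Longrightarrow> cumul f t \<le> cumul g t'"
  unfolding cumul_def by (intro nn_integral_mono) (auto simp: indicator_def)

lemma measurable_cumul[measurable]: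
  assumes [measurable]: "f \<in> borel_measurable borel"
  shows "cumul f \<in> borel_measurable borel"
  unfolding cumul_def[abs_def] by measurable

lemma cumul_add:
  assumes [measurable]: "f \<in> borel_measurable borel" "g \<in> borel_measurable borel"
  shows "cumul (\<lambda>s. f s + g s) t = cumul f t + cumul g t"
  unfolding cumul_def distrib_left by (rule nn_integral_add) measurable

lemma cumul_cmult:
  assumes [measurable]: "f \<in> borel_measurable borel"
  shows "cumul (\<lambda>s. k * f s) t = k * cumul f t"
  unfolding cumul_def by (subst nn_integral_cmult[symmetric]) (auto simp: ac_simps)

lemma cumul_top: "cumul f \<top> = (\<integral>\<^sup>+ t. indicator {0<..} t * f t \<partial>lborel)"
  unfolding cumul_def by (intro nn_integral_cong) (simp add: indicator_def)

lemma incseq_cumul: "incseq (\<lambda>n. cumul f (ennreal (real n)))"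
  by (intro incseq_SucI cumul_mono ennreal_leI) auto

lemma cumul_top_eq_SUP:
  assumes [measurable]: "f \<in> borel_measurable borel"
  shows "cumul f \<top> = (SUP n. cumul f (ennreal (real n)))"
proof -
  have density: "cumul f t = emeasure (density lborel f) {s. 0 < s \<and> ennreal s < t}" for t
    unfolding cumul_def by (subst emeasure_density) (auto simp: mult.commute)
  define A where "A n = {s. 0 < s \<and> ennreal s < ennreal (real n)}" for n
  have "\<exists>n. ennreal s < ennreal (real n)" if "0 < s" for s
    using reals_Archimedean2[of s] that by (auto simp: ennreal_less_iff)
  then have "(\<Union>n. A n) = {s. 0 < s \<and> ennreal s < \<top>}" unfolding A_def by auto
  moreover have "incseq A"
    unfolding A_def incseq_def by (auto elim!: order_less_le_trans intro: ennreal_leI)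
  moreover have "range A \<subseteq> sets (density lborel f)" unfolding A_def by auto
  ultimately show ?thesis unfolding density A_def[symmetric] by (metis SUP_emeasure_incseq)
qed

lemma cumul_const_top: "0 < k \<Longrightarrow> cumul (\<lambda>_. k) \<top> = \<top>"
proof -
  assume "0 < k"
  have "cumul (\<lambda>_. k) (ennreal (real n)) = k * of_nat n" for n
  proof -
    have "{s. 0 < s \<and> ennreal s < ennreal (real n)} = {0<..<real n}"
      by (auto simp: ennreal_less_iff)
    then show ?thesis
      unfolding cumul_def
      by (subst mult.commute) (simp add: nn_integral_cmult_indicator ennreal_of_nat_eq_real_of_nat)
  qed
  then have "cumul (\<lambda>_. k) \<top> = k * (SUP n. of_nat n)"
    by (simp add: cumul_top_eq_SUP SUP_mult_left_ennreal)
  then show ?thesis using \<open>0 < k\<close> by (simp add: ennreal_SUP_of_nat_eq_top ennreal_mult_top)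
qed

lemma cumul_ennreal:
  assumes [measurable]: "f \<in> borel_measurable borel" and nonneg: "\<And>s. 0 \<le> f s"
    and bound: "\<And>s. 0 < s \<Longrightarrow> s \<le> t \<Longrightarrow> f s \<le> K"
  shows "cumul (\<lambda>s. ennreal (f s)) (ennreal t) = ennreal (primitive f t)"
proof -
  have "cumul (\<lambda>s. ennreal (f s)) (ennreal t) = (\<integral>\<^sup>+ s. ennreal (indicator {0<..t} s * f s) \<partial>lborel)"
    unfolding cumul_def
  proof (rule nn_integral_cong_AE)
    have "AE s in lborel. s \<noteq> t" by (rule AE_lborel_singleton)
    then show "AE s in lborel. indicator {s. 0 < s \<and> ennreal s < ennreal t} s * ennreal (f s)
        = ennreal (indicator {0<..t} s * f s)"
      by eventually_elim (auto simp: indicator_def ennreal_less_iff)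
  qed
  also have "\<dots> = ennreal (primitive f t)"
    unfolding primitive_def
    by (intro nn_integral_eq_integral integrable_Ioc_bounded[where M=K]) (use nonneg bound in auto)
  finally show ?thesis .
qed

section \<open>The one-jump problem\<close>

text \<open>The expected cost of a sojourn with jump rate \<open>\<rho>\<close> and cost rate \<open>\<kappa>\<close>, where \<open>G t / \<rho> t\<close> is
  the value collected at a jump at time \<open>t\<close>.\<close>

definition one_jump_value :: "(real \<Rightarrow> ennreal) \<Rightarrow> (real \<Rightarrow> ennreal) \<Rightarrow> (real \<Rightarrow> ennreal) \<Rightarrow> ennreal" where
  "one_jump_value \<rho> \<kappa> G =
     cumul (\<lambda>t. ennexp_neg (cumul \<rho> (ennreal t)) * (ennexp (cumul \<kappa> (ennreal t)) * G t)) \<top>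
     + ennexp_neg (cumul \<rho> \<top>) * ennexp (cumul \<kappa> \<top>)"

locale bounded_rates =
  fixes \<rho> \<kappa> :: "real \<Rightarrow> ennreal" and K :: real
  assumes measurable_\<rho>[measurable]: "\<rho> \<in> borel_measurable borel" and \<rho>_le: "\<And>t. \<rho> t \<le> ennreal K"
    and measurable_\<kappa>[measurable]: "\<kappa> \<in> borel_measurable borel" and \<kappa>_le: "\<And>t. \<kappa> t \<le> ennreal K"
begin

abbreviation clock :: "ennreal \<Rightarrow> ennreal" where "clock \<equiv> cumul \<rho>"
abbreviation cost :: "ennreal \<Rightarrow> ennreal" where "cost \<equiv> cumul \<kappa>"

definition weight :: "real \<Rightarrow> ennreal" where
  "weight t = ennexp_neg (clock (ennreal t)) * ennexp (cost (ennreal t))"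

lemma measurable_weight[measurable]: "weight \<in> borel_measurable borel"
  unfolding weight_def by measurable

lemma one_jump_value_weight:
  "one_jump_value \<rho> \<kappa> G = cumul (\<lambda>t. weight t * G t) \<top> + ennexp_neg (clock \<top>) * ennexp (cost \<top>)"
  unfolding one_jump_value_def weight_def by (simp add: mult.assoc)

lemma weight_le: "weight t \<le> ennexp (cost (ennreal t))"
  unfolding weight_def using mult_right_mono[OF ennexp_neg_le_1] by fastforce

definition real_\<rho> :: "real \<Rightarrow> real" where "real_\<rho> t = enn2real (\<rho> t)"
definition real_\<kappa> :: "real \<Rightarrow> real" where "real_\<kappa> t = enn2real (\<kappa> t)"

lemma measurable_real_rates[measurable]: "real_\<rho> \<in> borel_measurable borel"
  "real_\<kappa> \<in> borel_measurable borel"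
  unfolding real_\<rho>_def[abs_def] real_\<kappa>_def[abs_def] by measurable

lemma real_rates_nonneg: "0 \<le> real_\<rho> t" "0 \<le> real_\<kappa> t"
  unfolding real_\<rho>_def real_\<kappa>_def by simp_all

lemma ennreal_real_rates: "ennreal (real_\<rho> t) = \<rho> t" "ennreal (real_\<kappa> t) = \<kappa> t"
proof -
  have "\<rho> t \<noteq> \<top>" "\<kappa> t \<noteq> \<top>" using \<rho>_le[of t] \<kappa>_le[of t] by (auto simp: top_unique)
  then show "ennreal (real_\<rho> t) = \<rho> t" "ennreal (real_\<kappa> t) = \<kappa> t"
    unfolding real_\<rho>_def real_\<kappa>_def by (simp_all add: ennreal_enn2real less_top)
qed

lemma real_rates_le: "real_\<rho> t \<le> \<bar>K\<bar>" "real_\<kappa> t \<le> \<bar>K\<bar>"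
proof -
  have "\<rho> t \<le> ennreal \<bar>K\<bar>" "\<kappa> t \<le> ennreal \<bar>K\<bar>"
    by (rule order_trans[OF _ ennreal_leI[OF abs_ge_self]], rule \<rho>_le \<kappa>_le)+
  then show "real_\<rho> t \<le> \<bar>K\<bar>" "real_\<kappa> t \<le> \<bar>K\<bar>"
    unfolding real_\<rho>_def real_\<kappa>_def by (auto intro: enn2real_leI)
qed

lemma abs_rate_difference_le: "\<bar>real_\<rho> t - real_\<kappa> t\<bar> \<le> \<bar>K\<bar>"
  using real_rates_nonneg[of t] real_rates_le[of t] by linarith

definition real_weight :: "real \<Rightarrow> real" where
  "real_weight t = exp (- primitive (\<lambda>s. real_\<rho> s - real_\<kappa> s) t)"

lemma measurable_real_weight[measurable]: "real_weight \<in> borel_measurable borel"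
  unfolding real_weight_def[abs_def] by measurable

lemma real_weight_nonneg: "0 \<le> real_weight t"
  unfolding real_weight_def by simp

lemma real_weight_le: "0 \<le> t \<Longrightarrow> t \<le> T \<Longrightarrow> real_weight t \<le> exp (\<bar>K\<bar> * T)"
proof -
  assume t: "0 \<le> t" "t \<le> T"
  have "- primitive (\<lambda>s. real_\<rho> s - real_\<kappa> s) t \<le> \<bar>K\<bar> * t"
    using abs_primitive_le[where t=t, OF _ abs_rate_difference_le] t(1) by (simp add: abs_le_iff)
  also have "\<dots> \<le> \<bar>K\<bar> * T" using t by (intro mult_left_mono) auto
  finally show ?thesis unfolding real_weight_def by simp
qed

lemma weight_eq_real_weight: "weight t = ennreal (real_weight t)"
proof -
  have "primitive (\<lambda>s. real_\<rho> s - real_\<kappa> s) t = primitive real_\<rho> t - primitive real_\<kappa> t"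
    by (rule primitive_diff) (use real_rates_nonneg real_rates_le in auto)
  moreover have "clock (ennreal t) = ennreal (primitive real_\<rho> t)"
    "cost (ennreal t) = ennreal (primitive real_\<kappa> t)"
    using cumul_ennreal[of real_\<rho> t "\<bar>K\<bar>"] cumul_ennreal[of real_\<kappa> t "\<bar>K\<bar>"]
    by (simp_all add: real_rates_nonneg real_rates_le ennreal_real_rates)
  moreover have "0 \<le> primitive real_\<rho> t" "0 \<le> primitive real_\<kappa> t"
    using real_rates_nonneg by (auto intro: primitive_nonneg)
  ultimately show ?thesis
    unfolding weight_def real_weight_def
    by (simp add: ennexp_neg_ennreal ennexp_ennreal flip: ennreal_mult exp_add)
qed

lemma weighted_rate_le:
  assumes "\<And>t. 0 \<le> f t" "\<And>t. f t \<le> \<bar>K\<bar>" and t: "0 < t" "t \<le> T"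
  shows "f t * real_weight t \<le> \<bar>K\<bar> * exp (\<bar>K\<bar> * T)"
  using assms real_weight_le[of t T] real_weight_nonneg[of t] by (intro mult_mono) auto

lemma cumul_weight_real:
  assumes [measurable]: "f \<in> borel_measurable borel" and f: "\<And>t. 0 \<le> f t" "\<And>t. f t \<le> \<bar>K\<bar>"
  shows "cumul (\<lambda>t. weight t * ennreal (f t)) (ennreal T)
      = ennreal (primitive (\<lambda>t. f t * real_weight t) T)"
proof -
  have "weight t * ennreal (f t) = ennreal (f t * real_weight t)" for t
    using f(1)[of t]
    by (simp add: weight_eq_real_weight ennreal_mult real_weight_nonneg mult.commute)
  moreover have "cumul (\<lambda>t. ennreal (f t * real_weight t)) (ennreal T)
      = ennreal (primitive (\<lambda>t. f t * real_weight t) T)"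
    by (rule cumul_ennreal[OF _ _ weighted_rate_le]) (use f real_weight_nonneg in auto)
  ultimately show ?thesis by simp
qed

lemma cumul_weight_rates:
  "cumul (\<lambda>t. weight t * \<rho> t) (ennreal T) = ennreal (primitive (\<lambda>t. real_\<rho> t * real_weight t) T)"
  "cumul (\<lambda>t. weight t * \<kappa> t) (ennreal T) = ennreal (primitive (\<lambda>t. real_\<kappa> t * real_weight t) T)"
  using cumul_weight_real[of real_\<rho> T] cumul_weight_real[of real_\<kappa> T]
  by (simp_all add: real_rates_nonneg real_rates_le ennreal_real_rates)

text \<open>Integrated over \<open>{0<..T}\<close>, this is \<open>w' = (\<kappa> - \<rho>) w\<close> for the weight \<open>w\<close>, with both sides
  moved so that no subtraction occurs.\<close>

lemma weight_balance:
  assumes T: "0 \<le> T"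
  shows "1 + cumul (\<lambda>t. weight t * \<kappa> t) (ennreal T) = weight T + cumul (\<lambda>t. weight t * \<rho> t) (ennreal T)"
proof -
  let ?q = "\<lambda>t. real_\<rho> t * real_weight t" and ?c = "\<lambda>t. real_\<kappa> t * real_weight t"
  have bound: "\<bar>?q t\<bar> \<le> \<bar>K\<bar> * exp (\<bar>K\<bar> * T)" "\<bar>?c t\<bar> \<le> \<bar>K\<bar> * exp (\<bar>K\<bar> * T)" if "0 < t" "t \<le> T" for t
    using weighted_rate_le[OF real_rates_nonneg(1) real_rates_le(1) that]
      weighted_rate_le[OF real_rates_nonneg(2) real_rates_le(2) that]
      real_rates_nonneg[of t] real_weight_nonneg[of t]
    by (simp_all add: abs_mult)
  have "primitive ?q T - primitive ?c T = primitive (\<lambda>t. (real_\<rho> t - real_\<kappa> t) * real_weight t) T"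
    unfolding left_diff_distrib by (rule primitive_diff[symmetric]) (use bound in auto)
  also have "\<dots> = 1 - real_weight T"
    unfolding real_weight_def by (rule primitive_exp[OF _ abs_rate_difference_le T]) measurable
  finally have "1 + primitive ?c T = real_weight T + primitive ?q T" by simp
  then have "ennreal (1 + primitive ?c T) = ennreal (real_weight T + primitive ?q T)"
    by (rule arg_cong)
  moreover have "0 \<le> primitive ?q T" "0 \<le> primitive ?c T"
    using real_rates_nonneg real_weight_nonneg by (auto intro!: primitive_nonneg)
  ultimately show ?thesis
    unfolding cumul_weight_rates weight_eq_real_weight[of T] using real_weight_nonneg[of T] by simp
qed

lemma cumul_weight_cmult:
  assumes [measurable]: "f \<in> borel_measurable borel"
  shows "cumul (\<lambda>t. weight t * (v * f t)) T = v * cumul (\<lambda>t. weight t * f t) T"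
  unfolding mult.left_commute[of _ v] by (rule cumul_cmult) measurable

lemma scaled_cost_finite: "v < \<top> \<Longrightarrow> cumul (\<lambda>t. weight t * (v * \<kappa> t)) (ennreal T) < \<top>"
  by (simp add: cumul_weight_cmult cumul_weight_rates ennreal_mult_less_top)

lemma weight_balance_scaled:
  assumes "0 \<le> T"
  shows "v + cumul (\<lambda>t. weight t * (v * \<kappa> t)) (ennreal T)
      = v * weight T + cumul (\<lambda>t. weight t * (v * \<rho> t)) (ennreal T)"
  using arg_cong[OF weight_balance[OF assms], of "\<lambda>x. v * x"]
  by (simp add: distrib_left cumul_weight_cmult)

lemma one_jump_horizon_lower:
  assumes [measurable]: "G \<in> borel_measurable borel"
    and le: "\<And>t. ennreal v * \<rho> t + \<delta> \<le> G t + ennreal v * \<kappa> t" and T: "0 \<le> T"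
  shows "ennreal v + \<delta> * cumul weight (ennreal T) \<le> ennreal v * weight T + cumul (\<lambda>t. weight t * G t) \<top>"
proof -
  let ?cost = "cumul (\<lambda>t. weight t * (ennreal v * \<kappa> t)) (ennreal T)"
  let ?J = "cumul (\<lambda>t. weight t * G t)"
  have "?cost + (ennreal v + \<delta> * cumul weight (ennreal T))
      = (ennreal v + ?cost) + \<delta> * cumul weight (ennreal T)"
    by (simp add: ac_simps)
  also have "\<dots> = ennreal v * weight T + cumul (\<lambda>t. weight t * (ennreal v * \<rho> t)) (ennreal T)
      + \<delta> * cumul weight (ennreal T)"
    unfolding weight_balance_scaled[OF T] ..
  also have "\<dots> = ennreal v * weight T
      + cumul (\<lambda>t. weight t * (ennreal v * \<rho> t) + \<delta> * weight t) (ennreal T)"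
    by (simp add: cumul_add cumul_cmult add.assoc)
  also have "\<dots> \<le> ennreal v * weight T + cumul (\<lambda>t. weight t * (G t + ennreal v * \<kappa> t)) (ennreal T)"
    using mult_left_mono[OF le, of "weight t" for t]
    by (intro add_left_mono cumul_mono) (auto simp: distrib_left mult.commute[of \<delta>])
  also have "\<dots> = ?cost + (ennreal v * weight T + ?J (ennreal T))"
    by (simp add: distrib_left cumul_add ac_simps)
  finally have "ennreal v + \<delta> * cumul weight (ennreal T) \<le> ennreal v * weight T + ?J (ennreal T)"
    using scaled_cost_finite[of "ennreal v" T] by (auto simp: ennreal_add_left_cancel_le)
  also have "\<dots> \<le> ennreal v * weight T + ?J \<top>" by (intro add_left_mono cumul_mono) auto
  finally show ?thesis .
qed

lemma weight_bounded_below: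
  assumes "G \<in> borel_measurable borel" "\<And>t. ennreal v * \<rho> t + \<delta> \<le> G t + ennreal v * \<kappa> t"
    and less: "cumul (\<lambda>t. weight t * G t) \<top> < ennreal v"
  obtains \<epsilon> where "0 < \<epsilon>" "\<And>T. 0 < T \<Longrightarrow> \<epsilon> \<le> weight T"
proof -
  let ?J = "cumul (\<lambda>t. weight t * G t) \<top>"
  show ?thesis
  proof (rule that)
    show "0 < (ennreal v - ?J) / ennreal v"
      using less by (auto simp: ennreal_zero_less_divide diff_gr0_ennreal)
    fix T :: real assume "0 < T"
    have "ennreal v \<le> ennreal v + \<delta> * cumul weight (ennreal T)" by (simp add: le_iff_add)
    also have "\<dots> \<le> ennreal v * weight T + ?J"
      using \<open>0 < T\<close> by (intro one_jump_horizon_lower[OF assms(1,2)]) simp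
    finally have "ennreal v - ?J \<le> weight T * ennreal v"
      by (simp add: ennreal_minus_le_iff ac_simps)
    moreover have "0 < ennreal v" using less by (rule le_less_trans[OF zero_le])
    ultimately show "(ennreal v - ?J) / ennreal v \<le> weight T"
      by (intro divide_le_posI_ennreal) (auto simp: mult.commute)
  qed
qed

lemma total_weight_le:
  assumes G: "G \<in> borel_measurable borel" and le: "\<And>t. ennreal v * \<rho> t + \<delta> \<le> G t + ennreal v * \<kappa> t"
  shows "\<delta> * cumul weight \<top> \<le> ennreal v * ennexp (cost \<top>) + cumul (\<lambda>t. weight t * G t) \<top>"
  unfolding cumul_top_eq_SUP[OF measurable_weight] SUP_mult_left_ennreal
proof (rule SUP_least)
  fix n
  have "\<delta> * cumul weight (ennreal (real n)) \<le> ennreal v + \<delta> * cumul weight (ennreal (real n))"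
    by (simp add: add_increasing)
  also have "\<dots> \<le> ennreal v * weight (real n) + cumul (\<lambda>t. weight t * G t) \<top>"
    by (rule one_jump_horizon_lower[OF G le]) simp
  also have "weight (real n) \<le> ennexp (cost \<top>)"
    by (rule order_trans[OF weight_le]) (intro ennexp_mono cumul_mono, auto)
  finally show "\<delta> * cumul weight (ennreal (real n))
      \<le> ennreal v * ennexp (cost \<top>) + cumul (\<lambda>t. weight t * G t) \<top>"
    by (simp add: mult_left_mono)
qed

text \<open>If the value were below \<open>v\<close>, the weight would stay above a positive constant. Then either
  \<open>clock \<top> = \<infinity>\<close> and the integral over the jumps is infinite, or the survival term is.\<close>

lemma one_jump_lower_bound:
  assumes G: "G \<in> borel_measurable borel" and \<delta>: "0 < \<delta>" and \<rho>_G: "\<And>t. \<rho> t \<le> G t"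
    and le: "\<And>t. ennreal v * \<rho> t + \<delta> \<le> G t + ennreal v * \<kappa> t"
  shows "ennreal v \<le> one_jump_value \<rho> \<kappa> G"
proof (rule ccontr)
  let ?J = "cumul (\<lambda>t. weight t * G t) \<top>" and ?E = "ennexp_neg (clock \<top>) * ennexp (cost \<top>)"
  assume "\<not> ?thesis"
  then have "?J + ?E < ennreal v" unfolding one_jump_value_weight by simp
  then have less: "?J < ennreal v" "?E < ennreal v"
    by (auto elim: order_le_less_trans[rotated] simp: le_iff_add intro: add.commute)
  then have fin: "?J < \<top>" "?E < \<top>" using ennreal_less_top less_trans by blast+
  obtain \<epsilon> where \<epsilon>: "0 < \<epsilon>" "\<And>T. 0 < T \<Longrightarrow> \<epsilon> \<le> weight T"
    by (rule weight_bounded_below[OF G le less(1)]) blast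
  show False
  proof (cases "clock \<top>")
    case top
    have "\<epsilon> * clock \<top> = cumul (\<lambda>t. \<epsilon> * \<rho> t) \<top>" by (simp add: cumul_cmult)
    also have "\<dots> \<le> ?J" using \<epsilon>(2) \<rho>_G by (intro cumul_mono mult_mono) auto
    finally have "\<epsilon> * \<top> \<le> ?J" unfolding top .
    moreover have "\<epsilon> * \<top> = \<top>" using \<epsilon>(1) by (simp add: ennreal_mult_top)
    ultimately show False using fin(1) by (simp add: top_unique)
  next
    case (real x)
    then have "ennexp_neg (clock \<top>) \<noteq> 0" by (simp add: ennexp_neg_ennreal)
    then have "ennexp (cost \<top>) < \<top>" using fin(2) by (auto simp: ennreal_mult_less_top)
    have "\<delta> * cumul weight \<top> \<le> ennreal v * ennexp (cost \<top>) + ?J" by (rule total_weight_le[OF G le])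
    moreover have "cumul (\<lambda>_. \<epsilon>) \<top> \<le> cumul weight \<top>" using \<epsilon>(2) by (intro cumul_mono) auto
    then have "\<delta> * cumul weight \<top> = \<top>"
      using \<delta> unfolding cumul_const_top[OF \<epsilon>(1)] by (simp add: top_unique ennreal_mult_top)
    ultimately show False
      using fin(1) \<open>ennexp (cost \<top>) < \<top>\<close> by (auto simp: top_unique ennreal_mult_eq_top_iff)
  qed
qed

lemma one_jump_horizon_upper:
  assumes [measurable]: "G \<in> borel_measurable borel" and T: "0 \<le> T"
    and le: "\<And>t. G t + ennreal v * \<kappa> t \<le> ennreal v * \<rho> t"
  shows "cumul (\<lambda>t. weight t * G t) (ennreal T) + ennreal v * weight T \<le> ennreal v"
proof -
  let ?cost = "cumul (\<lambda>t. weight t * (ennreal v * \<kappa> t)) (ennreal T)"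
  have "?cost + (cumul (\<lambda>t. weight t * G t) (ennreal T) + ennreal v * weight T)
      = ennreal v * weight T + cumul (\<lambda>t. weight t * (G t + ennreal v * \<kappa> t)) (ennreal T)"
    by (simp add: distrib_left cumul_add ac_simps)
  also have "\<dots> \<le> ennreal v * weight T + cumul (\<lambda>t. weight t * (ennreal v * \<rho> t)) (ennreal T)"
    using le by (intro add_left_mono cumul_mono mult_left_mono) auto
  also have "\<dots> = ?cost + ennreal v"
    unfolding weight_balance_scaled[OF T, symmetric] by (rule add.commute)
  finally show ?thesis
    using scaled_cost_finite[of "ennreal v" T] by (auto simp: ennreal_add_left_cancel_le)
qed

lemma one_jump_upper_bound:
  assumes [measurable]: "G \<in> borel_measurable borel" and v: "1 \<le> v"
    and le: "\<And>t. G t + ennreal v * \<kappa> t \<le> ennreal v * \<rho> t"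
  shows "one_jump_value \<rho> \<kappa> G \<le> ennreal v"
proof -
  let ?J = "\<lambda>n. cumul (\<lambda>t. weight t * G t) (ennreal (real n))"
  let ?E = "\<lambda>n. ennexp_neg (clock \<top>) * ennexp (cost (ennreal (real n)))"
  have "one_jump_value \<rho> \<kappa> G = (SUP n. ?J n) + (SUP n. ?E n)"
    unfolding one_jump_value_weight cumul_top_eq_SUP[OF measurable_\<kappa>] ennexp_SUP[OF incseq_cumul]
      SUP_mult_left_ennreal by (subst cumul_top_eq_SUP) auto
  also have "\<dots> = (SUP n. ?J n + ?E n)"
  proof (rule ennreal_SUP_add[symmetric])
    show "incseq ?E"
      using incseq_cumul[of \<kappa>] unfolding incseq_def
      by (intro allI impI mult_left_mono ennexp_mono) auto
  qed (rule incseq_cumul)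
  also have "\<dots> \<le> ennreal v"
  proof (rule SUP_least)
    fix n
    have "?E n \<le> weight (real n)"
      unfolding weight_def by (intro mult_right_mono ennexp_neg_antimono cumul_mono) auto
    also have "\<dots> \<le> ennreal v * weight (real n)"
      using mult_right_mono[OF ennreal_leI[OF v], of "weight (real n)"] by simp
    finally have "?J n + ?E n \<le> ?J n + ennreal v * weight (real n)" by (rule add_left_mono)
    also have "\<dots> \<le> ennreal v" by (rule one_jump_horizon_upper[OF assms(1) _ le]) simp
    finally show "?J n + ?E n \<le> ennreal v" .
  qed
  finally show ?thesis .
qed

end

lemma sojourn_total_mass:
  assumes [measurable]: "\<rho> \<in> borel_measurable borel" and "\<And>t. \<rho> t \<le> ennreal K"
  shows "cumul (\<lambda>t. ennexp_neg (cumul \<rho> (ennreal t)) * \<rho> t) \<top> + ennexp_neg (cumul \<rho> \<top>) = 1"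
proof -
  interpret bounded_rates \<rho> "\<lambda>_. 0" K
    by unfold_locales (use assms in auto)
  have no_cost: "cumul (\<lambda>_. 0) t = 0" for t unfolding cumul_def by simp
  have weight: "weight t = ennexp_neg (clock (ennreal t))" for t
    unfolding weight_def no_cost by simp
  let ?F = "cumul (\<lambda>t. weight t * \<rho> t)"
  have balance: "?F (ennreal (real n)) + weight (real n) = 1" for n
    using weight_balance[of "real n"] by (simp add: no_cost add.commute)
  have "(\<lambda>n. ?F (ennreal (real n))) \<longlonglongrightarrow> ?F \<top>"
    by (subst cumul_top_eq_SUP) (auto intro: LIMSEQ_SUP incseq_cumul)
  moreover have "(\<lambda>n. weight (real n)) \<longlonglongrightarrow> ennexp_neg (clock \<top>)"
    unfolding weight by (subst cumul_top_eq_SUP) (auto intro: ennexp_neg_LIMSEQ incseq_cumul)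
  ultimately have "(\<lambda>n. ?F (ennreal (real n)) + weight (real n)) \<longlonglongrightarrow> ?F \<top> + ennexp_neg (clock \<top>)"
    by (rule tendsto_add)
  then show ?thesis unfolding balance by (simp add: LIMSEQ_const_iff weight)
qed

lemma one_jump_value_ge_1:
  assumes \<rho>: "\<rho> \<in> borel_measurable borel" "\<And>t. \<rho> t \<le> ennreal K" and \<rho>_G: "\<And>t. \<rho> t \<le> G t"
  shows "1 \<le> one_jump_value \<rho> \<kappa> G"
proof -
  have "1 = cumul (\<lambda>t. ennexp_neg (cumul \<rho> (ennreal t)) * (1 * \<rho> t)) \<top> + ennexp_neg (cumul \<rho> \<top>) * 1"
    using sojourn_total_mass[OF \<rho>] by simp
  also have "\<dots> \<le> one_jump_value \<rho> \<kappa> G"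
    unfolding one_jump_value_def
    by (intro add_mono cumul_mono mult_mono ennexp_ge_1 \<rho>_G order_refl) auto
  finally show ?thesis .
qed

section \<open>Measures from positive functionals\<close>

locale integral_functional =
  fixes M :: "'a measure" and I :: "('a \<Rightarrow> ennreal) \<Rightarrow> ennreal"
  assumes cong: "\<And>f g. f \<in> borel_measurable M \<Longrightarrow> g \<in> borel_measurable M
      \<Longrightarrow> (\<And>x. x \<in> space M \<Longrightarrow> f x = g x) \<Longrightarrow> I f = I g"
    and cmult: "\<And>k f. f \<in> borel_measurable M \<Longrightarrow> I (\<lambda>x. k * f x) = k * I f"
    and add: "\<And>f g. f \<in> borel_measurable M \<Longrightarrow> g \<in> borel_measurable M \<Longrightarrow> I (\<lambda>x. f x + g x) = I f + I g"
    and SUP: "\<And>U :: nat \<Rightarrow> 'a \<Rightarrow> ennreal. (\<And>i. U i \<in> borel_measurable M) \<Longrightarrow> incseq U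
        \<Longrightarrow> I (\<lambda>x. SUP i. U i x) = (SUP i. I (U i))"
begin

lemma zero: "I (\<lambda>_. 0) = 0"
  using cmult[of "\<lambda>_. 0" 0] by simp

lemma sum: "(\<And>i. f i \<in> borel_measurable M) \<Longrightarrow> I (\<lambda>x. \<Sum>i<n. f i x) = (\<Sum>i<n. I (f i))" for n :: nat
  by (induction n) (auto simp: zero add)

lemma mono:
  assumes [measurable]: "f \<in> borel_measurable M" "g \<in> borel_measurable M"
    and le: "\<And>x. x \<in> space M \<Longrightarrow> f x \<le> g x"
  shows "I f \<le> I g"
proof -
  have "I g = I (\<lambda>x. f x + (g x - f x))"
    using le by (intro cong) (auto simp: add_diff_inverse_ennreal)
  also have "\<dots> = I f + I (\<lambda>x. g x - f x)" by (rule add) measurable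
  finally show ?thesis by (simp add: le_iff_add)
qed

definition represented_measure :: "'a measure" where
  "represented_measure = measure_of (space M) (sets M) (\<lambda>B. I (indicator B))"

lemma sets_represented_measure[simp]: "sets represented_measure = sets M"
  unfolding represented_measure_def by simp

lemma emeasure_represented_measure:
  assumes B: "B \<in> sets M"
  shows "emeasure represented_measure B = I (indicator B)"
proof (rule emeasure_measure_of[OF represented_measure_def])
  show "sets M \<subseteq> Pow (space M)" by (rule sets.space_closed)
  show "B \<in> sets represented_measure" using B by simp
  show "positive (sets represented_measure) (\<lambda>B. I (indicator B))"
    unfolding positive_def using cong[of "indicator {}" "\<lambda>_. 0"] zero by simp
  show "countably_additive (sets represented_measure) (\<lambda>B. I (indicator B))"
    unfolding sets_represented_measure
  proof (rule countably_additiveI)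
    fix A :: "nat \<Rightarrow> 'a set" assume A: "range A \<subseteq> sets M" "disjoint_family A"
    have Am[measurable]: "A i \<in> sets M" for i using A by auto
    have "(\<Sum>i. I (indicator (A i))) = (SUP n. \<Sum>i<n. I (indicator (A i)))" by (rule suminf_eq_SUP)
    also have "\<dots> = (SUP n. I (\<lambda>x. \<Sum>i<n. indicator (A i) x))" by (subst sum) auto
    also have "\<dots> = I (\<lambda>x. SUP n. \<Sum>i<n. indicator (A i) x)"
    proof (rule SUP[symmetric])
      show "incseq (\<lambda>n x. \<Sum>i<n. indicator (A i) x :: ennreal)"
        by (auto simp: incseq_def le_fun_def intro!: sum_mono2)
    qed measurable
    also have "(\<lambda>x. SUP n. \<Sum>i<n. indicator (A i) x :: ennreal) = indicator (\<Union>i. A i)"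
      using suminf_indicator[OF A(2)] by (auto simp: suminf_eq_SUP[symmetric])
    finally show "(\<Sum>i. I (indicator (A i))) = I (indicator (\<Union>i. A i))" .
  qed
qed

lemma nn_integral_represented_measure:
  assumes "f \<in> borel_measurable M"
  shows "(\<integral>\<^sup>+ x. f x \<partial>represented_measure) = I f"
proof -
  let ?N = represented_measure
  have sets_eq: "g \<in> borel_measurable M \<Longrightarrow> g \<in> borel_measurable ?N" for g :: "'a \<Rightarrow> ennreal"
    using measurable_cong_sets[OF sets_represented_measure refl] by blast
  have space_eq: "space ?N = space M" by (rule sets_eq_imp_space_eq[OF sets_represented_measure])
  note I_cong = cong and I_add = add
  from assms show ?thesis
  proof (induction rule: borel_measurable_induct)
    case (cong f g)
    then have "I f = I g" by (intro I_cong) auto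
    moreover have "(\<integral>\<^sup>+ x. f x \<partial>?N) = (\<integral>\<^sup>+ x. g x \<partial>?N)"
      using cong(3) by (intro nn_integral_cong) (simp add: space_eq)
    ultimately show ?case using cong(4) by simp
  next
    case (set B)
    then show ?case by (simp add: emeasure_represented_measure)
  next
    case (mult u k)
    then show ?case by (subst nn_integral_cmult) (auto simp: cmult sets_eq)
  next
    case (add u v)
    then show ?case by (subst nn_integral_add) (auto simp: I_add sets_eq)
  next
    case (seq U)
    have "(\<integral>\<^sup>+ x. (SUP i. U i) x \<partial>?N) = (\<integral>\<^sup>+ x. (SUP i. U i x) \<partial>?N)" by (simp add: image_comp)
    also have "\<dots> = (SUP i. \<integral>\<^sup>+ x. U i x \<partial>?N)"
      by (rule nn_integral_monotone_convergence_SUP[OF \<open>incseq U\<close> sets_eq[OF seq(1)]])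
    also have "\<dots> = (SUP i. I (U i))" using seq.IH by simp
    also have "\<dots> = I (\<lambda>x. SUP i. U i x)" by (rule SUP[OF seq(1) \<open>incseq U\<close>, symmetric])
    finally show ?case by (simp add: image_comp SUP_apply[abs_def])
  qed
qed

end

lemma integral_functional_nn_integral: "integral_functional M (nn_integral M)"
proof
  fix U :: "nat \<Rightarrow> 'a \<Rightarrow> ennreal" assume "\<And>i. U i \<in> borel_measurable M" "incseq U"
  then show "(\<integral>\<^sup>+ x. (SUP i. U i x) \<partial>M) = (SUP i. \<integral>\<^sup>+ x. U i x \<partial>M)"
    by (intro nn_integral_monotone_convergence_SUP)
qed (auto intro: nn_integral_cong nn_integral_cmult nn_integral_add)

lemma integral_functional_eval: "x \<in> space M \<Longrightarrow> integral_functional M (\<lambda>f. f x)"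
  by unfold_locales auto

lemma integral_functional_compose:
  assumes "integral_functional N I" and \<phi>[measurable]: "\<phi> \<in> N \<rightarrow>\<^sub>M M"
  shows "integral_functional M (\<lambda>f. I (\<lambda>x. f (\<phi> x)))"
proof -
  interpret integral_functional N I by fact
  show ?thesis
  proof
    fix f g :: "'b \<Rightarrow> ennreal" assume [measurable]: "f \<in> borel_measurable M" "g \<in> borel_measurable M"
    show "I (\<lambda>x. f (\<phi> x) + g (\<phi> x)) = I (\<lambda>x. f (\<phi> x)) + I (\<lambda>x. g (\<phi> x))" by (rule add) measurable
    show "I (\<lambda>x. k * f (\<phi> x)) = k * I (\<lambda>x. f (\<phi> x))" for k by (rule cmult) measurable
    assume "\<And>x. x \<in> space M \<Longrightarrow> f x = g x"
    then have "f (\<phi> x) = g (\<phi> x)" if "x \<in> space N" for x using measurable_space[OF \<phi> that] by blast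
    then show "I (\<lambda>x. f (\<phi> x)) = I (\<lambda>x. g (\<phi> x))" by (rule cong[rotated 2]) measurable
  next
    fix U :: "nat \<Rightarrow> 'b \<Rightarrow> ennreal" assume [measurable]: "\<And>i. U i \<in> borel_measurable M" and "incseq U"
    then show "I (\<lambda>x. SUP i. U i (\<phi> x)) = (SUP i. I (\<lambda>x. U i (\<phi> x)))"
      by (intro SUP) (measurable, auto simp: incseq_def le_fun_def)
  qed
qed

lemma integral_functional_mixture:
  assumes functional: "\<And>a. a \<in> space N \<Longrightarrow> integral_functional M (I a)"
    and measurable: "\<And>f. f \<in> borel_measurable M \<Longrightarrow> (\<lambda>a. I a f) \<in> borel_measurable N"
  shows "integral_functional M (\<lambda>f. \<integral>\<^sup>+ a. I a f \<partial>N)"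
proof
  note cong = integral_functional.cong[OF functional] and cmult = integral_functional.cmult[OF functional]
    and add = integral_functional.add[OF functional]
  fix f g :: "'b \<Rightarrow> ennreal" assume f: "f \<in> borel_measurable M"
  have "(\<integral>\<^sup>+ a. I a (\<lambda>x. k * f x) \<partial>N) = (\<integral>\<^sup>+ a. k * I a f \<partial>N)" for k
    using cmult f by (intro nn_integral_cong) blast
  then show "(\<integral>\<^sup>+ a. I a (\<lambda>x. k * f x) \<partial>N) = k * (\<integral>\<^sup>+ a. I a f \<partial>N)" for k
    using measurable[OF f] by (simp add: nn_integral_cmult)
  assume g: "g \<in> borel_measurable M"
  have "(\<integral>\<^sup>+ a. I a (\<lambda>x. f x + g x) \<partial>N) = (\<integral>\<^sup>+ a. I a f + I a g \<partial>N)"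
    using add f g by (intro nn_integral_cong) blast
  then show "(\<integral>\<^sup>+ a. I a (\<lambda>x. f x + g x) \<partial>N) = (\<integral>\<^sup>+ a. I a f \<partial>N) + (\<integral>\<^sup>+ a. I a g \<partial>N)"
    using measurable[OF f] measurable[OF g] by (simp add: nn_integral_add)
  assume "\<And>x. x \<in> space M \<Longrightarrow> f x = g x"
  then show "(\<integral>\<^sup>+ a. I a f \<partial>N) = (\<integral>\<^sup>+ a. I a g \<partial>N)" using cong f g by (intro nn_integral_cong) blast
next
  note SUP = integral_functional.SUP[OF functional] and mono = integral_functional.mono[OF functional]
  fix U :: "nat \<Rightarrow> 'b \<Rightarrow> ennreal" assume U: "\<And>i. U i \<in> borel_measurable M" "incseq U"
  have "(\<integral>\<^sup>+ a. I a (\<lambda>x. SUP i. U i x) \<partial>N) = (\<integral>\<^sup>+ a. (SUP i. I a (U i)) \<partial>N)"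
    using SUP U by (intro nn_integral_cong) blast
  also have "\<dots> = (SUP i. \<integral>\<^sup>+ a. I a (U i) \<partial>N)"
  proof (rule nn_integral_monotone_convergence_SUP_AE)
    show "AE a in N. I a (U i) \<le> I a (U (Suc i))" for i
      using mono[OF _ U(1) U(1)] U(2) by (intro AE_I2) (auto simp: incseq_Suc_iff le_fun_def)
  qed (rule measurable[OF U(1)])
  finally show "(\<integral>\<^sup>+ a. I a (\<lambda>x. SUP i. U i x) \<partial>N) = (SUP i. \<integral>\<^sup>+ a. I a (U i) \<partial>N)" .
qed

lemma integral_functional_cmult:
  assumes "integral_functional M I"
  shows "integral_functional M (\<lambda>f. k * I f)"
proof -
  interpret integral_functional M I by fact
  show ?thesis
    by unfold_locales (auto simp: cmult add SUP distrib_left ac_simps SUP_mult_left_ennreal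
        intro: arg_cong[OF cong])
qed

lemma integral_functional_add:
  assumes "integral_functional M I" "integral_functional M J"
  shows "integral_functional M (\<lambda>f. I f + J f)"
proof -
  interpret I: integral_functional M I by fact
  interpret J: integral_functional M J by fact
  show ?thesis
  proof
    fix U :: "nat \<Rightarrow> 'a \<Rightarrow> ennreal" assume U: "\<And>i. U i \<in> borel_measurable M" "incseq U"
    have "incseq (\<lambda>i. I (U i))" "incseq (\<lambda>i. J (U i))"
      using I.mono[OF U(1) U(1)] J.mono[OF U(1) U(1)] U(2) by (auto simp: incseq_def le_fun_def)
    then show "I (\<lambda>x. SUP i. U i x) + J (\<lambda>x. SUP i. U i x) = (SUP i. I (U i) + J (U i))"
      by (simp add: I.SUP J.SUP U ennreal_SUP_add)
  qed (auto simp: I.cmult J.cmult I.add J.add distrib_left ac_simps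
      intro: arg_cong2[where f=plus, OF I.cong J.cong])
qed

lemma integral_functional_cumul:
  assumes functional: "\<And>t. integral_functional M (I t)"
    and measurable: "\<And>f. f \<in> borel_measurable M \<Longrightarrow> (\<lambda>t. I t f) \<in> borel_measurable borel"
  shows "integral_functional M (\<lambda>f. cumul (\<lambda>t. I t f) T)"
  unfolding cumul_def
proof (rule integral_functional_mixture)
  show "(\<lambda>t. indicator {s. 0 < s \<and> ennreal s < T} t * I t f) \<in> borel_measurable lborel"
    if "f \<in> borel_measurable M" for f
    using measurable[OF that] by measurable
qed (intro integral_functional_cmult functional)

section \<open>The controlled jump kernel\<close>

lemma Sinf_generator_subset:
  "insert {None} ((\<lambda>B. Some ` B) ` sets (restrict_space borel S)) \<subseteq> Pow (insert None (Some ` S))"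
  using sets.sets_into_space[of _ "restrict_space borel S"] by (force simp: space_restrict_space)

lemma space_Sinf: "space (Sinf S) = insert None (Some ` S)"
  and sets_Sinf_None: "{None} \<in> sets (Sinf S)"
  and sets_Sinf_Some: "B \<in> sets (restrict_space borel S) \<Longrightarrow> Some ` B \<in> sets (Sinf S)"
  using Sinf_generator_subset[of S] unfolding Sinf_def
  by (auto simp: space_measure_of_conv sets_measure_of)

lemma measurable_Some_Sinf[measurable]: "Some \<in> restrict_space borel S \<rightarrow>\<^sub>M Sinf S"
  unfolding Sinf_def
proof (rule measurable_measure_of[OF Sinf_generator_subset])
  fix B assume "B \<in> insert {None} ((\<lambda>B. Some ` B) ` sets (restrict_space borel S))"
  then consider "B = {None}" | C where "B = Some ` C" "C \<in> sets (restrict_space borel S)" by blast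
  then show "Some -` B \<inter> space (restrict_space borel S) \<in> sets (restrict_space borel S)"
  proof cases
    case 2
    then have "Some -` B \<inter> space (restrict_space borel S) = C"
      using sets.sets_into_space by fastforce
    then show ?thesis using 2 by simp
  qed (simp add: vimage_def)
qed (auto simp: space_restrict_space)

lemma measurable_from_Sinf:
  assumes Some: "(\<lambda>x. f (Some x)) \<in> restrict_space borel S \<rightarrow>\<^sub>M N" and None: "f None \<in> space N"
  shows "f \<in> Sinf S \<rightarrow>\<^sub>M N"
proof (rule measurableI)
  show "f x \<in> space N" if "x \<in> space (Sinf S)" for x
    using that None measurable_space[OF Some] unfolding space_Sinf
    by (auto simp: space_restrict_space)
  fix B assume "B \<in> sets N"
  let ?B = "Some ` ((\<lambda>x. f (Some x)) -` B \<inter> S)"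
  have "?B \<in> sets (Sinf S)"
    using measurable_sets[OF Some \<open>B \<in> sets N\<close>]
    by (intro sets_Sinf_Some) (simp add: space_restrict_space)
  moreover have "f -` B \<inter> space (Sinf S) = (if f None \<in> B then insert None ?B else ?B)"
    unfolding space_Sinf by auto
  ultimately show "f -` B \<inter> space (Sinf S) \<in> sets (Sinf S)"
    using sets.Un[OF sets_Sinf_None] by fastforce
qed

lemma measurable_case_Sinf:
  assumes u[measurable]: "u \<in> N \<rightarrow>\<^sub>M Sinf S" and a[measurable]: "a \<in> N \<rightarrow>\<^sub>M L"
    and b: "(\<lambda>(w, z). b w z) \<in> N \<Otimes>\<^sub>M restrict_space borel S \<rightarrow>\<^sub>M L" and "S \<noteq> {}"
  shows "(\<lambda>w. case u w of None \<Rightarrow> a w | Some z \<Rightarrow> b w z) \<in> N \<rightarrow>\<^sub>M L"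
proof -
  obtain x where "x \<in> S" using \<open>S \<noteq> {}\<close> by blast
  define state where "state s = (case s of None \<Rightarrow> x | Some z \<Rightarrow> z)" for s
  have [measurable]: "state \<in> Sinf S \<rightarrow>\<^sub>M restrict_space borel S"
    by (rule measurable_from_Sinf) (use \<open>x \<in> S\<close> in \<open>auto simp: state_def space_restrict_space\<close>)
  have "(\<lambda>w. (w, state (u w))) \<in> N \<rightarrow>\<^sub>M N \<Otimes>\<^sub>M restrict_space borel S" by measurable
  from measurable_compose[OF this b] have [measurable]: "(\<lambda>w. b w (state (u w))) \<in> N \<rightarrow>\<^sub>M L" by simp
  have "{w \<in> space N. u w = None} \<in> sets N"
    using measurable_sets[OF u sets_Sinf_None] by (simp add: vimage_def Int_def conj_commute)
  then have "(\<lambda>w. if u w = None then a w else b w (state (u w))) \<in> N \<rightarrow>\<^sub>M L"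
    by (rule measurable_If[rotated 2]) measurable
  moreover have "(\<lambda>w. if u w = None then a w else b w (state (u w)))
      = (\<lambda>w. case u w of None \<Rightarrow> a w | Some z \<Rightarrow> b w z)"
    by (auto simp: state_def fun_eq_iff split: option.split)
  ultimately show ?thesis by simp
qed

lemma space_Mst: "space (Mst S) = UNIV \<times> insert None (Some ` S)"
  unfolding Mst_def by (simp add: space_pair_measure space_Sinf)

lemma measurable_Mst[measurable]: "fst \<in> Mst S \<rightarrow>\<^sub>M borel" "snd \<in> Mst S \<rightarrow>\<^sub>M Sinf S"
  unfolding Mst_def by measurable

lemma measurable_Pair_Mst[measurable]:
  "f \<in> N \<rightarrow>\<^sub>M borel \<Longrightarrow> g \<in> N \<rightarrow>\<^sub>M Sinf S \<Longrightarrow> (\<lambda>w. (f w, g w)) \<in> N \<rightarrow>\<^sub>M Mst S"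
  unfolding Mst_def by measurable

lemma space_top_None: "(\<top>, None) \<in> space (Mst S)"
  by (simp add: space_Mst)

type_synonym 's history = "nat \<Rightarrow> ennreal \<times> 's option"

locale ctmdp_model =
  fixes S :: "'s::polish_space set" and A :: "'b::polish_space set"
    and qt :: "'s \<Rightarrow> 'b \<Rightarrow> 's measure" and c :: "'s \<Rightarrow> 'b \<Rightarrow> real"
  assumes model: "ctmdp S A qt c" and cost_bounded: "\<And>x. x \<in> S \<Longrightarrow> bdd_above ((\<lambda>a. c x a) ` A)"
begin

abbreviation "borel_S \<equiv> restrict_space borel S"
abbreviation "borel_A \<equiv> restrict_space borel A"
abbreviation "q \<equiv> qrate S qt"

lemma S_borel: "S \<in> sets borel" and S_nonempty: "S \<noteq> {}" and A_borel: "A \<in> sets borel"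
  and A_nonempty: "A \<noteq> {}"
  using model unfolding ctmdp_def by blast+

lemma space_borel_S[simp]: "space borel_S = S" and space_borel_A[simp]: "space borel_A = A"
  by (simp_all add: space_restrict_space)

lemma sets_borel_S_iff: "B \<in> sets borel_S \<longleftrightarrow> B \<in> sets borel \<and> B \<subseteq> S"
  using S_borel by (auto simp: sets_restrict_space_iff)

lemma sets_qt: "x \<in> S \<Longrightarrow> a \<in> A \<Longrightarrow> sets (qt x a) = sets borel_S"
  using model unfolding ctmdp_def by blast

lemma space_qt: "x \<in> S \<Longrightarrow> a \<in> A \<Longrightarrow> space (qt x a) = S"
  using sets_eq_imp_space_eq[OF sets_qt] by simp

lemma measurable_qt_cong: "x \<in> S \<Longrightarrow> a \<in> A \<Longrightarrow> f \<in> measurable (qt x a) N \<longleftrightarrow> f \<in> measurable borel_S N"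
  using measurable_cong_sets[OF sets_qt refl] by blast

lemma measurable_emeasure_qt:
  "B \<in> sets borel_S \<Longrightarrow> (\<lambda>(x, a). emeasure (qt x a) B) \<in> borel_measurable (borel_S \<Otimes>\<^sub>M borel_A)"
  using model unfolding ctmdp_def by blast

lemma c_nonneg: "x \<in> S \<Longrightarrow> a \<in> A \<Longrightarrow> 0 \<le> c x a"
  using model unfolding ctmdp_def by blast

lemma q_nonneg[simp]: "0 \<le> q x a"
  unfolding qrate_def by simp

lemma c_measurable[measurable]: "(\<lambda>(x, a). c x a) \<in> borel_measurable (borel_S \<Otimes>\<^sub>M borel_A)"
  using model unfolding ctmdp_def by blast

lemma emeasure_qt_bounded:
  assumes x: "x \<in> S"
  obtains K where "\<And>a. a \<in> A \<Longrightarrow> emeasure (qt x a) S \<le> ennreal K"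
proof -
  have "(SUP a\<in>A. emeasure (qt x a) S) < \<top>" using model x unfolding ctmdp_def by blast
  then obtain K where "(SUP a\<in>A. emeasure (qt x a) S) = ennreal K"
    by (cases "SUP a\<in>A. emeasure (qt x a) S") auto
  then show ?thesis using that SUP_upper[of _ A "\<lambda>a. emeasure (qt x a) S"] by metis
qed

lemma emeasure_qt_space:
  assumes "x \<in> S" "a \<in> A"
  shows "emeasure (qt x a) S = ennreal (q x a)"
proof -
  have "emeasure (qt x a) S \<noteq> \<top>"
    using emeasure_qt_bounded[OF assms(1)] assms(2) by (metis ennreal_less_top leD top.not_eq_extremum)
  then show ?thesis unfolding qrate_def by (rule emeasure_eq_ennreal_measure)
qed

lemma finite_measure_qt: "x \<in> S \<Longrightarrow> a \<in> A \<Longrightarrow> finite_measure (qt x a)"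
  by (rule finite_measureI) (simp add: space_qt emeasure_qt_space)

definition rate_bound :: "'s \<Rightarrow> real" where
  "rate_bound x = (SUP a\<in>A. max (q x a) (c x a))"

lemma bdd_above_rates:
  assumes x: "x \<in> S"
  shows "bdd_above ((\<lambda>a. max (q x a) (c x a)) ` A)"
proof -
  obtain K where K: "\<And>a. a \<in> A \<Longrightarrow> emeasure (qt x a) S \<le> ennreal K"
    by (rule emeasure_qt_bounded[OF x]) blast
  obtain L where L: "\<And>a. a \<in> A \<Longrightarrow> c x a \<le> L" using cost_bounded[OF x] unfolding bdd_above_def by auto
  show ?thesis
  proof (rule bdd_aboveI2)
    fix a assume a: "a \<in> A"
    have "q x a \<le> max 0 K"
      using K[OF a] unfolding emeasure_qt_space[OF x a]
      by (cases "0 \<le> K") (auto simp: ennreal_le_iff ennreal_neg max_def)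
    then show "max (q x a) (c x a) \<le> max (max 0 K) L" using L[OF a] by auto
  qed
qed

lemma rates_le_rate_bound:
  assumes "x \<in> S" "a \<in> A"
  shows "q x a \<le> rate_bound x" "c x a \<le> rate_bound x"
  using cSUP_upper[OF assms(2) bdd_above_rates[OF assms(1)]] unfolding rate_bound_def by simp_all

lemma q_measurable[measurable]: "(\<lambda>(x, a). q x a) \<in> borel_measurable (borel_S \<Otimes>\<^sub>M borel_A)"
proof -
  have "S \<in> sets borel_S" by (metis sets.top space_borel_S)
  from measurable_emeasure_qt[OF this]
  have "(\<lambda>p. enn2real ((\<lambda>(x, a). emeasure (qt x a) S) p)) \<in> borel_measurable (borel_S \<Otimes>\<^sub>M borel_A)"
    by measurable
  then show ?thesis unfolding qrate_def measure_def by (simp add: split_beta')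
qed

lemma rate_action_measurable:
  "(\<lambda>(x, a). r x a) \<in> borel_measurable (borel_S \<Otimes>\<^sub>M borel_A) \<Longrightarrow> x \<in> S \<Longrightarrow> r x \<in> borel_measurable borel_A"
  for r :: "'s \<Rightarrow> 'b \<Rightarrow> real"
  using measurable_Pair2[of "\<lambda>(x, a). r x a" _ _ _ x] by simp

text \<open>Divided by \<open>max 1 q\<close>, the rates become a sub-stochastic kernel, to which the library applies.\<close>

definition subprob_kernel :: "'s \<times> 'b \<Rightarrow> 's measure" where
  "subprob_kernel p = scale_measure (ennreal (1 / max 1 (q (fst p) (snd p)))) (qt (fst p) (snd p))"

lemma measurable_subprob_kernel: "subprob_kernel \<in> borel_S \<Otimes>\<^sub>M borel_A \<rightarrow>\<^sub>M subprob_algebra borel_S"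
proof (rule measurable_subprob_algebra)
  fix p assume "p \<in> space (borel_S \<Otimes>\<^sub>M borel_A)"
  then have p: "fst p \<in> S" "snd p \<in> A" by (auto simp: space_pair_measure)
  show "sets (subprob_kernel p) = sets borel_S"
    unfolding subprob_kernel_def using sets_qt[OF p] by simp
  show "subprob_space (subprob_kernel p)"
  proof (rule subprob_spaceI)
    have "1 / max 1 (q (fst p) (snd p)) * q (fst p) (snd p) \<le> 1" by (simp add: divide_le_eq)
    then show "emeasure (subprob_kernel p) (space (subprob_kernel p)) \<le> 1"
      unfolding subprob_kernel_def space_scale_measure using p
      by (simp add: space_qt emeasure_qt_space ennreal_mult[symmetric] ennreal_le_1)
    show "space (subprob_kernel p) \<noteq> {}"
      unfolding subprob_kernel_def space_scale_measure using p S_nonempty by (simp add: space_qt)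
  qed
next
  fix B assume "B \<in> sets borel_S"
  note [measurable] = measurable_emeasure_qt[OF this]
  have "(\<lambda>p. ennreal (1 / max 1 ((\<lambda>(x, a). q x a) p)) * (\<lambda>(x, a). emeasure (qt x a) B) p)
      \<in> borel_measurable (borel_S \<Otimes>\<^sub>M borel_A)"
    by measurable
  then show "(\<lambda>p. emeasure (subprob_kernel p) B) \<in> borel_measurable (borel_S \<Otimes>\<^sub>M borel_A)"
    unfolding subprob_kernel_def by (simp add: split_beta')
qed

definition jump_mean :: "('s \<Rightarrow> ennreal) \<Rightarrow> 's \<Rightarrow> 'b \<Rightarrow> ennreal" where
  "jump_mean V x a = (\<integral>\<^sup>+ y. V y \<partial>qt x a)"

lemma jump_mean_subprob_kernel:
  assumes "x \<in> S" "a \<in> A" "f \<in> borel_measurable borel_S"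
  shows "jump_mean f x a = ennreal (max 1 (q x a)) * (\<integral>\<^sup>+ y. f y \<partial>subprob_kernel (x, a))"
proof -
  have "(\<integral>\<^sup>+ y. f y \<partial>subprob_kernel (x, a)) = ennreal (1 / max 1 (q x a)) * jump_mean f x a"
    unfolding subprob_kernel_def jump_mean_def using assms
    by (simp add: nn_integral_scale_measure measurable_qt_cong)
  moreover have "ennreal (max 1 (q x a)) * ennreal (1 / max 1 (q x a)) = 1"
    by (subst ennreal_mult[symmetric]) auto
  ultimately show ?thesis by (simp add: mult.assoc[symmetric])
qed

lemma measurable_jump_mean:
  assumes f: "(\<lambda>(w, y). f w y) \<in> borel_measurable (N \<Otimes>\<^sub>M borel_S)"
    and u[measurable]: "u \<in> N \<rightarrow>\<^sub>M borel_S" and v[measurable]: "v \<in> N \<rightarrow>\<^sub>M borel_A"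
  shows "(\<lambda>w. jump_mean (f w) (u w) (v w)) \<in> borel_measurable N"
proof -
  have "(\<lambda>w. subprob_kernel (u w, v w)) \<in> N \<rightarrow>\<^sub>M subprob_algebra borel_S"
    by (rule measurable_compose[OF _ measurable_subprob_kernel]) measurable
  then have [measurable]: "(\<lambda>w. \<integral>\<^sup>+ y. f w y \<partial>subprob_kernel (u w, v w)) \<in> borel_measurable N"
    by (rule nn_integral_measurable_subprob_algebra2[OF f])
  have [measurable]: "(\<lambda>w. q (u w) (v w)) \<in> borel_measurable N"
    using measurable_compose[OF measurable_Pair[OF u v] q_measurable] by simp
  have "(\<lambda>w. ennreal (max 1 (q (u w) (v w))) * (\<integral>\<^sup>+ y. f w y \<partial>subprob_kernel (u w, v w)))
      \<in> borel_measurable N"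
    by measurable
  moreover have "jump_mean (f w) (u w) (v w)
      = ennreal (max 1 (q (u w) (v w))) * (\<integral>\<^sup>+ y. f w y \<partial>subprob_kernel (u w, v w))"
    if "w \<in> space N" for w
    using measurable_space[OF u that] measurable_space[OF v that] measurable_Pair2[OF f that]
    by (intro jump_mean_subprob_kernel) auto
  ultimately show ?thesis using measurable_cong by (metis (no_types, lifting))
qed

lemma jump_mean_action_measurable:
  assumes f: "f \<in> borel_measurable borel_S" and x: "x \<in> S"
  shows "jump_mean f x \<in> borel_measurable borel_A"
proof -
  have "(\<lambda>(w, y). f y) \<in> borel_measurable (borel_A \<Otimes>\<^sub>M borel_S)" using f by measurable
  then show ?thesis by (rule measurable_jump_mean) (use x in auto)
qed

lemma jump_mean_mono: "x \<in> S \<Longrightarrow> a \<in> A \<Longrightarrow> (\<And>y. y \<in> S \<Longrightarrow> V y \<le> V' y) \<Longrightarrow> jump_mean V x a \<le> jump_mean V' x a"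
  unfolding jump_mean_def by (intro nn_integral_mono) (simp add: space_qt)

lemma jump_mean_cong: "x \<in> S \<Longrightarrow> a \<in> A \<Longrightarrow> (\<And>y. y \<in> S \<Longrightarrow> V y = V' y) \<Longrightarrow> jump_mean V x a = jump_mean V' x a"
  by (intro antisym jump_mean_mono) auto

lemma jump_mean_1: "x \<in> S \<Longrightarrow> a \<in> A \<Longrightarrow> jump_mean (\<lambda>_. 1) x a = ennreal (q x a)"
  unfolding jump_mean_def by (simp add: space_qt emeasure_qt_space)

lemma jump_mean_ge_q: "x \<in> S \<Longrightarrow> a \<in> A \<Longrightarrow> (\<And>y. y \<in> S \<Longrightarrow> 1 \<le> V y) \<Longrightarrow> ennreal (q x a) \<le> jump_mean V x a"
  using jump_mean_mono[of x a "\<lambda>_. 1" V] by (simp add: jump_mean_1)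

lemma integral_functional_jump_mean:
  "x \<in> S \<Longrightarrow> a \<in> A \<Longrightarrow> integral_functional borel_S (\<lambda>f. jump_mean f x a)"
  unfolding jump_mean_def
  by (rule integral_functional_compose[OF integral_functional_nn_integral]) (simp add: measurable_qt_cong)

abbreviation "hist n \<equiv> PiM {0..<Suc n} (\<lambda>_. Mst S)"

end

locale ctmdp_policy = ctmdp_model S A qt c
  for S :: "'s::polish_space set" and A :: "'b::polish_space set"
    and qt :: "'s \<Rightarrow> 'b \<Rightarrow> 's measure" and c :: "'s \<Rightarrow> 'b \<Rightarrow> real" +
  fixes pol :: "('s, 'b) policy"
  assumes policy: "is_policy S A pol"
begin

lemma measurable_pol: "(\<lambda>(h, s). pol n h s) \<in> hist n \<Otimes>\<^sub>M borel \<rightarrow>\<^sub>M prob_algebra borel_A"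
  using policy unfolding is_policy_def by blast

lemma sets_pol: "h \<in> space (hist n) \<Longrightarrow> sets (pol n h s) = sets borel_A"
  and prob_space_pol: "h \<in> space (hist n) \<Longrightarrow> prob_space (pol n h s)"
  using measurable_space[OF measurable_pol, of "(h, s)" n]
  by (simp_all add: space_pair_measure space_prob_algebra)

lemma space_pol: "h \<in> space (hist n) \<Longrightarrow> space (pol n h s) = A"
  using sets_eq_imp_space_eq[OF sets_pol, of h n s] by simp

lemma measurable_pol_cong: "h \<in> space (hist n) \<Longrightarrow> f \<in> measurable (pol n h s) N \<longleftrightarrow> f \<in> measurable borel_A N"
  using measurable_cong_sets[OF sets_pol refl] by blast

lemma measurable_nn_integral_pol:
  assumes f: "(\<lambda>(w, a). f w a) \<in> borel_measurable (N \<Otimes>\<^sub>M borel_A)"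
    and u[measurable]: "u \<in> N \<rightarrow>\<^sub>M hist n" and v[measurable]: "v \<in> N \<rightarrow>\<^sub>M borel"
  shows "(\<lambda>w. \<integral>\<^sup>+ a. f w a \<partial>pol n (u w) (v w)) \<in> borel_measurable N"
proof (rule nn_integral_measurable_subprob_algebra2[OF f])
  have "(\<lambda>w. (u w, v w)) \<in> N \<rightarrow>\<^sub>M hist n \<Otimes>\<^sub>M borel" by measurable
  from measurable_compose[OF this measurable_prob_algebraD[OF measurable_pol]]
  show "(\<lambda>w. pol n (u w) (v w)) \<in> N \<rightarrow>\<^sub>M subprob_algebra borel_A" by simp
qed

definition mean_rate :: "('s \<Rightarrow> 'b \<Rightarrow> real) \<Rightarrow> nat \<Rightarrow> 's history \<Rightarrow> 's \<Rightarrow> real \<Rightarrow> ennreal" where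
  "mean_rate r n h z s = (\<integral>\<^sup>+ a. ennreal (r z a) \<partial>pol n h s)"

lemma measurable_mean_rate:
  assumes r: "(\<lambda>(x, a). r x a) \<in> borel_measurable (borel_S \<Otimes>\<^sub>M borel_A)"
  shows "(\<lambda>((h, z), s). mean_rate r n h z s) \<in> borel_measurable ((hist n \<Otimes>\<^sub>M borel_S) \<Otimes>\<^sub>M borel)"
proof -
  have "(\<lambda>p. (snd (fst (fst p)), snd p))
      \<in> ((hist n \<Otimes>\<^sub>M borel_S) \<Otimes>\<^sub>M (borel :: real measure)) \<Otimes>\<^sub>M borel_A \<rightarrow>\<^sub>M borel_S \<Otimes>\<^sub>M borel_A"
    by measurable
  from measurable_compose[OF this r]
  have "(\<lambda>(w, a). ennreal (r (snd (fst w)) a))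
      \<in> borel_measurable (((hist n \<Otimes>\<^sub>M borel_S) \<Otimes>\<^sub>M (borel :: real measure)) \<Otimes>\<^sub>M borel_A)"
    by (simp add: split_beta')
  then have "(\<lambda>w. \<integral>\<^sup>+ a. ennreal (r (snd (fst w)) a) \<partial>pol n (fst (fst w)) (snd w))
      \<in> borel_measurable ((hist n \<Otimes>\<^sub>M borel_S) \<Otimes>\<^sub>M borel)"
    by (rule measurable_nn_integral_pol) measurable
  then show ?thesis unfolding mean_rate_def by (simp add: split_beta')
qed

lemma measurable_mean_rate_time:
  assumes "(\<lambda>(x, a). r x a) \<in> borel_measurable (borel_S \<Otimes>\<^sub>M borel_A)" "h \<in> space (hist n)" "z \<in> S"
  shows "mean_rate r n h z \<in> borel_measurable borel"
  using measurable_Pair2[OF measurable_mean_rate[OF assms(1)], of "(h, z)" n] assms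
  by (simp add: space_pair_measure)

lemma mean_rate_le:
  assumes "h \<in> space (hist n)" "\<And>a. a \<in> A \<Longrightarrow> r z a \<le> K"
  shows "mean_rate r n h z s \<le> ennreal K"
proof -
  interpret prob_space "pol n h s" by (rule prob_space_pol[OF assms(1)])
  have "mean_rate r n h z s \<le> (\<integral>\<^sup>+ a. ennreal K \<partial>pol n h s)"
    unfolding mean_rate_def using assms
    by (intro nn_integral_mono ennreal_leI) (simp add: space_pol)
  also have "\<dots> = ennreal K" by (simp add: emeasure_space_1)
  finally show ?thesis .
qed

lemma bounded_rates_mean:
  assumes h: "h \<in> space (hist n)" and z: "z \<in> S"
  shows "bounded_rates (mean_rate q n h z) (mean_rate c n h z) (rate_bound z)"
  by (rule bounded_rates.intro)
    (use measurable_mean_rate_time[OF _ h z] mean_rate_le[OF h] rates_le_rate_bound[OF z] in auto)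

lemma measurable_cumul_mean_rate:
  assumes r: "(\<lambda>(x, a). r x a) \<in> borel_measurable (borel_S \<Otimes>\<^sub>M borel_A)"
    and w: "w \<in> N \<rightarrow>\<^sub>M hist n \<Otimes>\<^sub>M borel_S" and t: "t \<in> N \<rightarrow>\<^sub>M borel"
  shows "(\<lambda>p. cumul (mean_rate r n (fst (w p)) (snd (w p))) (t p)) \<in> borel_measurable N"
proof -
  note [measurable] = w t
  have "(\<lambda>p. (w (fst p), snd p)) \<in> N \<Otimes>\<^sub>M lborel \<rightarrow>\<^sub>M (hist n \<Otimes>\<^sub>M borel_S) \<Otimes>\<^sub>M borel" by measurable
  from measurable_compose[OF this measurable_mean_rate[OF r]]
  have [measurable]: "(\<lambda>(p, s). mean_rate r n (fst (w p)) (snd (w p)) s)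
      \<in> borel_measurable (N \<Otimes>\<^sub>M lborel)"
    by (simp add: split_beta')
  show ?thesis unfolding cumul_def by measurable
qed

abbreviation mean_clock :: "nat \<Rightarrow> 's history \<Rightarrow> 's \<Rightarrow> ennreal \<Rightarrow> ennreal" where
  "mean_clock n h z \<equiv> cumul (mean_rate q n h z)"

definition jump_integral :: "nat \<Rightarrow> 's history \<Rightarrow> 's \<Rightarrow> (ennreal \<times> 's option \<Rightarrow> ennreal) \<Rightarrow> ennreal" where
  "jump_integral n h z F =
     cumul (\<lambda>t. ennexp_neg (mean_clock n h z (ennreal t)) *
         (\<integral>\<^sup>+ a. jump_mean (\<lambda>y. F (ennreal t, Some y)) z a \<partial>pol n h t)) \<top>
     + ennexp_neg (mean_clock n h z \<top>) * F (\<top>, None)"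

lemma measurable_mean_jump_mean:
  assumes F: "(\<lambda>(w, p). F w p) \<in> borel_measurable ((hist n \<Otimes>\<^sub>M borel_S) \<Otimes>\<^sub>M Mst S)"
  shows "(\<lambda>(w, t). \<integral>\<^sup>+ a. jump_mean (\<lambda>y. F w (ennreal t, Some y)) (snd w) a \<partial>pol n (fst w) t)
    \<in> borel_measurable ((hist n \<Otimes>\<^sub>M borel_S) \<Otimes>\<^sub>M borel)"
proof -
  let ?W = "(hist n \<Otimes>\<^sub>M borel_S) \<Otimes>\<^sub>M (borel :: real measure)"
  have "(\<lambda>p. (fst (fst (fst p)), (ennreal (snd (fst (fst p))), Some (snd p))))
      \<in> (?W \<Otimes>\<^sub>M borel_A) \<Otimes>\<^sub>M borel_S \<rightarrow>\<^sub>M (hist n \<Otimes>\<^sub>M borel_S) \<Otimes>\<^sub>M Mst S"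
    by measurable
  from measurable_compose[OF this F]
  have "(\<lambda>(p, y). F (fst (fst p)) (ennreal (snd (fst p)), Some y))
      \<in> borel_measurable ((?W \<Otimes>\<^sub>M borel_A) \<Otimes>\<^sub>M borel_S)"
    by (simp add: split_beta')
  then have "(\<lambda>p. jump_mean (\<lambda>y. F (fst (fst p)) (ennreal (snd (fst p)), Some y)) (snd (fst (fst p))) (snd p))
      \<in> borel_measurable (?W \<Otimes>\<^sub>M borel_A)"
    by (rule measurable_jump_mean) measurable
  then have "(\<lambda>(w, a). jump_mean (\<lambda>y. F (fst w) (ennreal (snd w), Some y)) (snd (fst w)) a)
      \<in> borel_measurable (?W \<Otimes>\<^sub>M borel_A)"
    by (simp add: split_beta')
  then have "(\<lambda>w. \<integral>\<^sup>+ a. jump_mean (\<lambda>y. F (fst w) (ennreal (snd w), Some y)) (snd (fst w)) a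
        \<partial>pol n (fst (fst w)) (snd w)) \<in> borel_measurable ?W"
    by (rule measurable_nn_integral_pol) measurable
  then show ?thesis by (simp add: split_beta')
qed

lemma measurable_jump_integral:
  assumes F: "(\<lambda>(w, p). F w p) \<in> borel_measurable ((hist n \<Otimes>\<^sub>M borel_S) \<Otimes>\<^sub>M Mst S)"
  shows "(\<lambda>w. jump_integral n (fst w) (snd w) (F w)) \<in> borel_measurable (hist n \<Otimes>\<^sub>M borel_S)"
proof -
  let ?W = "hist n \<Otimes>\<^sub>M borel_S"
  have [measurable]: "(\<lambda>(w, t). \<integral>\<^sup>+ a. jump_mean (\<lambda>y. F w (ennreal t, Some y)) (snd w) a \<partial>pol n (fst w) t)
    \<in> borel_measurable (?W \<Otimes>\<^sub>M lborel)"
    using measurable_mean_jump_mean[OF F] by simp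
  have [measurable]: "(\<lambda>(w, t). mean_clock n (fst w) (snd w) (ennreal t))
      \<in> borel_measurable (?W \<Otimes>\<^sub>M lborel)"
    using measurable_cumul_mean_rate[OF q_measurable, of fst "?W \<Otimes>\<^sub>M lborel" n "\<lambda>p. ennreal (snd p)"]
    by (simp add: split_beta')
  have [measurable]: "(\<lambda>w. mean_clock n (fst w) (snd w) \<top>) \<in> borel_measurable ?W"
    by (rule measurable_cumul_mean_rate[OF q_measurable]) measurable
  have "(\<lambda>w. (w, (\<top>, None))) \<in> ?W \<rightarrow>\<^sub>M ?W \<Otimes>\<^sub>M Mst S"
    by (intro measurable_Pair measurable_ident_sets measurable_const refl space_top_None)
  from measurable_compose[OF this F]
  have [measurable]: "(\<lambda>w. F w (\<top>, None)) \<in> borel_measurable ?W" by simp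
  show ?thesis unfolding jump_integral_def by (subst cumul_top) measurable
qed

context
  fixes n h z
  assumes h: "h \<in> space (hist n)" and z: "z \<in> S"
begin

lemma integral_functional_mean_jump_mean:
  "integral_functional borel_S (\<lambda>f. \<integral>\<^sup>+ a. jump_mean f z a \<partial>pol n h t)"
  by (rule integral_functional_mixture)
    (simp_all add: space_pol[OF h] measurable_pol_cong[OF h] integral_functional_jump_mean z
        jump_mean_action_measurable)

lemma measurable_mean_jump_mean_time:
  assumes [measurable]: "F \<in> borel_measurable (Mst S)"
  shows "(\<lambda>t. \<integral>\<^sup>+ a. jump_mean (\<lambda>y. F (ennreal t, Some y)) z a \<partial>pol n h t) \<in> borel_measurable borel"
proof -
  have "(\<lambda>(w, p). F p) \<in> borel_measurable ((hist n \<Otimes>\<^sub>M borel_S) \<Otimes>\<^sub>M Mst S)" by measurable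
  from measurable_Pair2[OF measurable_mean_jump_mean[OF this], of "(h, z)"] show ?thesis
    using h z by (simp add: space_pair_measure)
qed

lemma integral_functional_jump_integral: "integral_functional (Mst S) (jump_integral n h z)"
proof -
  note [measurable] = measurable_mean_rate_time[OF q_measurable h z]
  have "integral_functional (Mst S) (\<lambda>F. \<integral>\<^sup>+ a. jump_mean (\<lambda>y. F (ennreal t, Some y)) z a \<partial>pol n h t)"
    for t
    by (rule integral_functional_compose[OF integral_functional_mean_jump_mean]) measurable
  moreover have "(\<lambda>t. ennexp_neg (mean_clock n h z (ennreal t))
      * (\<integral>\<^sup>+ a. jump_mean (\<lambda>y. F (ennreal t, Some y)) z a \<partial>pol n h t))
      \<in> borel_measurable borel" if "F \<in> borel_measurable (Mst S)" for F
    by (intro borel_measurable_times_ennreal measurable_mean_jump_mean_time that) measurable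
  ultimately show ?thesis
    unfolding jump_integral_def
    by (intro integral_functional_add integral_functional_cumul integral_functional_cmult
        integral_functional_eval space_top_None)
qed

lemma emeasure_qmix:
  assumes B: "B \<in> sets borel_S"
  shows "emeasure (qmix S qt z (pol n h t)) B = (\<integral>\<^sup>+ a. jump_mean (indicator B) z a \<partial>pol n h t)"
proof -
  interpret integral_functional borel_S "\<lambda>f. \<integral>\<^sup>+ a. jump_mean f z a \<partial>pol n h t"
    by (rule integral_functional_mean_jump_mean)
  have "qmix S qt z (pol n h t) = represented_measure"
    unfolding qmix_def represented_measure_def space_borel_S
  proof (rule measure_of_eq)
    show "sets borel_S \<subseteq> Pow S" using sets.space_closed[of borel_S] by simp
    fix B assume "B \<in> sigma_sets S (sets borel_S)"
    then have "B \<in> sets borel_S" using sets.sigma_sets_eq[of borel_S] by simp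
    then show "(\<integral>\<^sup>+ a. emeasure (qt z a) B \<partial>pol n h t) = (\<integral>\<^sup>+ a. jump_mean (indicator B) z a \<partial>pol n h t)"
      using z by (intro nn_integral_cong) (simp add: space_pol[OF h] sets_qt jump_mean_def)
  qed
  then show ?thesis using emeasure_represented_measure[OF B] by simp
qed

interpretation jump: integral_functional "Mst S" "jump_integral n h z"
  by (rule integral_functional_jump_integral)

lemma jump_eq_represented_measure: "jump S qt pol n h z = jump.represented_measure"
  unfolding jump_def jump.represented_measure_def
proof (rule measure_of_eq)
  show "sets (Mst S) \<subseteq> Pow (space (Mst S))" by (rule sets.space_closed)
  fix B assume "B \<in> sigma_sets (space (Mst S)) (sets (Mst S))"
  then have B: "B \<in> sets (Mst S)" using sets.sigma_sets_eq[of "Mst S"] by simp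
  have "emeasure (qmix S qt z (pol n h t)) {y\<in>S. (ennreal t, Some y) \<in> B}
      = (\<integral>\<^sup>+ a. jump_mean (\<lambda>y. indicator B (ennreal t, Some y)) z a \<partial>pol n h t)" for t
  proof -
    have "(\<lambda>y. (ennreal t, Some y)) \<in> borel_S \<rightarrow>\<^sub>M Mst S" by measurable
    from measurable_sets[OF this B] have "{y\<in>S. (ennreal t, Some y) \<in> B} \<in> sets borel_S"
      by (simp add: vimage_def Int_def conj_commute)
    then show ?thesis
      using z
      by (subst emeasure_qmix) (auto intro!: nn_integral_cong jump_mean_cong
          simp: space_pol[OF h] indicator_def)
  qed
  moreover have "Lam S qt pol n h z t = mean_clock n h z t" for t
    unfolding Lam_def cumul_def mean_rate_def ..
  ultimately show "(\<integral>\<^sup>+ t. indicator {0<..} t * ennexp_neg (Lam S qt pol n h z (ennreal t)) *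
            emeasure (qmix S qt z (pol n h t)) {y \<in> S. (ennreal t, Some y) \<in> B} \<partial>lborel) +
         ennexp_neg (Lam S qt pol n h z \<top>) * indicator B (\<top>, None) = jump_integral n h z (indicator B)"
    unfolding jump_integral_def by (subst cumul_top) (simp add: mult.assoc)
qed

lemma sets_jump: "sets (jump S qt pol n h z) = sets (Mst S)"
  unfolding jump_eq_represented_measure by simp

lemma nn_integral_jump: "F \<in> borel_measurable (Mst S)
    \<Longrightarrow> (\<integral>\<^sup>+ p. F p \<partial>jump S qt pol n h z) = jump_integral n h z F"
  unfolding jump_eq_represented_measure by (rule jump.nn_integral_represented_measure)

lemma emeasure_jump: "B \<in> sets (Mst S)
    \<Longrightarrow> emeasure (jump S qt pol n h z) B = jump_integral n h z (indicator B)"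
  unfolding jump_eq_represented_measure by (rule jump.emeasure_represented_measure)

lemma prob_space_jump: "prob_space (jump S qt pol n h z)"
proof (rule prob_spaceI)
  interpret bounded_rates "mean_rate q n h z" "mean_rate c n h z" "rate_bound z"
    by (rule bounded_rates_mean[OF h z])
  have "(\<integral>\<^sup>+ a. jump_mean (\<lambda>_. 1) z a \<partial>pol n h t) = mean_rate q n h z t" for t
    unfolding mean_rate_def using z
    by (intro nn_integral_cong) (simp add: space_pol[OF h] jump_mean_1)
  then have "jump_integral n h z (\<lambda>_. 1) = 1"
    unfolding jump_integral_def using sojourn_total_mass[OF measurable_\<rho> \<rho>_le] by simp
  then show "emeasure (jump S qt pol n h z) (space (jump S qt pol n h z)) = 1"
    using nn_integral_jump[of "\<lambda>_. 1"] by simp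
qed

end

lemma measurable_jump: "(\<lambda>(h, z). jump S qt pol n h z) \<in> hist n \<Otimes>\<^sub>M borel_S \<rightarrow>\<^sub>M subprob_algebra (Mst S)"
proof (rule measurable_subprob_algebra)
  fix w assume "w \<in> space (hist n \<Otimes>\<^sub>M borel_S)"
  then have w: "fst w \<in> space (hist n)" "snd w \<in> S" by (auto simp: space_pair_measure)
  show "subprob_space ((\<lambda>(h, z). jump S qt pol n h z) w)"
    using prob_space_jump[OF w] by (simp add: prob_space_imp_subprob_space split_beta)
  show "sets ((\<lambda>(h, z). jump S qt pol n h z) w) = sets (Mst S)"
    using sets_jump[OF w] by (simp add: split_beta)
next
  fix B assume B[measurable]: "B \<in> sets (Mst S)"
  have "(\<lambda>(w, p). indicator B p) \<in> borel_measurable ((hist n \<Otimes>\<^sub>M borel_S) \<Otimes>\<^sub>M Mst S)" by measurable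
  then have "(\<lambda>w. jump_integral n (fst w) (snd w) (indicator B)) \<in> borel_measurable (hist n \<Otimes>\<^sub>M borel_S)"
    by (rule measurable_jump_integral)
  then show "(\<lambda>w. emeasure ((\<lambda>(h, z). jump S qt pol n h z) w) B) \<in> borel_measurable (hist n \<Otimes>\<^sub>M borel_S)"
    by (subst measurable_cong[where g="\<lambda>w. jump_integral n (fst w) (snd w) (indicator B)"])
      (auto simp: space_pair_measure emeasure_jump)
qed

end

section \<open>The path measure\<close>

context ctmdp_policy
begin

definition sojourn_cost :: "nat \<Rightarrow> 's history \<Rightarrow> ennreal \<times> 's option \<Rightarrow> ennreal" where
  "sojourn_cost n h p = (case snd (h n) of None \<Rightarrow> 0 | Some z \<Rightarrow> cumul (mean_rate c n h z) (fst p))"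

definition cost_upto :: "nat \<Rightarrow> 's history \<Rightarrow> ennreal" where
  "cost_upto k \<omega> = (\<Sum>i<k. sojourn_cost i (restrict \<omega> {0..<Suc i}) (\<omega> (Suc i)))"

lemma pathcost_eq_SUP: "pathcost c pol \<omega> = (SUP k. cost_upto k \<omega>)"
proof -
  have "pathcost c pol \<omega> = (\<Sum>i. sojourn_cost i (restrict \<omega> {0..<Suc i}) (\<omega> (Suc i)))"
    unfolding pathcost_def sojourn_cost_def cumul_def mean_rate_def
    by (intro suminf_cong) (simp split: option.split)
  then show ?thesis unfolding cost_upto_def suminf_eq_SUP .
qed

lemma incseq_cost_upto: "incseq (\<lambda>k. cost_upto k \<omega>)"
  unfolding cost_upto_def by (rule incseq_SucI) simp

lemma cost_upto_cong:
  assumes "\<And>i. i \<le> k \<Longrightarrow> \<omega> i = \<omega>' i"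
  shows "cost_upto k \<omega> = cost_upto k \<omega>'"
proof -
  have "restrict \<omega> {0..<Suc i} = restrict \<omega>' {0..<Suc i}" if "i < k" for i
    using assms that by (intro restrict_ext) auto
  then show ?thesis unfolding cost_upto_def using assms by (intro sum.cong) auto
qed

lemma measurable_state:
  fixes m n :: nat
  assumes "m < n"
  shows "(\<lambda>h. snd (h m)) \<in> PiM {0..<n} (\<lambda>_. Mst S) \<rightarrow>\<^sub>M Sinf S"
proof -
  have "(\<lambda>h. h m) \<in> PiM {0..<n} (\<lambda>_. Mst S) \<rightarrow>\<^sub>M Mst S"
    using assms by (intro measurable_component_singleton) simp
  then show ?thesis by measurable
qed

lemma hist_state_cases:
  assumes "h \<in> space (hist n)"
  obtains "snd (h n) = None" | z where "snd (h n) = Some z" "z \<in> S"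
  using measurable_space[OF measurable_state, of n "Suc n" h] assms unfolding space_Sinf by auto

lemma measurable_sojourn_cost: "(\<lambda>(h, p). sojourn_cost n h p) \<in> borel_measurable (hist n \<Otimes>\<^sub>M Mst S)"
proof -
  have state: "(\<lambda>w. snd (fst w n)) \<in> hist n \<Otimes>\<^sub>M Mst S \<rightarrow>\<^sub>M Sinf S"
    by (rule measurable_compose[OF measurable_fst measurable_state]) simp
  have "(\<lambda>p. cumul (mean_rate c n (fst (fst p)) (snd p)) (fst (snd (fst p))))
      \<in> borel_measurable ((hist n \<Otimes>\<^sub>M Mst S) \<Otimes>\<^sub>M borel_S)"
    using measurable_cumul_mean_rate[OF c_measurable, of "\<lambda>p. (fst (fst p), snd p)"
        "(hist n \<Otimes>\<^sub>M Mst S) \<Otimes>\<^sub>M borel_S" n "\<lambda>p. fst (snd (fst p))"]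
    by simp
  then have "(\<lambda>w. case snd (fst w n) of None \<Rightarrow> 0 | Some z \<Rightarrow> cumul (mean_rate c n (fst w) z) (fst (snd w)))
      \<in> borel_measurable (hist n \<Otimes>\<^sub>M Mst S)"
    by (intro measurable_case_Sinf[OF state _ _ S_nonempty]) (auto simp: split_beta')
  then show ?thesis unfolding sojourn_cost_def by (simp add: split_beta')
qed

lemma measurable_cost_upto:
  assumes "{0..<Suc k} \<subseteq> J"
  shows "cost_upto k \<in> borel_measurable (PiM J (\<lambda>_. Mst S))"
  unfolding cost_upto_def
proof (rule borel_measurable_sum)
  fix i assume i: "i \<in> {..<k}"
  have "(\<lambda>\<omega>. (restrict \<omega> {0..<Suc i}, \<omega> (Suc i))) \<in> PiM J (\<lambda>_. Mst S) \<rightarrow>\<^sub>M hist i \<Otimes>\<^sub>M Mst S"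
    using assms i
    by (intro measurable_Pair measurable_restrict_subset measurable_component_singleton) auto
  from measurable_compose[OF this measurable_sojourn_cost]
  show "(\<lambda>\<omega>. sojourn_cost i (restrict \<omega> {0..<Suc i}) (\<omega> (Suc i))) \<in> borel_measurable (PiM J (\<lambda>_. Mst S))"
    by simp
qed

lemma restrict_hist: "h \<in> space (PiM J (\<lambda>_. Mst S)) \<Longrightarrow> restrict h J = h"
  by (auto simp: space_PiM PiE_def extensional_restrict)

lemma trans_Suc:
  assumes "h \<in> space (hist m)"
  shows "trans S qt pol x (Suc m) h
    = (case snd (h m) of None \<Rightarrow> return (Mst S) (\<top>, None) | Some z \<Rightarrow> jump S qt pol m h z)"
  unfolding trans_def by (auto simp: restrict_hist[OF assms] split: option.split)

lemma Ionescu_Tulcea_trans: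
  assumes x: "x \<in> S"
  shows "Ionescu_Tulcea (trans S qt pol x) (\<lambda>_. Mst S)"
proof (rule Ionescu_Tulcea.intro)
  have x_space: "(0, Some x) \<in> space (Mst S)" using x by (simp add: space_Mst)
  show "trans S qt pol x i \<in> PiM {0..<i} (\<lambda>_. Mst S) \<rightarrow>\<^sub>M subprob_algebra (Mst S)" for i
  proof (cases i)
    case 0
    from measurable_compose[OF measurable_const[OF x_space] return_measurable]
    show ?thesis unfolding trans_def 0 by simp
  next
    case (Suc m)
    have "(\<lambda>h. case snd (h m) of None \<Rightarrow> return (Mst S) (\<top>, None) | Some z \<Rightarrow> jump S qt pol m h z)
        \<in> hist m \<rightarrow>\<^sub>M subprob_algebra (Mst S)"
      using measurable_compose[OF measurable_const[OF space_top_None] return_measurable]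
      by (intro measurable_case_Sinf[OF _ _ measurable_jump S_nonempty] measurable_state) auto
    then show ?thesis
      unfolding Suc by (rule measurable_cong[THEN iffD1, rotated]) (simp add: trans_Suc)
  qed
  show "prob_space (trans S qt pol x i h)" if h: "h \<in> space (PiM {0..<i} (\<lambda>_. Mst S))" for i h
  proof (cases i)
    case 0
    then show ?thesis unfolding trans_def using x_space by (auto intro!: prob_space_return)
  next
    case (Suc m)
    then have hm: "h \<in> space (hist m)" using h by simp
    show ?thesis
      using hm unfolding Suc trans_Suc[OF hm]
      by (cases rule: hist_state_cases)
        (auto intro!: prob_space_return prob_space_jump[OF hm] space_top_None)
  qed
qed

text \<open>The value \<open>1 = exp 0\<close> at the cemetery reflects that no cost accrues there.\<close>

definition lift :: "('s \<Rightarrow> ennreal) \<Rightarrow> 's option \<Rightarrow> ennreal" where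
  "lift V s = (case s of None \<Rightarrow> 1 | Some y \<Rightarrow> V y)"

lemma lift_simps[simp]: "lift V None = 1" "lift V (Some y) = V y"
  unfolding lift_def by simp_all

lemma lift_1: "lift (\<lambda>_. 1) = (\<lambda>_. 1)"
  unfolding lift_def by (simp add: fun_eq_iff split: option.split)

lemma measurable_lift: "V \<in> borel_measurable borel_S \<Longrightarrow> lift V \<in> borel_measurable (Sinf S)"
  by (rule measurable_from_Sinf) auto

definition next_value :: "nat \<Rightarrow> 's history \<Rightarrow> ('s \<Rightarrow> ennreal) \<Rightarrow> ennreal" where
  "next_value k h V = (case snd (h k) of None \<Rightarrow> 1
     | Some z \<Rightarrow> one_jump_value (mean_rate q k h z) (mean_rate c k h z)
       (\<lambda>t. \<integral>\<^sup>+ a. jump_mean V z a \<partial>pol k h t))"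

lemma measurable_next_stage:
  assumes h: "h \<in> space (hist k)" and V: "V \<in> borel_measurable borel_S"
  shows "(\<lambda>p. ennexp (sojourn_cost k h p) * lift V (snd p)) \<in> borel_measurable (Mst S)"
proof -
  have [measurable]: "sojourn_cost k h \<in> borel_measurable (Mst S)"
    using measurable_Pair2[OF measurable_sojourn_cost h] by simp
  note [measurable] = measurable_lift[OF V]
  show ?thesis by measurable
qed

lemma nn_integral_trans_Suc:
  assumes h: "h \<in> space (hist k)" and V: "V \<in> borel_measurable borel_S"
  shows "(\<integral>\<^sup>+ p. ennexp (sojourn_cost k h p) * lift V (snd p) \<partial>trans S qt pol x (Suc k) h)
      = next_value k h V"
  using h
proof (cases rule: hist_state_cases)
  case 1
  then show ?thesis
    unfolding trans_Suc[OF h] next_value_def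
    using nn_integral_return[OF space_top_None measurable_next_stage[OF h V]]
    by (simp add: sojourn_cost_def)
next
  case (2 z)
  interpret integral_functional borel_S "\<lambda>f. \<integral>\<^sup>+ a. jump_mean f z a \<partial>pol k h t" for t
    by (rule integral_functional_mean_jump_mean[OF h 2(2)])
  have "(\<integral>\<^sup>+ p. ennexp (sojourn_cost k h p) * lift V (snd p) \<partial>trans S qt pol x (Suc k) h)
      = jump_integral k h z (\<lambda>p. ennexp (sojourn_cost k h p) * lift V (snd p))"
    unfolding trans_Suc[OF h]
    using nn_integral_jump[OF h 2(2) measurable_next_stage[OF h V]] 2(1) by simp
  also have "\<dots> = next_value k h V"
    unfolding jump_integral_def next_value_def one_jump_value_def sojourn_cost_def
    using 2(1) cmult[OF V] by simp
  finally show ?thesis .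
qed

context
  fixes x assumes x: "x \<in> S"
begin

interpretation IT: Ionescu_Tulcea "trans S qt pol x" "\<lambda>_. Mst S"
  by (rule Ionescu_Tulcea_trans[OF x])

abbreviation "path_law k \<equiv> IT.C 0 k (\<lambda>_. undefined)"

definition staged_value :: "nat \<Rightarrow> ('s \<Rightarrow> ennreal) \<Rightarrow> ennreal" where
  "staged_value k V = (\<integral>\<^sup>+ \<omega>. ennexp (cost_upto k \<omega>) * lift V (snd (\<omega> k)) \<partial>path_law (Suc k))"

lemma undefined_in_space: "(\<lambda>_. undefined) \<in> space (PiM {0..<0::nat} (\<lambda>_. Mst S))"
  by (simp add: space_PiM PiE_def extensional_def)

lemma space_path_law: "space (path_law k) = space (PiM {0..<k} (\<lambda>_. Mst S))"
  and sets_path_law: "sets (path_law k) = sets (PiM {0..<k} (\<lambda>_. Mst S))"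
  using IT.space_C[OF undefined_in_space, of k] IT.sets_C[OF undefined_in_space, of k] by simp_all

lemma nn_integral_path_law_Suc:
  assumes F: "F \<in> borel_measurable (PiM {0..<Suc k} (\<lambda>_. Mst S))"
  shows "(\<integral>\<^sup>+ \<omega>. F \<omega> \<partial>path_law (Suc k))
      = (\<integral>\<^sup>+ \<omega>. \<integral>\<^sup>+ p. F (fun_upd \<omega> k p) \<partial>trans S qt pol x k \<omega> \<partial>path_law k)"
proof -
  have "(\<integral>\<^sup>+ \<omega>. F \<omega> \<partial>path_law (Suc k)) = (\<integral>\<^sup>+ \<omega>. \<integral>\<^sup>+ \<omega>'. F \<omega>' \<partial>IT.eP k \<omega> \<partial>path_law k)"
    using F IT.measurable_eP[of k]
    by (simp add: nn_integral_bind[where B="PiM {0..<Suc k} (\<lambda>_. Mst S)"]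
        measurable_cong_sets[OF sets_path_law refl])
  also have "\<dots> = (\<integral>\<^sup>+ \<omega>. \<integral>\<^sup>+ p. F (fun_upd \<omega> k p) \<partial>trans S qt pol x k \<omega> \<partial>path_law k)"
    by (intro nn_integral_cong IT.nn_integral_eP F) (simp add: space_path_law)
  finally show ?thesis .
qed

lemma measurable_staged_cost:
  assumes V: "V \<in> borel_measurable borel_S"
  shows "(\<lambda>\<omega>. ennexp (cost_upto k \<omega>) * lift V (snd (\<omega> k))) \<in> borel_measurable (hist k)"
proof -
  note [measurable] = measurable_cost_upto[OF order_refl, of k]
    measurable_compose[OF measurable_state[of k "Suc k"] measurable_lift[OF V]]
  show ?thesis by measurable
qed

lemma staged_value_0:
  assumes V: "V \<in> borel_measurable borel_S"
  shows "staged_value 0 V = V x"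
proof -
  have V': "(\<lambda>p. lift V (snd p)) \<in> borel_measurable (Mst S)"
    using measurable_lift[OF V] by measurable
  have "staged_value 0 V = (\<integral>\<^sup>+ \<omega>. \<integral>\<^sup>+ p. lift V (snd p) \<partial>trans S qt pol x 0 \<omega> \<partial>path_law 0)"
    unfolding staged_value_def nn_integral_path_law_Suc[OF measurable_staged_cost[OF V]]
    by (simp add: cost_upto_def)
  also have "\<dots> = (\<integral>\<^sup>+ \<omega>. V x \<partial>path_law 0)"
    unfolding trans_def using nn_integral_return[OF _ V', of "(0, Some x)"] x
    by (simp add: space_Mst)
  also have "\<dots> = V x"
    using prob_space.emeasure_space_1[OF IT.prob_space_C[OF undefined_in_space, of 0]] by simp
  finally show ?thesis .
qed

lemma staged_value_Suc:
  assumes V: "V \<in> borel_measurable borel_S"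
  shows "staged_value (Suc k) V = (\<integral>\<^sup>+ \<omega>. ennexp (cost_upto k \<omega>) * next_value k \<omega> V \<partial>path_law (Suc k))"
  unfolding staged_value_def nn_integral_path_law_Suc[OF measurable_staged_cost[OF V]]
proof (rule nn_integral_cong)
  fix \<omega> assume "\<omega> \<in> space (path_law (Suc k))"
  then have \<omega>: "\<omega> \<in> space (hist k)" unfolding space_path_law .
  let ?T = "trans S qt pol x (Suc k) \<omega>" and ?F = "\<lambda>p. ennexp (sojourn_cost k \<omega> p) * lift V (snd p)"
  have cost: "cost_upto (Suc k) (fun_upd \<omega> (Suc k) p) = cost_upto k \<omega> + sojourn_cost k \<omega> p" for p
  proof -
    have "restrict (fun_upd \<omega> (Suc k) p) {0..<Suc k} = restrict \<omega> {0..<Suc k}"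
      by (intro restrict_ext) auto
    also have "\<dots> = \<omega>" by (rule restrict_hist[OF \<omega>])
    finally show ?thesis
      using cost_upto_cong[of k "fun_upd \<omega> (Suc k) p" \<omega>] unfolding cost_upto_def by simp
  qed
  have "?F \<in> borel_measurable ?T"
    using measurable_next_stage[OF \<omega> V] measurable_cong_sets[OF IT.sets_P[OF \<omega>] refl] by blast
  then have "(\<integral>\<^sup>+ p. ennexp (cost_upto k \<omega>) * ?F p \<partial>?T) = ennexp (cost_upto k \<omega>) * (\<integral>\<^sup>+ p. ?F p \<partial>?T)"
    by (rule nn_integral_cmult)
  then show "(\<integral>\<^sup>+ p. ennexp (cost_upto (Suc k) (fun_upd \<omega> (Suc k) p))
      * lift V (snd (fun_upd \<omega> (Suc k) p (Suc k))) \<partial>?T)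
      = ennexp (cost_upto k \<omega>) * next_value k \<omega> V"
    unfolding cost ennexp_add nn_integral_trans_Suc[OF \<omega> V] by (simp add: mult.assoc)
qed

lemma staged_value_le_Suc:
  assumes V: "V \<in> borel_measurable borel_S"
    and "\<And>h. h \<in> space (hist k) \<Longrightarrow> lift V' (snd (h k)) \<le> next_value k h V"
  shows "staged_value k V' \<le> staged_value (Suc k) V"
  unfolding staged_value_Suc[OF V] unfolding staged_value_def
  using assms(2)
  by (intro nn_integral_mono mult_left_mono) (auto simp: space_path_law simp del: IT.C.simps)

lemma staged_value_Suc_le:
  assumes V: "V \<in> borel_measurable borel_S"
    and "\<And>h. h \<in> space (hist k) \<Longrightarrow> next_value k h V \<le> lift V' (snd (h k))"
  shows "staged_value (Suc k) V \<le> staged_value k V'"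
  unfolding staged_value_Suc[OF V] unfolding staged_value_def
  using assms(2)
  by (intro nn_integral_mono mult_left_mono) (auto simp: space_path_law simp del: IT.C.simps)

lemma staged_value_mono:
  assumes le: "\<And>y. y \<in> S \<Longrightarrow> V y \<le> V' y"
  shows "staged_value k V \<le> staged_value k V'"
  unfolding staged_value_def
proof (intro nn_integral_mono mult_left_mono)
  fix \<omega> assume "\<omega> \<in> space (path_law (Suc k))"
  then have "\<omega> \<in> space (hist k)" unfolding space_path_law .
  then show "lift V (snd (\<omega> k)) \<le> lift V' (snd (\<omega> k))"
    by (cases rule: hist_state_cases) (auto intro: le)
qed simp

lemma nn_integral_Pth_restrict:
  assumes F: "F \<in> borel_measurable (hist k)"
  shows "(\<integral>\<^sup>+ \<omega>. F (restrict \<omega> {0..<Suc k}) \<partial>Pth S qt pol x) = (\<integral>\<^sup>+ \<omega>. F \<omega> \<partial>path_law (Suc k))"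
proof -
  let ?J = "{0..<Suc k}"
  have "IT.up_to ?J \<le> Suc k" by (subst IT.up_to_iff_Ico) auto
  moreover have "Suc k \<le> IT.up_to ?J" using IT.up_to_less[of ?J k] by simp
  ultimately have CI: "IT.CI ?J = distr (path_law (Suc k)) (hist k) (\<lambda>\<omega>. restrict \<omega> ?J)"
    unfolding IT.CI_def by simp
  have measurable_restrict: "(\<lambda>\<omega>. restrict \<omega> ?J) \<in> IT.PF.lim \<rightarrow>\<^sub>M hist k"
    "(\<lambda>\<omega>. restrict \<omega> ?J) \<in> path_law (Suc k) \<rightarrow>\<^sub>M hist k"
    using measurable_restrict_subset[of ?J _ "\<lambda>_. Mst S"] measurable_cong_sets[OF IT.PF.sets_lim refl]
      measurable_cong_sets[OF sets_path_law refl] by blast+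
  have "(\<integral>\<^sup>+ \<omega>. F (restrict \<omega> ?J) \<partial>Pth S qt pol x)
      = (\<integral>\<^sup>+ \<omega>. F \<omega> \<partial>distr IT.PF.lim (hist k) (\<lambda>\<omega>. restrict \<omega> ?J))"
    unfolding Pth_def
    by (rule nn_integral_distr[symmetric, OF measurable_restrict(1)]) (simp add: F)
  also have "distr IT.PF.lim (hist k) (\<lambda>\<omega>. restrict \<omega> ?J)
      = distr (path_law (Suc k)) (hist k) (\<lambda>\<omega>. restrict \<omega> ?J)"
    unfolding CI[symmetric] by (rule IT.distr_lim) simp
  also have "(\<integral>\<^sup>+ \<omega>. F \<omega> \<partial>\<dots>) = (\<integral>\<^sup>+ \<omega>. F (restrict \<omega> ?J) \<partial>path_law (Suc k))"
    by (rule nn_integral_distr[OF measurable_restrict(2)]) (simp add: F)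
  also have "\<dots> = (\<integral>\<^sup>+ \<omega>. F \<omega> \<partial>path_law (Suc k))"
    by (intro nn_integral_cong) (simp add: space_path_law restrict_hist del: IT.C.simps)
  finally show ?thesis .
qed

lemma nn_integral_Pth_cost_upto: "(\<integral>\<^sup>+ \<omega>. ennexp (cost_upto k \<omega>) \<partial>Pth S qt pol x)
    = staged_value k (\<lambda>_. 1)"
proof -
  have "(\<lambda>\<omega>. ennexp (cost_upto k \<omega>)) \<in> borel_measurable (hist k)"
    by (rule measurable_compose[OF measurable_cost_upto[OF order_refl]]) measurable
  moreover have "cost_upto k (restrict \<omega> {0..<Suc k}) = cost_upto k \<omega>" for \<omega>
    by (rule cost_upto_cong) simp
  ultimately show ?thesis
    unfolding staged_value_def lift_1
    using nn_integral_Pth_restrict[of "\<lambda>\<omega>. ennexp (cost_upto k \<omega>)" k] by simp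
qed

lemma Vcrit_eq_SUP: "Vcrit S qt c pol x = (SUP k. staged_value k (\<lambda>_. 1))"
proof -
  have [measurable]: "cost_upto k \<in> borel_measurable (Pth S qt pol x)" for k
    using measurable_cost_upto[of k UNIV] measurable_cong_sets[OF IT.PF.sets_lim refl]
    unfolding Pth_def by blast
  have "Vcrit S qt c pol x = (\<integral>\<^sup>+ \<omega>. (SUP k. ennexp (cost_upto k \<omega>)) \<partial>Pth S qt pol x)"
    unfolding Vcrit_def pathcost_eq_SUP ennexp_SUP[OF incseq_cost_upto] ..
  also have "\<dots> = (SUP k. \<integral>\<^sup>+ \<omega>. ennexp (cost_upto k \<omega>) \<partial>Pth S qt pol x)"
  proof (rule nn_integral_monotone_convergence_SUP)
    show "incseq (\<lambda>k \<omega>. ennexp (cost_upto k \<omega>))"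
      unfolding incseq_def le_fun_def by (intro allI impI ennexp_mono incseqD[OF incseq_cost_upto])
  qed measurable
  finally show ?thesis unfolding nn_integral_Pth_cost_upto .
qed

end

lemma next_value_None: "snd (h k) = None \<Longrightarrow> next_value k h V = 1"
  unfolding next_value_def by simp

context
  fixes k h z and V :: "'s \<Rightarrow> ennreal"
  assumes h: "h \<in> space (hist k)" and state: "snd (h k) = Some z" and z: "z \<in> S"
    and V: "V \<in> borel_measurable borel_S" "\<And>y. y \<in> S \<Longrightarrow> 1 \<le> V y"
begin

abbreviation mean_jump :: "real \<Rightarrow> ennreal" where
  "mean_jump t \<equiv> (\<integral>\<^sup>+ a. jump_mean V z a \<partial>pol k h t)"

lemma next_value_Some: "next_value k h V
    = one_jump_value (mean_rate q k h z) (mean_rate c k h z) mean_jump"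
  unfolding next_value_def using state by simp

lemma measurable_mean_jump: "mean_jump \<in> borel_measurable borel"
proof -
  have "(\<lambda>p. lift V (snd p)) \<in> borel_measurable (Mst S)"
    using measurable_lift[OF V(1)] by measurable
  from measurable_mean_jump_mean_time[OF h z this] show ?thesis by simp
qed

lemma mean_rate_le_mean_jump: "mean_rate q k h z t \<le> mean_jump t"
  unfolding mean_rate_def using jump_mean_ge_q[OF z _ V(2)]
  by (intro nn_integral_mono) (simp add: space_pol[OF h])

lemma next_value_ge_1: "1 \<le> next_value k h V"
proof -
  interpret bounded_rates "mean_rate q k h z" "mean_rate c k h z" "rate_bound z"
    by (rule bounded_rates_mean[OF h z])
  show ?thesis
    unfolding next_value_Some
    by (rule one_jump_value_ge_1[OF measurable_\<rho> \<rho>_le mean_rate_le_mean_jump])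
qed

lemma nn_integral_pol_affine_rate:
  assumes r: "(\<lambda>(x, a). r x a) \<in> borel_measurable (borel_S \<Otimes>\<^sub>M borel_A)"
    and f: "f \<in> borel_measurable borel_A"
  shows "(\<integral>\<^sup>+ a. f a + v * ennreal (r z a) \<partial>pol k h t)
      = (\<integral>\<^sup>+ a. f a \<partial>pol k h t) + v * mean_rate r k h z t"
proof -
  have [measurable]: "r z \<in> borel_measurable (pol k h t)" "f \<in> borel_measurable (pol k h t)"
    unfolding measurable_pol_cong[OF h] using rate_action_measurable[OF r z] f by auto
  show ?thesis unfolding mean_rate_def by (simp add: nn_integral_add nn_integral_cmult)
qed

lemma next_value_lower:
  assumes \<delta>: "0 < \<delta>"
    and le: "\<And>a. a \<in> A \<Longrightarrow> \<delta> + ennreal v * ennreal (q z a) \<le> jump_mean V z a + ennreal v * ennreal (c z a)"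
  shows "ennreal v \<le> next_value k h V"
proof -
  interpret bounded_rates "mean_rate q k h z" "mean_rate c k h z" "rate_bound z"
    by (rule bounded_rates_mean[OF h z])
  have "ennreal v * mean_rate q k h z t + \<delta> \<le> mean_jump t + ennreal v * mean_rate c k h z t" for t
  proof -
    interpret prob_space "pol k h t" by (rule prob_space_pol[OF h])
    have "ennreal v * mean_rate q k h z t + \<delta> = (\<integral>\<^sup>+ a. \<delta> + ennreal v * ennreal (q z a) \<partial>pol k h t)"
      by (subst nn_integral_pol_affine_rate[OF q_measurable]) (simp_all add: emeasure_space_1 add.commute)
    also have "\<dots> \<le> (\<integral>\<^sup>+ a. jump_mean V z a + ennreal v * ennreal (c z a) \<partial>pol k h t)"
      using le by (intro nn_integral_mono) (simp add: space_pol[OF h])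
    also have "\<dots> = mean_jump t + ennreal v * mean_rate c k h z t"
      by (rule nn_integral_pol_affine_rate[OF c_measurable jump_mean_action_measurable[OF V(1) z]])
    finally show ?thesis .
  qed
  then show ?thesis
    unfolding next_value_Some
    by (rule one_jump_lower_bound[OF measurable_mean_jump \<delta> mean_rate_le_mean_jump])
qed

lemma next_value_upper:
  assumes v: "1 \<le> v"
    and le: "\<And>t. AE a in pol k h t. jump_mean V z a + ennreal v * ennreal (c z a)
        \<le> ennreal v * ennreal (q z a)"
  shows "next_value k h V \<le> ennreal v"
proof -
  interpret bounded_rates "mean_rate q k h z" "mean_rate c k h z" "rate_bound z"
    by (rule bounded_rates_mean[OF h z])
  have "mean_jump t + ennreal v * mean_rate c k h z t \<le> ennreal v * mean_rate q k h z t" for t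
  proof -
    have "mean_jump t + ennreal v * mean_rate c k h z t
        = (\<integral>\<^sup>+ a. jump_mean V z a + ennreal v * ennreal (c z a) \<partial>pol k h t)"
      by (rule nn_integral_pol_affine_rate[OF c_measurable jump_mean_action_measurable[OF V(1) z],
            symmetric])
    also have "\<dots> \<le> (\<integral>\<^sup>+ a. 0 + ennreal v * ennreal (q z a) \<partial>pol k h t)"
      using le by (intro nn_integral_mono_AE) simp
    also have "\<dots> = ennreal v * mean_rate q k h z t"
      by (subst nn_integral_pol_affine_rate[OF q_measurable]) simp_all
    finally show ?thesis .
  qed
  then show ?thesis
    unfolding next_value_Some by (rule one_jump_upper_bound[OF measurable_mean_jump v])
qed

end

end

section \<open>The optimality operator\<close>

lemma sets_borel_prod_of_restrict:
  fixes S :: "'s::second_countable_topology set" and A :: "'b::second_countable_topology set"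
  assumes S: "S \<in> sets borel" and A: "A \<in> sets borel"
    and B: "B \<in> sets (restrict_space borel S \<Otimes>\<^sub>M restrict_space borel A)"
  shows "B \<in> sets (borel :: ('s \<times> 'b) measure)"
proof -
  have SA: "S \<times> A \<in> sets (borel :: ('s \<times> 'b) measure)"
    unfolding borel_prod[symmetric] using S A by auto
  have "(\<lambda>p. p) \<in> restrict_space (borel \<Otimes>\<^sub>M borel) (S \<times> A)
      \<rightarrow>\<^sub>M restrict_space borel S \<Otimes>\<^sub>M restrict_space borel A"
    unfolding measurable_pair_iff comp_def
    by (intro conjI measurable_restrict_space3 measurable_fst measurable_snd) auto
  from measurable_sets[OF this B]
  have "B \<inter> (S \<times> A) \<in> sets (restrict_space (borel :: ('s \<times> 'b) measure) (S \<times> A))"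
    by (simp add: space_restrict_space borel_prod space_pair_measure)
  moreover have "B \<subseteq> S \<times> A"
    using sets.sets_into_space[OF B] by (simp add: space_pair_measure space_restrict_space)
  ultimately show ?thesis using SA by (simp add: sets_restrict_space_iff Int_absorb2)
qed

context ctmdp_model
begin

definition feasible :: "('s \<Rightarrow> ennreal) \<Rightarrow> 's \<Rightarrow> real \<Rightarrow> real \<Rightarrow> 'b set" where
  "feasible V x v d = {a\<in>A. jump_mean V x a + ennreal v * ennreal (c x a)
      \<le> ennreal v * ennreal (q x a) + ennreal d}"

text \<open>The optimal value at \<open>x\<close> when \<open>V\<close> is collected at the first jump: constant controls are
  optimal, and the constant control \<open>a\<close> has value at most \<open>v\<close> iff \<open>a \<in> feasible V x v 0\<close>.\<close>

definition opt_op :: "('s \<Rightarrow> ennreal) \<Rightarrow> 's \<Rightarrow> ennreal" where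
  "opt_op V x = (INF v\<in>{v. 1 \<le> v \<and> feasible V x v 0 \<noteq> {}}. ennreal v)"

definition opt_val :: "('s \<Rightarrow> ennreal) \<Rightarrow> 's \<Rightarrow> 'b \<Rightarrow> ereal" where
  "opt_val V x a = ereal (c x a * enn2real (V x))
      + enn2ereal (jump_mean V x a) - ereal (q x a * enn2real (V x))"

lemma opt_eq_iff: "opt_eq S A qt c V \<longleftrightarrow> (\<forall>x\<in>S. V x < \<top> \<longrightarrow> (INF a\<in>A. opt_val V x a) = 0)"
  unfolding opt_eq_def opt_val_def jump_mean_def ..

lemma feasible_subset: "feasible V x v d \<subseteq> A"
  unfolding feasible_def by blast

lemma feasible_iff:
  assumes "x \<in> S" "a \<in> A" "0 \<le> v" "0 \<le> d"
  shows "a \<in> feasible V x v d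
      \<longleftrightarrow> jump_mean V x a < \<top> \<and> enn2real (jump_mean V x a) + v * c x a \<le> v * q x a + d"
proof (cases "jump_mean V x a")
  case (real g)
  have "a \<in> feasible V x v d \<longleftrightarrow> ennreal (g + v * c x a) \<le> ennreal (v * q x a + d)"
    unfolding feasible_def using assms real c_nonneg[OF assms(1,2)] by (simp add: ennreal_mult)
  also have "\<dots> \<longleftrightarrow> g + v * c x a \<le> v * q x a + d"
    using assms by (intro ennreal_le_iff) simp
  finally show ?thesis using real by simp
qed (simp add: feasible_def top_unique ennreal_mult_eq_top_iff)

lemma opt_val_le_iff:
  assumes "x \<in> S" "a \<in> A" "0 \<le> d"
  shows "opt_val V x a \<le> ereal d \<longleftrightarrow> a \<in> feasible V x (enn2real (V x)) d"
  unfolding feasible_iff[OF assms(1,2) enn2real_nonneg assms(3)] opt_val_def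
  by (cases "jump_mean V x a") (auto simp: enn2ereal_ennreal algebra_simps)

lemma opt_val_less_0_iff:
  "opt_val V x a < 0
    \<longleftrightarrow> jump_mean V x a < \<top> \<and> enn2real (jump_mean V x a) < enn2real (V x) * (q x a - c x a)"
  unfolding opt_val_def by (cases "jump_mean V x a") (auto simp: enn2ereal_ennreal algebra_simps)

lemma feasible_mono:
  assumes x: "x \<in> S" and v: "1 \<le> v" "v \<le> v'"
  shows "feasible V x v 0 \<subseteq> feasible V x v' 0"
proof
  fix a assume a: "a \<in> feasible V x v 0"
  then have A: "a \<in> A" using feasible_subset by blast
  then have fin: "jump_mean V x a < \<top>" and le: "enn2real (jump_mean V x a) \<le> v * (q x a - c x a)"
    using a v feasible_iff[OF x A, of v 0 V] by (auto simp: algebra_simps)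
  then have "0 \<le> v * (q x a - c x a)" using enn2real_nonneg order_trans by blast
  then have "v * (q x a - c x a) \<le> v' * (q x a - c x a)"
    using v by (intro mult_right_mono) (auto simp: zero_le_mult_iff)
  then show "a \<in> feasible V x v' 0"
    using fin le v feasible_iff[OF x A, of v' 0 V] by (auto simp: algebra_simps)
qed

lemma feasible_antimono:
  assumes "x \<in> S" "\<And>y. y \<in> S \<Longrightarrow> V y \<le> V' y" "d \<le> d'"
  shows "feasible V' x v d \<subseteq> feasible V x v d'"
proof
  fix a assume a: "a \<in> feasible V' x v d"
  then have "a \<in> A" using feasible_subset by blast
  then have "jump_mean V x a + ennreal v * ennreal (c x a)
      \<le> jump_mean V' x a + ennreal v * ennreal (c x a)"
    using assms by (intro add_right_mono jump_mean_mono) auto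
  also have "\<dots> \<le> ennreal v * ennreal (q x a) + ennreal d" using a unfolding feasible_def by blast
  also have "\<dots> \<le> ennreal v * ennreal (q x a) + ennreal d'"
    using assms by (intro add_left_mono ennreal_leI) simp
  finally show "a \<in> feasible V x v d'" unfolding feasible_def using \<open>a \<in> A\<close> by blast
qed

lemma opt_op_ge_1: "1 \<le> opt_op V x"
  unfolding opt_op_def by (rule INF_greatest) (simp add: ennreal_1[symmetric] del: ennreal_1)

lemma opt_op_mono: "x \<in> S \<Longrightarrow> (\<And>y. y \<in> S \<Longrightarrow> V y \<le> V' y) \<Longrightarrow> opt_op V x \<le> opt_op V' x"
  unfolding opt_op_def using feasible_antimono[of x V V' 0 0] by (intro INF_superset_mono) blast+

lemma opt_op_le: "1 \<le> v \<Longrightarrow> feasible V x v 0 \<noteq> {} \<Longrightarrow> opt_op V x \<le> ennreal v"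
  unfolding opt_op_def by (intro INF_lower) auto

lemma measurable_feasible:
  assumes V[measurable]: "V \<in> borel_measurable borel_S" and v[measurable]: "v \<in> borel_measurable borel_S"
  shows "{(x, a) \<in> S \<times> A. a \<in> feasible V x (v x) d} \<in> sets borel"
proof -
  let ?M = "borel_S \<Otimes>\<^sub>M borel_A"
  have "(\<lambda>(w, y). V y) \<in> borel_measurable (?M \<Otimes>\<^sub>M borel_S)" by measurable
  then have [measurable]: "(\<lambda>p. jump_mean V (fst p) (snd p)) \<in> borel_measurable ?M"
    by (rule measurable_jump_mean) measurable
  have [measurable]: "(\<lambda>p. q (fst p) (snd p)) \<in> borel_measurable ?M"
    "(\<lambda>p. c (fst p) (snd p)) \<in> borel_measurable ?M"
    using q_measurable c_measurable by (simp_all add: split_beta')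
  have "{p \<in> space ?M. jump_mean V (fst p) (snd p) + ennreal (v (fst p)) * ennreal (c (fst p) (snd p))
      \<le> ennreal (v (fst p)) * ennreal (q (fst p) (snd p)) + ennreal d} \<in> sets ?M"
    by measurable
  also have "{p \<in> space ?M. jump_mean V (fst p) (snd p)
      + ennreal (v (fst p)) * ennreal (c (fst p) (snd p))
      \<le> ennreal (v (fst p)) * ennreal (q (fst p) (snd p)) + ennreal d}
    = {(x, a) \<in> S \<times> A. a \<in> feasible V x (v x) d}"
    unfolding feasible_def by (auto simp: space_pair_measure)
  finally show ?thesis by (rule sets_borel_prod_of_restrict[OF S_borel A_borel])
qed

lemma borel_closed_sections_feasible:
  assumes V: "V \<in> borel_measurable borel_S" and v: "v \<in> borel_measurable borel_S"
    and D: "D \<in> sets borel_S" and closed: "\<And>x. x \<in> D \<Longrightarrow> closed (feasible V x (v x) d)"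
  shows "borel_closed_sections A {(x, a). x \<in> D \<and> a \<in> feasible V x (v x) d}"
    (is "borel_closed_sections A ?B")
proof -
  have D_borel: "D \<in> sets borel" "D \<subseteq> S" using D unfolding sets_borel_S_iff by auto
  have "?B = {(x, a) \<in> S \<times> A. a \<in> feasible V x (v x) d} \<inter> D \<times> UNIV"
    using D_borel(2) subsetD[OF feasible_subset] by auto
  moreover have "D \<times> UNIV \<in> sets (borel :: ('s \<times> 'b) measure)"
    unfolding borel_prod[symmetric] using D_borel(1) by auto
  ultimately have "?B \<in> sets borel" using sets.Int[OF measurable_feasible[OF V v]] by simp
  moreover have "{a. (x, a) \<in> ?B} = (if x \<in> D then feasible V x (v x) d else {})" for x by auto
  ultimately show ?thesis
    unfolding borel_closed_sections_def using closed subsetD[OF feasible_subset] by auto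
qed

end

text \<open>The two parts of the theorem differ only in the class \<open>admissible\<close> of sublevel sets:
  relatively closed sets in (a), measurable sets in (b).\<close>

locale ctmdp_regular = ctmdp_model S A qt c
  for S :: "'s::polish_space set" and A :: "'b::polish_space set"
    and qt :: "'s \<Rightarrow> 'b \<Rightarrow> 's measure" and c :: "'s \<Rightarrow> 'b \<Rightarrow> real" +
  fixes admissible :: "'s set \<Rightarrow> bool"
  assumes compact_A: "compact A"
    and admissible_S: "admissible S" and admissible_empty: "admissible {}"
    and admissible_INT: "\<And>X :: nat \<Rightarrow> 's set. (\<And>n. admissible (X n)) \<Longrightarrow> admissible (\<Inter>n. X n)"
    and admissible_measurable: "\<And>X. admissible X \<Longrightarrow> X \<in> sets borel_S"
    and compact_feasible: "\<And>V x v d. (\<And>u. admissible {x\<in>S. V x \<le> u}) \<Longrightarrow> x \<in> S \<Longrightarrow> 1 \<le> v \<Longrightarrow> 0 \<le> d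
        \<Longrightarrow> compact (feasible V x v d)"
    and admissible_feasible: "\<And>V v. (\<And>u. admissible {x\<in>S. V x \<le> u}) \<Longrightarrow> 1 \<le> v
        \<Longrightarrow> admissible {x\<in>S. feasible V x v 0 \<noteq> {}}"
begin

definition regular :: "('s \<Rightarrow> ennreal) \<Rightarrow> bool" where
  "regular V \<longleftrightarrow> (\<forall>u. admissible {x\<in>S. V x \<le> u})"

lemma measurable_regular: "regular V \<Longrightarrow> V \<in> borel_measurable borel_S"
  by (rule borel_measurableI_le) (auto simp: regular_def intro: admissible_measurable)

lemma regular_cong: "(\<And>x. x \<in> S \<Longrightarrow> V x = V' x) \<Longrightarrow> regular V \<longleftrightarrow> regular V'"
  unfolding regular_def by (simp cong: conj_cong)

lemma compact_feasible_regular: "regular V \<Longrightarrow> x \<in> S \<Longrightarrow> 1 \<le> v \<Longrightarrow> 0 \<le> d \<Longrightarrow> compact (feasible V x v d)"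
  unfolding regular_def using compact_feasible by blast

lemma feasible_limit:
  assumes V: "regular V" and x: "x \<in> S" and v: "1 \<le> v" and ne: "\<And>d. 0 < d \<Longrightarrow> feasible V x v d \<noteq> {}"
  shows "feasible V x v 0 \<noteq> {}"
proof -
  define d where "d n = inverse (real (Suc n))" for n
  have d: "0 < d n" for n unfolding d_def by simp
  have "(\<Inter>n. feasible V x v (d n)) \<noteq> {}"
  proof (rule compact_decreasing_nonempty)
    show "compact (feasible V x v (d n))" for n
      using d by (intro compact_feasible_regular V x v less_imp_le)
    show "feasible V x v (d n) \<subseteq> feasible V x v (d m)" if "m \<le> n" for m n
      using that by (intro feasible_antimono[OF x]) (auto simp: d_def field_simps)
  qed (rule ne[OF d])
  then obtain a where a: "\<And>n. a \<in> feasible V x v (d n)" by blast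
  then have A: "a \<in> A" using feasible_subset by blast
  have "jump_mean V x a < \<top>" and le: "enn2real (jump_mean V x a) + v * c x a \<le> v * q x a + d n" for n
    using a[of n] d[of n] v by (auto simp: feasible_iff[OF x A] less_imp_le)
  moreover have "enn2real (jump_mean V x a) + v * c x a \<le> v * q x a + 0"
    using le unfolding d_def
    by (intro LIMSEQ_le_const[OF tendsto_add[OF tendsto_const LIMSEQ_inverse_real_of_nat]]) blast
  ultimately have "a \<in> feasible V x v 0" using v by (simp add: feasible_iff[OF x A])
  then show ?thesis by blast
qed

lemma opt_op_le_iff:
  assumes V: "regular V" and x: "x \<in> S" and v: "1 \<le> v"
  shows "opt_op V x \<le> ennreal v \<longleftrightarrow> feasible V x v 0 \<noteq> {}"
proof
  assume le: "opt_op V x \<le> ennreal v"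
  show "feasible V x v 0 \<noteq> {}"
  proof (rule feasible_limit[OF V x v])
    fix d :: real assume "0 < d"
    define e where "e = d / max 1 (rate_bound x)"
    have e: "0 < e" "e * rate_bound x \<le> d"
      using \<open>0 < d\<close> unfolding e_def by (auto simp: divide_le_eq mult_left_mono)
    have "ennreal v < ennreal (v + e)" using v e by (intro ennreal_lessI) auto
    with le have "opt_op V x < ennreal (v + e)" by (rule order_le_less_trans)
    then obtain u where u: "1 \<le> u" "feasible V x u 0 \<noteq> {}" "ennreal u < ennreal (v + e)"
      unfolding opt_op_def by (auto simp: INF_less_iff)
    then have "u \<le> v + e" by (simp add: ennreal_less_iff)
    then obtain a where a: "a \<in> feasible V x (v + e) 0" using feasible_mono[OF x u(1)] u(2) by blast
    then have A: "a \<in> A" using feasible_subset by blast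
    have "e * q x a \<le> e * rate_bound x" "0 \<le> e * c x a"
      using e(1) rates_le_rate_bound(1)[OF x A] c_nonneg[OF x A] by simp_all
    moreover have fin: "jump_mean V x a < \<top>"
      and "enn2real (jump_mean V x a) + v * c x a + e * c x a \<le> v * q x a + e * q x a"
      using a v e(1) by (auto simp: feasible_iff[OF x A] distrib_right)
    ultimately have "enn2real (jump_mean V x a) + v * c x a \<le> v * q x a + d" using e(2) by linarith
    then have "a \<in> feasible V x v d" using fin v \<open>0 < d\<close> by (simp add: feasible_iff[OF x A])
    then show "feasible V x v d \<noteq> {}" by blast
  qed
qed (rule opt_op_le[OF v])

lemma regular_opt_op:
  assumes V: "regular V"
  shows "regular (opt_op V)"
  unfolding regular_def
proof
  fix u :: ennreal
  show "admissible {x\<in>S. opt_op V x \<le> u}"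
  proof (cases u)
    case (real v)
    show ?thesis
    proof (cases "1 \<le> v")
      case True
      then have "{x\<in>S. opt_op V x \<le> u} = {x\<in>S. feasible V x v 0 \<noteq> {}}"
        using opt_op_le_iff[OF V _ True] real by auto
      then show ?thesis using admissible_feasible[of V v] V True unfolding regular_def by simp
    next
      case False
      then have "u < 1" using real by (simp add: ennreal_1[symmetric] ennreal_lessI del: ennreal_1)
      then have "\<not> opt_op V x \<le> u" for x using opt_op_ge_1[of V x] by (meson leD order_trans)
      then have "{x\<in>S. opt_op V x \<le> u} = {}" by blast
      then show ?thesis using admissible_empty by metis
    qed
  qed (use admissible_S in auto)
qed

section \<open>Value iteration\<close>

primrec value_iter :: "nat \<Rightarrow> 's \<Rightarrow> ennreal" where
  "value_iter 0 = (\<lambda>_. 1)"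
| "value_iter (Suc n) = opt_op (value_iter n)"

definition value_lim :: "'s \<Rightarrow> ennreal" where
  "value_lim x = (SUP n. value_iter n x)"

lemma regular_value_iter: "regular (value_iter n)"
proof (induction n)
  case 0
  have "{x\<in>S. (1::ennreal) \<le> u} = S \<or> {x\<in>S. (1::ennreal) \<le> u} = {}" for u by auto
  then show ?case unfolding regular_def using admissible_S admissible_empty by (auto, metis)
qed (simp add: regular_opt_op)

lemma value_iter_ge_1: "1 \<le> value_iter n x"
  by (cases n) (simp_all add: opt_op_ge_1)

lemma value_iter_le_Suc: "x \<in> S \<Longrightarrow> value_iter n x \<le> value_iter (Suc n) x"
proof (induction n arbitrary: x)
  case (Suc n)
  then show ?case using opt_op_mono[of x "value_iter n" "value_iter (Suc n)"] by simp
qed (simp add: opt_op_ge_1)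

lemma incseq_value_iter: "x \<in> S \<Longrightarrow> incseq (\<lambda>n. value_iter n x)"
  by (rule incseq_SucI) (rule value_iter_le_Suc)

lemma value_iter_le_lim: "value_iter n x \<le> value_lim x"
  unfolding value_lim_def by (rule SUP_upper) simp

lemma value_lim_ge_1: "1 \<le> value_lim x"
  using value_iter_ge_1 value_iter_le_lim by (rule order_trans)

lemma regular_value_lim: "regular value_lim"
  unfolding regular_def
proof
  fix u
  have "{x\<in>S. value_lim x \<le> u} = (\<Inter>n. {x\<in>S. value_iter n x \<le> u})"
    unfolding value_lim_def by (auto simp: SUP_le_iff)
  then show "admissible {x\<in>S. value_lim x \<le> u}"
    using admissible_INT[of "\<lambda>n. {x\<in>S. value_iter n x \<le> u}"]
      regular_value_iter unfolding regular_def by simp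
qed

lemma value_lim_le:
  assumes x: "x \<in> S" and v: "1 \<le> v" and ne: "feasible value_lim x v 0 \<noteq> {}"
  shows "value_lim x \<le> ennreal v"
  unfolding value_lim_def
proof (rule SUP_least)
  fix n
  have "feasible value_lim x v 0 \<subseteq> feasible (value_iter n) x v 0"
    using value_iter_le_lim by (intro feasible_antimono[OF x]) auto
  then have "opt_op (value_iter n) x \<le> ennreal v" using ne v by (intro opt_op_le) auto
  then show "value_iter n x \<le> ennreal v" using value_iter_le_Suc[OF x, of n] by simp
qed

lemma jump_mean_value_lim:
  assumes xa: "x \<in> S" "a \<in> A"
  shows "jump_mean value_lim x a = (SUP n. jump_mean (value_iter n) x a)"
proof -
  have [measurable]: "value_iter n \<in> borel_measurable (qt x a)" for n
    unfolding measurable_qt_cong[OF xa] by (rule measurable_regular[OF regular_value_iter])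
  show ?thesis
    unfolding jump_mean_def value_lim_def
    by (rule nn_integral_monotone_convergence_SUP_AE)
      (auto intro!: AE_I2 simp: space_qt[OF xa] value_iter_le_Suc simp del: value_iter.simps)
qed

lemma finite_value_lim:
  assumes "value_lim x < \<top>"
  shows "ennreal (enn2real (value_lim x)) = value_lim x" and "1 \<le> enn2real (value_lim x)"
proof -
  show eq: "ennreal (enn2real (value_lim x)) = value_lim x" using assms by simp
  have "ennreal 1 \<le> ennreal (enn2real (value_lim x))" unfolding eq by (simp add: value_lim_ge_1)
  then show "1 \<le> enn2real (value_lim x)" by (simp add: ennreal_le_iff2)
qed

definition greedy :: "'s \<Rightarrow> 'b set" where
  "greedy x = feasible value_lim x (enn2real (value_lim x)) 0"

lemma compact_greedy: "x \<in> S \<Longrightarrow> value_lim x < \<top> \<Longrightarrow> compact (greedy x)"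
  unfolding greedy_def by (intro compact_feasible_regular regular_value_lim finite_value_lim) auto

lemma greedy_subset: "greedy x \<subseteq> A"
  unfolding greedy_def by (rule feasible_subset)

lemma greedy_nonempty:
  assumes x: "x \<in> S" and fin: "value_lim x < \<top>"
  shows "greedy x \<noteq> {}"
proof -
  define v where "v = enn2real (value_lim x)"
  have v: "ennreal v = value_lim x" "1 \<le> v" unfolding v_def using finite_value_lim[OF fin] by auto
  have "(\<Inter>n. feasible (value_iter n) x v 0) \<noteq> {}"
  proof (rule compact_decreasing_nonempty)
    show "compact (feasible (value_iter n) x v 0)" for n
      by (rule compact_feasible_regular[OF regular_value_iter x v(2)]) simp
    show "feasible (value_iter n) x v 0 \<noteq> {}" for n
      using opt_op_le_iff[OF regular_value_iter x v(2), of n] value_iter_le_lim[of "Suc n" x] v(1)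
      by simp
    show "feasible (value_iter n) x v 0 \<subseteq> feasible (value_iter m) x v 0" if "m \<le> n" for m n
      by (rule feasible_antimono[OF x]) (use incseqD[OF incseq_value_iter that] in auto)
  qed
  then obtain a where a: "\<And>n. a \<in> feasible (value_iter n) x v 0" by blast
  then have A: "a \<in> A" using feasible_subset by blast
  have "jump_mean value_lim x a + ennreal v * ennreal (c x a)
      = (SUP n. jump_mean (value_iter n) x a + ennreal v * ennreal (c x a))"
    unfolding jump_mean_value_lim[OF x A] by (rule ennreal_SUP_add_left[symmetric]) simp
  also have "\<dots> \<le> ennreal v * ennreal (q x a) + ennreal 0"
    using a unfolding feasible_def by (intro SUP_least) blast
  finally show ?thesis using A unfolding greedy_def feasible_def v_def by blast
qed

lemma opt_val_value_lim_nonneg: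
  assumes x: "x \<in> S" and fin: "value_lim x < \<top>" and A: "a \<in> A"
  shows "0 \<le> opt_val value_lim x a"
proof (rule ccontr)
  define g where "g = enn2real (jump_mean value_lim x a)"
  define v where "v = enn2real (value_lim x)"
  assume "\<not> 0 \<le> opt_val value_lim x a"
  then have fin_g: "jump_mean value_lim x a < \<top>" and less: "g < v * (q x a - c x a)"
    using opt_val_less_0_iff[of value_lim x a] unfolding g_def v_def by (auto simp: not_le)
  have v: "ennreal v = value_lim x" "1 \<le> v" unfolding v_def using finite_value_lim[OF fin] by auto
  have "0 \<le> g" unfolding g_def by simp
  with less have "0 < v * (q x a - c x a)" by linarith
  then have gap: "0 < q x a - c x a" using v(2) by (simp add: zero_less_mult_iff)
  have "ennreal (q x a) \<le> ennreal g"
    using jump_mean_ge_q[OF x A, of value_lim] value_lim_ge_1 fin_g unfolding g_def by simp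
  then have "q x a \<le> g" using \<open>0 \<le> g\<close> by (simp add: ennreal_le_iff)
  \<comment> \<open>the value of the constant control \<open>a\<close>\<close>
  define v' where "v' = g / (q x a - c x a)"
  have v': "1 \<le> v'" "v' < v" "g = v' * (q x a - c x a)"
    unfolding v'_def using gap less \<open>q x a \<le> g\<close> c_nonneg[OF x A] by (simp_all add: field_simps)
  then have "a \<in> feasible value_lim x v' 0"
    using fin_g by (simp add: feasible_iff[OF x A] algebra_simps flip: g_def)
  then have "ennreal v \<le> ennreal v'" unfolding v(1) using v'(1) by (intro value_lim_le[OF x]) auto
  then show False using v'(1,2) by (simp add: ennreal_le_iff)
qed

lemma opt_eq_value_lim: "opt_eq S A qt c value_lim"
  unfolding opt_eq_iff
proof (intro ballI impI antisym)
  fix x assume x: "x \<in> S" and fin: "value_lim x < \<top>"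
  obtain a where a: "a \<in> greedy x" using greedy_nonempty[OF x fin] by blast
  then have A: "a \<in> A" using greedy_subset by blast
  then have "opt_val value_lim x a \<le> 0"
    using opt_val_le_iff[OF x A order_refl, of value_lim] a unfolding greedy_def
    by (simp add: zero_ereal_def)
  then show "(INF a\<in>A. opt_val value_lim x a) \<le> 0" using A by (rule INF_lower2[rotated])
  show "0 \<le> (INF a\<in>A. opt_val value_lim x a)"
    by (intro INF_greatest opt_val_value_lim_nonneg x fin)
qed

lemma solution_ge_opt_op:
  assumes V: "regular V" "\<And>x. x \<in> S \<Longrightarrow> 1 \<le> V x" "opt_eq S A qt c V" and x: "x \<in> S"
  shows "opt_op V x \<le> V x"
proof (cases "V x < \<top>")
  case True
  define v where "v = enn2real (V x)"
  have eq: "ennreal v = V x" unfolding v_def using True by simp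
  then have "ennreal 1 \<le> ennreal v" using V(2)[OF x] by simp
  then have v: "1 \<le> v" by (simp add: ennreal_le_iff2)
  have inf: "(INF a\<in>A. opt_val V x a) = 0" using V(3) x True unfolding opt_eq_iff by blast
  have "feasible V x v 0 \<noteq> {}"
  proof (rule feasible_limit[OF V(1) x v])
    fix d :: real assume "0 < d"
    then have "(INF a\<in>A. opt_val V x a) < ereal d" unfolding inf by simp
    then obtain a where a: "a \<in> A" "opt_val V x a < ereal d" by (auto simp: INF_less_iff)
    then have "a \<in> feasible V x v d"
      using opt_val_le_iff[OF x a(1), of d V] \<open>0 < d\<close> unfolding v_def by (simp add: less_imp_le)
    then show "feasible V x v d \<noteq> {}" by blast
  qed
  then show ?thesis using opt_op_le[OF v] eq by metis
qed (simp add: not_less top_unique)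

lemma solution_ge_value_lim:
  assumes V: "regular V" "\<And>x. x \<in> S \<Longrightarrow> 1 \<le> V x" "opt_eq S A qt c V" and x: "x \<in> S"
  shows "value_lim x \<le> V x"
proof -
  have "value_iter n x \<le> V x" if "x \<in> S" for n x
    using that
  proof (induction n arbitrary: x)
    case (Suc n)
    have "value_iter (Suc n) x \<le> opt_op V x" using opt_op_mono[of x "value_iter n" V] Suc by simp
    also have "\<dots> \<le> V x" by (rule solution_ge_opt_op[OF V Suc.prems])
    finally show ?case .
  qed (use V in simp)
  then show ?thesis unfolding value_lim_def using x by (intro SUP_least) simp
qed

lemma feasible_empty_gap:
  assumes V: "regular V" and x: "x \<in> S" and v: "1 \<le> v" and empty: "feasible V x v 0 = {}"
  obtains \<delta> where "0 < \<delta>"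
    "\<And>a. a \<in> A \<Longrightarrow> \<delta> + ennreal v * ennreal (q x a) \<le> jump_mean V x a + ennreal v * ennreal (c x a)"
proof -
  obtain d where d: "0 < d" "feasible V x v d = {}" using feasible_limit[OF V x v] empty by blast
  show ?thesis
  proof (rule that)
    show "0 < ennreal d" using d(1) by simp
    show "ennreal d + ennreal v * ennreal (q x a) \<le> jump_mean V x a + ennreal v * ennreal (c x a)"
      if "a \<in> A" for a
      using that d(2) unfolding feasible_def by (auto simp: not_le less_imp_le add.commute)
  qed
qed

end

locale ctmdp_regular_policy = ctmdp_regular S A qt c admissible + ctmdp_policy S A qt c pol
  for S :: "'s::polish_space set" and A :: "'b::polish_space set"
    and qt :: "'s \<Rightarrow> 'b \<Rightarrow> 's measure" and c :: "'s \<Rightarrow> 'b \<Rightarrow> real"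
    and admissible :: "'s set \<Rightarrow> bool" and pol :: "('s, 'b) policy"
begin

lemma opt_op_le_next_value:
  assumes V: "regular V" "\<And>y. 1 \<le> V y" and h: "h \<in> space (hist k)" and z: "snd (h k) = Some z" "z \<in> S"
  shows "opt_op V z \<le> next_value k h V"
proof (rule dense_le)
  fix u assume u: "u < opt_op V z"
  show "u \<le> next_value k h V"
  proof (cases "1 \<le> u")
    case True
    obtain v where v: "u = ennreal v" "0 \<le> v" using u by (cases u) auto
    have v1: "1 \<le> v" using True v by (simp add: ennreal_1[symmetric] del: ennreal_1)
    have "feasible V z v 0 = {}" using opt_op_le[OF v1, of V z] u unfolding v(1) by (meson not_le)
    then obtain \<delta> where "0 < \<delta>"
      "\<And>a. a \<in> A \<Longrightarrow> \<delta> + ennreal v * ennreal (q z a) \<le> jump_mean V z a + ennreal v * ennreal (c z a)"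
      by (rule feasible_empty_gap[OF V(1) z(2) v1]) blast
    then show ?thesis
      unfolding v(1) using V(2) by (intro next_value_lower[OF h z measurable_regular[OF V(1)]])
  next
    case False
    then have "u \<le> 1" by simp
    also have "1 \<le> next_value k h V"
      using V(2) by (intro next_value_ge_1[OF h z measurable_regular[OF V(1)]])
    finally show ?thesis .
  qed
qed

lemma value_iter_le_staged_value:
  assumes x: "x \<in> S"
  shows "k \<le> n \<Longrightarrow> value_iter n x \<le> staged_value x k (value_iter (n - k))"
proof (induction k)
  case 0
  then show ?case by (simp add: staged_value_0[OF x measurable_regular[OF regular_value_iter]])
next
  case (Suc k)
  let ?V = "value_iter (n - Suc k)"
  have "value_iter n x \<le> staged_value x k (opt_op ?V)"
    using Suc by (simp add: Suc_diff_Suc flip: value_iter.simps(2))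
  also have "\<dots> \<le> staged_value x (Suc k) ?V"
  proof (rule staged_value_le_Suc[OF x measurable_regular[OF regular_value_iter]])
    show "lift (opt_op ?V) (snd (h k)) \<le> next_value k h ?V" if h: "h \<in> space (hist k)" for h
      using h
    proof (cases rule: hist_state_cases)
      case (2 z)
      then show ?thesis
        using opt_op_le_next_value[OF regular_value_iter value_iter_ge_1 h 2] by simp
    qed (simp add: next_value_None)
  qed
  finally show ?case .
qed

lemma value_lim_le_Vcrit:
  assumes x: "x \<in> S"
  shows "value_lim x \<le> Vcrit S qt c pol x"
  unfolding value_lim_def Vcrit_eq_SUP[OF x]
  using value_iter_le_staged_value[OF x order_refl] by (intro SUP_mono) auto

lemma Vcrit_le_value_lim:
  assumes greedy: "\<And>h k s z. h \<in> space (hist k) \<Longrightarrow> snd (h k) = Some z \<Longrightarrow> z \<in> S \<Longrightarrow> value_lim z < \<top>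
      \<Longrightarrow> AE a in pol k h s. a \<in> greedy z"
    and x: "x \<in> S"
  shows "Vcrit S qt c pol x \<le> value_lim x"
proof -
  note measurable_V = measurable_regular[OF regular_value_lim]
  have next_le: "next_value k h value_lim \<le> lift value_lim (snd (h k))" if h: "h \<in> space (hist k)" for h k
    using h
  proof (cases rule: hist_state_cases)
    case (2 z)
    show ?thesis
    proof (cases "value_lim z < \<top>")
      case True
      have "next_value k h value_lim \<le> ennreal (enn2real (value_lim z))"
        using greedy[OF h 2 True]
        by (intro next_value_upper[OF h 2 measurable_V] value_lim_ge_1 finite_value_lim(2)[OF True])
          (auto simp: greedy_def feasible_def)
      then show ?thesis using 2 True by simp
    qed (use 2 in \<open>simp add: not_less top_unique\<close>)
  qed (simp add: next_value_None)
  have "staged_value x k value_lim \<le> value_lim x" for k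
  proof (induction k)
    case (Suc k)
    then show ?case using staged_value_Suc_le[OF x measurable_V next_le] order_trans by blast
  qed (simp add: staged_value_0[OF x measurable_V])
  moreover have "staged_value x k (\<lambda>_. 1) \<le> staged_value x k value_lim" for k
    by (intro staged_value_mono[OF x] value_lim_ge_1)
  ultimately show ?thesis unfolding Vcrit_eq_SUP[OF x] by (meson SUP_least order_trans)
qed

end

context ctmdp_model
begin

definition stationary_policy :: "('s \<Rightarrow> 'b) \<Rightarrow> ('s, 'b) policy" where
  "stationary_policy f n h s = return borel_A (case snd (h n) of None \<Rightarrow> SOME a. a \<in> A | Some z \<Rightarrow> f z)"

lemma is_policy_stationary:
  assumes f: "f \<in> borel_S \<rightarrow>\<^sub>M borel_A"
  shows "is_policy S A (stationary_policy f)"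
  unfolding is_policy_def
proof
  fix n
  have "(SOME a. a \<in> A) \<in> A" using A_nonempty by (simp add: some_in_eq)
  then have action: "(\<lambda>s. case s of None \<Rightarrow> SOME a. a \<in> A | Some z \<Rightarrow> f z) \<in> Sinf S \<rightarrow>\<^sub>M borel_A"
    using f by (intro measurable_from_Sinf) auto
  have "(\<lambda>p. fst p n) \<in> hist n \<Otimes>\<^sub>M (borel :: real measure) \<rightarrow>\<^sub>M Mst S" by measurable
  then have "(\<lambda>p. snd (fst p n)) \<in> hist n \<Otimes>\<^sub>M (borel :: real measure) \<rightarrow>\<^sub>M Sinf S" by measurable
  from measurable_compose[OF measurable_compose[OF this action] measurable_return_prob_space]
  show "(\<lambda>(h, s). stationary_policy f n h s)
      \<in> hist n \<Otimes>\<^sub>M (borel :: real measure) \<rightarrow>\<^sub>M prob_algebra borel_A"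
    unfolding stationary_policy_def by (simp add: split_beta')
qed

lemma opt_eq_cong:
  assumes "\<And>x. x \<in> S \<Longrightarrow> V x = V' x"
  shows "opt_eq S A qt c V \<longleftrightarrow> opt_eq S A qt c V'"
  unfolding opt_eq_iff opt_val_def using assms jump_mean_cong[OF _ _ assms] by (simp cong: INF_cong)

end

context ctmdp_regular
begin

lemma measurable_greedy_selector_exists:
  obtains f where "f \<in> borel_S \<rightarrow>\<^sub>M borel_A" "\<And>x. x \<in> S \<Longrightarrow> value_lim x < \<top> \<Longrightarrow> f x \<in> greedy x"
proof -
  note [measurable] = measurable_regular[OF regular_value_lim]
  define D where "D = {x\<in>space borel_S. value_lim x < \<top>}"
  have D: "D \<in> sets borel_S" unfolding D_def by measurable
  have mem_D: "x \<in> D \<longleftrightarrow> x \<in> S \<and> value_lim x < \<top>" for x unfolding D_def by simp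
  define B where "B = {(x, a). x \<in> D \<and> a \<in> greedy x}"
  have "borel_closed_sections A B"
    unfolding B_def greedy_def
  proof (rule borel_closed_sections_feasible[OF _ _ D])
    show "closed (feasible value_lim x (enn2real (value_lim x)) 0)" if "x \<in> D" for x
      using compact_greedy[of x] that unfolding mem_D greedy_def by (simp add: compact_imp_closed)
  qed measurable
  then obtain f where f: "f \<in> borel_measurable (restrict_space borel (fst ` B))"
    "\<And>x. x \<in> fst ` B \<Longrightarrow> (x, f x) \<in> B"
    by (rule borel_selection_compact_sections[OF _ compact_A]) blast
  have "fst ` B = {x\<in>D. greedy x \<noteq> {}}" unfolding B_def by force
  then have fst_B: "fst ` B = D" using greedy_nonempty mem_D by auto
  have f_greedy: "f x \<in> greedy x" if "x \<in> D" for x using f(2)[unfolded fst_B] that unfolding B_def by simp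
  obtain a where a: "a \<in> A" using A_nonempty by blast
  define F where "F x = (if x \<in> D then f x else a)" for x
  have "F \<in> borel_measurable borel"
    unfolding F_def using f(1) D
    by (subst measurable_restrict_space_iff[symmetric]) (auto simp: fst_B sets_borel_S_iff)
  moreover have "F x \<in> A" for x using f_greedy[of x] greedy_subset[of x] a unfolding F_def by auto
  ultimately have "F \<in> borel_S \<rightarrow>\<^sub>M borel_A"
    by (intro measurable_restrict_space2 measurable_restrict_space1) auto
  moreover have "F x \<in> greedy x" if "x \<in> S" "value_lim x < \<top>" for x
    using f_greedy[of x] that unfolding F_def mem_D by simp
  ultimately show ?thesis by (rule that)
qed

lemma optimal_policy_exists:
  obtains pol where "is_policy S A pol" "\<And>x. x \<in> S \<Longrightarrow> Vcrit S qt c pol x \<le> value_lim x"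
proof -
  obtain f where f: "f \<in> borel_S \<rightarrow>\<^sub>M borel_A" "\<And>x. x \<in> S \<Longrightarrow> value_lim x < \<top> \<Longrightarrow> f x \<in> greedy x"
    by (rule measurable_greedy_selector_exists) blast
  interpret ctmdp_regular_policy S A qt c admissible "stationary_policy f"
    by unfold_locales (rule is_policy_stationary[OF f(1)])
  show ?thesis
  proof (rule that[OF policy])
    show "Vcrit S qt c (stationary_policy f) x \<le> value_lim x" if "x \<in> S" for x
    proof (rule Vcrit_le_value_lim[OF _ that])
      fix h :: "'s history" and s :: real and z and k :: nat
      assume z: "snd (h k) = Some z" "z \<in> S" "value_lim z < \<top>"
      have "greedy z \<in> sets borel_A"
        using A_borel greedy_subset compact_greedy[OF z(2,3)]
        by (simp add: sets_restrict_space_iff borel_compact)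
      then have "Measurable.pred borel_A (\<lambda>a. a \<in> greedy z)" by measurable
      then show "AE a in stationary_policy f k h s. a \<in> greedy z"
        unfolding stationary_policy_def z(1) using f(2)[OF z(2,3)] measurable_space[OF f(1)] z(2)
        by (simp add: AE_return)
    qed
  qed
qed

end

section \<open>The two continuity conditions\<close>

context ctmdp_model
begin

lemma jump_mean_eq_SUP:
  assumes f: "bounded_approximation S V f" "\<And>k. f k \<in> borel_measurable borel_S" and xa: "x \<in> S" "a \<in> A"
  shows "jump_mean V x a = (SUP k. ennreal (\<integral>y. f k y \<partial>qt x a))"
proof -
  interpret finite_measure "qt x a" by (rule finite_measure_qt[OF xa])
  have [measurable]: "f k \<in> borel_measurable (qt x a)" for k
    unfolding measurable_qt_cong[OF xa] by (rule f(2))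
  have "jump_mean V x a = (\<integral>\<^sup>+ y. (SUP k. ennreal (f k y)) \<partial>qt x a)"
    unfolding jump_mean_def using bounded_approximationD(4)[OF f(1)]
    by (intro nn_integral_cong) (simp add: space_qt[OF xa])
  also have "\<dots> = (SUP k. \<integral>\<^sup>+ y. ennreal (f k y) \<partial>qt x a)"
    using bounded_approximationD(3)[OF f(1)]
    by (intro nn_integral_monotone_convergence_SUP_AE AE_I2 ennreal_leI)
      (auto simp: space_qt[OF xa] incseq_Suc_iff)
  also have "\<dots> = (SUP k. ennreal (\<integral>y. f k y \<partial>qt x a))"
    using bounded_approximationD(1,2)[OF f(1)]
    by (intro SUP_cong refl nn_integral_eq_integral AE_I2 integrable_const_bound[of _ "real _"])
      (auto simp: space_qt[OF xa])
  finally show ?thesis .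
qed

lemma feasible_iff_approximation:
  assumes f: "bounded_approximation S V f" "\<And>k. f k \<in> borel_measurable borel_S" and xa: "x \<in> S" "a \<in> A"
    and v: "0 \<le> v" and d: "0 \<le> d"
  shows "a \<in> feasible V x v d \<longleftrightarrow> (\<forall>k. (\<integral>y. f k y \<partial>qt x a) + v * c x a \<le> v * q x a + d)"
proof -
  have "0 \<le> (\<integral>y. f k y \<partial>qt x a)" for k
    using bounded_approximationD(1)[OF f(1)]
    by (intro integral_nonneg_AE AE_I2) (simp add: space_qt[OF xa])
  then have "jump_mean V x a + ennreal v * ennreal (c x a)
      = (SUP k. ennreal ((\<integral>y. f k y \<partial>qt x a) + v * c x a))"
    unfolding jump_mean_eq_SUP[OF f xa] using c_nonneg[OF xa] v
    by (simp add: ennreal_SUP_add_left[symmetric] ennreal_mult)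
  moreover have "ennreal v * ennreal (q x a) + ennreal d = ennreal (v * q x a + d)"
    using v d by (simp add: ennreal_mult)
  moreover have "0 \<le> v * q x a + d" using v d by simp
  ultimately show ?thesis
    unfolding feasible_def using xa by (simp add: SUP_le_iff ennreal_le_iff del: ennreal_plus)
qed

lemma integral_qt_1: "x \<in> S \<Longrightarrow> a \<in> A \<Longrightarrow> (\<integral>y. 1 \<partial>qt x a) = q x a"
  by (simp add: qrate_def space_qt)

lemma closedin_feasible:
  assumes \<xi>: "\<And>p. p \<in> D \<Longrightarrow> \<xi> p \<in> S" and \<alpha>: "\<And>p. p \<in> D \<Longrightarrow> \<alpha> p \<in> A"
    and f: "bounded_approximation S V f" "\<And>k. f k \<in> borel_measurable borel_S"
    and mean: "\<And>k. continuous_on D (\<lambda>p. \<integral>y. f k y \<partial>qt (\<xi> p) (\<alpha> p))"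
    and rate: "continuous_on D (\<lambda>p. \<integral>y. 1 \<partial>qt (\<xi> p) (\<alpha> p) :: real)"
    and cost: "lsc_on D (\<lambda>p. c (\<xi> p) (\<alpha> p))" and v: "1 \<le> v" and d: "0 \<le> d"
  shows "closedin (top_of_set D) {p\<in>D. \<alpha> p \<in> feasible V (\<xi> p) v d}"
proof -
  have q: "continuous_on D (\<lambda>p. q (\<xi> p) (\<alpha> p))"
    using rate by (rule continuous_on_eq) (rule integral_qt_1[OF \<xi> \<alpha>])
  have "{p\<in>D. \<alpha> p \<in> feasible V (\<xi> p) v d}
      = (\<Inter>k. {p\<in>D. c (\<xi> p) (\<alpha> p) \<le> (v * q (\<xi> p) (\<alpha> p) + d - (\<integral>y. f k y \<partial>qt (\<xi> p) (\<alpha> p))) / v})"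
    using v d by (auto simp: feasible_iff_approximation[OF f \<xi> \<alpha>] field_simps)
  moreover have "closedin (top_of_set D)
      {p\<in>D. c (\<xi> p) (\<alpha> p) \<le> (v * q (\<xi> p) (\<alpha> p) + d - (\<integral>y. f k y \<partial>qt (\<xi> p) (\<alpha> p))) / v}" for k
    using v by (intro closedin_lsc_le_continuous cost continuous_intros mean q) auto
  ultimately show ?thesis by (simp only:) (intro closedin_Inter, auto)
qed

definition strongly_continuous_rates :: bool where
  "strongly_continuous_rates \<longleftrightarrow> (\<forall>f :: 's \<Rightarrow> real. f \<in> borel_measurable borel_S \<and> bounded (f ` S)
     \<longrightarrow> (\<forall>x\<in>S. continuous_on A (\<lambda>a. \<integral>y. f y \<partial>qt x a)))"

lemma compact_feasible_measurable:
  assumes rates: strongly_continuous_rates and cost: "lsc_on A (c x)" and A: "compact A"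
    and V[measurable]: "V \<in> borel_measurable borel_S" and x: "x \<in> S" and v: "1 \<le> v" "0 \<le> d"
  shows "compact (feasible V x v d)"
proof -
  have mean: "continuous_on A (\<lambda>a. \<integral>y. f y \<partial>qt x a)"
    if "f \<in> borel_measurable borel_S" "bounded (f ` S)" for f :: "'s \<Rightarrow> real"
    using rates that x unfolding strongly_continuous_rates_def by blast
  have "closedin (top_of_set A) {a\<in>A. a \<in> feasible V x v d}"
  proof (rule closedin_feasible[OF _ _ bounded_approximation_truncate])
    show "continuous_on A (\<lambda>a. \<integral>y. truncate k (V y) \<partial>qt x a)" for k
      by (rule mean[OF _ bounded_approximation_bounded[OF bounded_approximation_truncate]]) measurable
    show "continuous_on A (\<lambda>a. \<integral>y. 1 \<partial>qt x a :: real)"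
      using mean[of "\<lambda>_. 1"] by (simp add: image_constant_conv)
  qed (use x v cost in auto)
  then show ?thesis
    using feasible_subset closedin_compact[OF A] by (simp add: Collect_conj_eq Int_absorb1)
qed

lemma ctmdp_regular_measurable:
  assumes rates: strongly_continuous_rates and cost: "\<And>x. x \<in> S \<Longrightarrow> lsc_on A (c x)" and A: "compact A"
  shows "ctmdp_regular S A qt c (\<lambda>X. X \<in> sets borel_S)"
proof unfold_locales
  show S: "S \<in> sets borel_S" by (simp add: sets_borel_S_iff S_borel)
  have measurable: "V \<in> borel_measurable borel_S"
    if "\<And>u. {x\<in>S. V x \<le> u} \<in> sets borel_S" for V :: "'s \<Rightarrow> ennreal"
    using that by (intro borel_measurableI_le) simp
  show compact_feasible: "compact (feasible V x v d)"
    if "\<And>u. {x\<in>S. V x \<le> u} \<in> sets borel_S" "x \<in> S" "1 \<le> v" "0 \<le> d" for V x v d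
    using that by (intro compact_feasible_measurable rates cost A measurable)
  show "{x\<in>S. feasible V x v 0 \<noteq> {}} \<in> sets borel_S" if V: "\<And>u. {x\<in>S. V x \<le> u} \<in> sets borel_S"
    and v: "1 \<le> v" for V v
  proof -
    define B where "B = {(x, a). x \<in> S \<and> a \<in> feasible V x v 0}"
    have "borel_closed_sections A B"
      unfolding B_def
      by (rule borel_closed_sections_feasible[OF measurable[OF V] _ S])
        (simp_all add: compact_feasible V v compact_imp_closed)
    then have "fst ` B \<in> sets borel" by (rule borel_projection_compact_sections[OF _ A])
    moreover have "fst ` B = {x\<in>S. feasible V x v 0 \<noteq> {}}" unfolding B_def by force
    ultimately show ?thesis unfolding sets_borel_S_iff by auto
  qed
qed (use A in \<open>auto intro!: sets.countable_INT\<close>)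

definition weakly_continuous_rates :: bool where
  "weakly_continuous_rates \<longleftrightarrow> (\<forall>f :: 's \<Rightarrow> real. continuous_on S f \<and> bounded (f ` S)
     \<longrightarrow> continuous_on (S \<times> A) (\<lambda>(x, a). \<integral>y. f y \<partial>qt x a))"

lemma closedin_feasible_lsc:
  assumes rates: weakly_continuous_rates and cost: "lsc_on (S \<times> A) (\<lambda>(x, a). c x a)"
    and V: "lsc_on S V" and v: "1 \<le> v" "0 \<le> d"
  shows "closedin (top_of_set (S \<times> A)) {p \<in> S \<times> A. snd p \<in> feasible V (fst p) v d}"
proof (rule closedin_feasible)
  have mean: "continuous_on (S \<times> A) (\<lambda>p. \<integral>y. f y \<partial>qt (fst p) (snd p))"
    if "continuous_on S f" "bounded (f ` S)" for f :: "'s \<Rightarrow> real"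
    using rates that unfolding weakly_continuous_rates_def by (simp add: split_beta')
  show approx: "bounded_approximation S V (lipschitz_minorant S V)"
    by (rule bounded_approximation_lipschitz_minorant[OF V])
  show "lipschitz_minorant S V k \<in> borel_measurable borel_S" for k
    by (rule borel_measurable_continuous_on_restrict[OF continuous_on_lipschitz_minorant])
  show "continuous_on (S \<times> A) (\<lambda>p. \<integral>y. lipschitz_minorant S V k y \<partial>qt (fst p) (snd p))" for k
    by (rule mean[OF continuous_on_lipschitz_minorant bounded_approximation_bounded[OF approx]])
  show "continuous_on (S \<times> A) (\<lambda>p. \<integral>y. 1 \<partial>qt (fst p) (snd p) :: real)"
    using mean[of "\<lambda>_. 1"] by (simp add: image_constant_conv)
qed (use v cost in \<open>auto simp: split_beta'\<close>)

lemma ctmdp_regular_lsc: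
  assumes rates: weakly_continuous_rates and cost: "lsc_on (S \<times> A) (\<lambda>(x, a). c x a)" and A: "compact A"
  shows "ctmdp_regular S A qt c (closedin (top_of_set S))"
proof unfold_locales
  have closed: "closedin (top_of_set (S \<times> A)) {p \<in> S \<times> A. snd p \<in> feasible V (fst p) v d}"
    if "\<And>u. closedin (top_of_set S) {x\<in>S. V x \<le> u}" "1 \<le> v" "0 \<le> d" for V v d
    using that by (intro closedin_feasible_lsc rates cost) (simp_all add: lsc_on_iff_closedin)
  show "compact (feasible V x v d)"
    if V: "\<And>u. closedin (top_of_set S) {x\<in>S. V x \<le> u}" and x: "x \<in> S" and v: "1 \<le> v" "0 \<le> d" for V x v d
  proof -
    have "closedin (top_of_set A) (A \<inter> Pair x -` {p \<in> S \<times> A. snd p \<in> feasible V (fst p) v d})"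
      by (rule continuous_closedin_preimage_gen[OF _ _ closed[OF V v]])
        (use x in \<open>auto intro!: continuous_intros\<close>)
    moreover have "A \<inter> Pair x -` {p \<in> S \<times> A. snd p \<in> feasible V (fst p) v d} = feasible V x v d"
      using x subsetD[OF feasible_subset] by auto
    ultimately show ?thesis using closedin_compact[OF A] by simp
  qed
  show "closedin (top_of_set S) {x\<in>S. feasible V x v 0 \<noteq> {}}"
    if V: "\<And>u. closedin (top_of_set S) {x\<in>S. V x \<le> u}" and v: "1 \<le> v" for V v
  proof -
    have "closed_map (prod_topology (top_of_set S) (top_of_set A)) (top_of_set S) fst"
      by (rule Abstract_Topological_Spaces.closed_map_fst) (simp add: compact_space_subtopology A)
    then have "closedin (top_of_set S) (fst ` {p \<in> S \<times> A. snd p \<in> feasible V (fst p) v 0})"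
      using closed[OF V v order_refl] unfolding closed_map_def by (simp add: subtopology_Times)
    moreover have "fst ` {p \<in> S \<times> A. snd p \<in> feasible V (fst p) v 0} = {x\<in>S. feasible V x v 0 \<noteq> {}}"
      using subsetD[OF feasible_subset] by force
    ultimately show ?thesis by simp
  qed
  show "X \<in> sets borel_S" if "closedin (top_of_set S) X" for X
    using that S_borel unfolding closedin_closed by (auto simp: sets_restrict_space_iff)
qed (use A in \<open>auto intro!: closedin_Inter\<close>)

section \<open>The minimal solution\<close>

definition minimal_solution :: "(('s \<Rightarrow> ennreal) \<Rightarrow> bool) \<Rightarrow> ('s \<Rightarrow> ennreal) \<Rightarrow> bool" where
  "minimal_solution R U \<longleftrightarrow> (\<forall>x\<in>S. 1 \<le> U x) \<and> R U \<and> opt_eq S A qt c U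
     \<and> (\<forall>V. (\<forall>x\<in>S. 1 \<le> V x) \<and> R V \<and> opt_eq S A qt c V \<longrightarrow> (\<forall>x\<in>S. U x \<le> V x))"

end

context ctmdp_regular
begin

lemma Vstar_eq_value_lim:
  assumes x: "x \<in> S"
  shows "Vstar S A qt c x = value_lim x"
  unfolding Vstar_def
proof (rule antisym)
  obtain pol where "is_policy S A pol" "Vcrit S qt c pol x \<le> value_lim x"
    using optimal_policy_exists x by metis
  then show "(INF pol\<in>{pol. is_policy S A pol}. Vcrit S qt c pol x) \<le> value_lim x"
    by (intro INF_lower2) auto
  show "value_lim x \<le> (INF pol\<in>{pol. is_policy S A pol}. Vcrit S qt c pol x)"
  proof (rule INF_greatest)
    fix pol :: "('s, 'b) policy" assume "pol \<in> {pol. is_policy S A pol}"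
    then interpret ctmdp_regular_policy S A qt c admissible pol by unfold_locales simp
    show "value_lim x \<le> Vcrit S qt c pol x" by (rule value_lim_le_Vcrit[OF x])
  qed
qed

lemma Vstar_minimal_regular_solution: "minimal_solution regular (Vstar S A qt c)"
  unfolding minimal_solution_def
proof (intro conjI allI ballI impI)
  show "regular (Vstar S A qt c)"
    using regular_value_lim regular_cong[of _ value_lim] Vstar_eq_value_lim by blast
  show "opt_eq S A qt c (Vstar S A qt c)"
    using opt_eq_value_lim opt_eq_cong[of _ value_lim] Vstar_eq_value_lim by blast
  fix x assume x: "x \<in> S"
  show "1 \<le> Vstar S A qt c x" unfolding Vstar_eq_value_lim[OF x] by (rule value_lim_ge_1)
  fix V assume "(\<forall>x\<in>S. 1 \<le> V x) \<and> regular V \<and> opt_eq S A qt c V"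
  then show "Vstar S A qt c x \<le> V x"
    unfolding Vstar_eq_value_lim[OF x] by (intro solution_ge_value_lim x) auto
qed

end

context ctmdp_model
begin

theorem Vstar_minimal_lsc_solution:
  assumes weakly_continuous_rates "lsc_on (S \<times> A) (\<lambda>(x, a). c x a)" "compact A"
  shows "minimal_solution (lsc_on S) (Vstar S A qt c)"
proof -
  interpret ctmdp_regular S A qt c "closedin (top_of_set S)" using assms by (rule ctmdp_regular_lsc)
  have "regular = lsc_on S" unfolding fun_eq_iff regular_def lsc_on_iff_closedin by blast
  then show ?thesis using Vstar_minimal_regular_solution by simp
qed

theorem Vstar_minimal_measurable_solution:
  assumes strongly_continuous_rates "\<And>x. x \<in> S \<Longrightarrow> lsc_on A (c x)" "compact A"
  shows "minimal_solution (\<lambda>V. V \<in> borel_measurable borel_S) (Vstar S A qt c)"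
proof -
  interpret ctmdp_regular S A qt c "\<lambda>X. X \<in> sets borel_S"
    using assms by (rule ctmdp_regular_measurable)
  have "regular V \<longleftrightarrow> V \<in> borel_measurable borel_S" for V
  proof
    assume [measurable]: "V \<in> borel_measurable borel_S"
    have "{x\<in>space borel_S. V x \<le> u} \<in> sets borel_S" for u by measurable
    then show "regular V" unfolding regular_def by simp
  qed (rule measurable_regular)
  then have "regular = (\<lambda>V. V \<in> borel_measurable borel_S)" by blast
  then show ?thesis using Vstar_minimal_regular_solution by simp
qed

end

theorem theorem5p3:
  fixes S :: "'s::polish_space set" and A :: "'b::polish_space set"
    and qt :: "'s \<Rightarrow> 'b \<Rightarrow> 's measure" and c :: "'s \<Rightarrow> 'b \<Rightarrow> real"
  assumes model: "ctmdp S A qt c"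
    and cbar: "\<forall>x\<in>S. bdd_above ((\<lambda>a. c x a) ` A)"
  shows
    "((\<exists>w :: 's \<Rightarrow> real. continuous_on S w \<and> w \<in> borel_measurable (restrict_space borel S) \<and>
          (\<forall>x\<in>S. 1 \<le> w x \<and> 1 + (SUP a\<in>A. c x a) + (SUP a\<in>A. qrate S qt x a) \<le> w x))
      \<and> (\<forall>f :: 's \<Rightarrow> real. continuous_on S f \<and> bounded (f ` S) \<longrightarrow>
            continuous_on (S \<times> A) (\<lambda>(x, a). \<integral> y. f y \<partial>qt x a))
      \<and> lsc_on (S \<times> A) (\<lambda>(x, a). c x a)
      \<and> compact A
      \<longrightarrow>
        (\<forall>x\<in>S. 1 \<le> Vstar S A qt c x) \<and> lsc_on S (Vstar S A qt c) \<and> opt_eq S A qt c (Vstar S A qt c)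
        \<and> (\<forall>V. (\<forall>x\<in>S. 1 \<le> V x) \<and> lsc_on S V \<and> opt_eq S A qt c V \<longrightarrow>
                (\<forall>x\<in>S. Vstar S A qt c x \<le> V x)))
     \<and>
     ((\<forall>f :: 's \<Rightarrow> real. f \<in> borel_measurable (restrict_space borel S) \<and> bounded (f ` S) \<longrightarrow>
            (\<forall>x\<in>S. continuous_on A (\<lambda>a. \<integral> y. f y \<partial>qt x a)))
      \<and> (\<forall>x\<in>S. lsc_on A (\<lambda>a. c x a))
      \<and> compact A
      \<longrightarrow>
        (\<forall>x\<in>S. 1 \<le> Vstar S A qt c x)
        \<and> Vstar S A qt c \<in> borel_measurable (restrict_space borel S)
        \<and> opt_eq S A qt c (Vstar S A qt c)
        \<and> (\<forall>V. (\<forall>x\<in>S. 1 \<le> V x) \<and> V \<in> borel_measurable (restrict_space borel S) \<and> opt_eq S A qt c V \<longrightarrow>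
                (\<forall>x\<in>S. Vstar S A qt c x \<le> V x)))"
proof -
  interpret ctmdp_model S A qt c using model cbar by unfold_locales auto
  have lsc: "weakly_continuous_rates \<and> lsc_on (S \<times> A) (\<lambda>(x, a). c x a) \<and> compact A
      \<longrightarrow> minimal_solution (lsc_on S) (Vstar S A qt c)"
    using Vstar_minimal_lsc_solution by blast
  have measurable: "strongly_continuous_rates \<and> (\<forall>x\<in>S. lsc_on A (\<lambda>a. c x a)) \<and> compact A
      \<longrightarrow> minimal_solution (\<lambda>V. V \<in> borel_measurable borel_S) (Vstar S A qt c)"
    using Vstar_minimal_measurable_solution by blast
  show ?thesis
    using lsc measurable
    unfolding minimal_solution_def weakly_continuous_rates_def strongly_continuous_rates_def by blast
qed

end
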